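(* Let $\Omega\subset\mathbb R^n$ be a bounded open set with $C^2$ boundary, let $L,F,G$ satisfy the assumptions below. Let $(u,m)$ be a mild solution of the constrained MFG problem in $\overline\Omega$ and let $(t,x)\in\partial Q_m$. Then $$-p_1+H^\tau(x,p_2)=F(x,m(t))\qquad\forall(p_1,p_2)\in D^+u(t,x).$$
   Context: $T>0$; $U\supset\overline\Omega$ open; $\nu(x)$ the outward unit normal at $x\in\partial\Omega$; $\mathcal P(\overline\Omega)$ with the Kantorovich–Rubinstein distance $d_1$. Assumptions: (D1) $|F(x,m_1)-F(x,m_2)|+|G(x,m_1)-G(x,m_2)|\le\kappa d_1(m_1,m_2)$; (D2) $F(\cdot,m),G(\cdot,m)\in C^1_b(U)$, $|D_xF|+|D_xG|\le\kappa$; (D3) $x\mapsto F(x,m)$ semiconcave with linear modulus uniformly in $m$; (L0) $L\in C^1(U\times\mathbb R^n)$, $|L(x,0)|+|D_xL(x,0)|+|D_vL(x,0)|\le M$; (L1) $D_vL$ differentiable, $I/\mu\le D^2_{vv}L\le\mu I$, $\|D^2_{vx}L(x,v)\|\le\mu(1+|v|)$; (L2) $|D_xL(x,v)-D_xL(x,w)|\le C(R)|v-w|$ for $v,w\in B_R$; (L3) $x\mapsto L(x,v)$ semiconcave with linear modulus uniformly in $v\in B_R$. $H(x,p)=\sup_v\{-\langle p,v\rangle-L(x,v)\}$. Tangential Hamiltonian: for $x\in\partial\Omega$, $H^\tau(x,p)=\sup\{-\langle p,v\rangle-L(x,v):v\in\mathbb R^n,\ \langle v,\nu(x)\rangle=0\}$.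 $\Gamma$: absolutely continuous curves $[0,T]\to\overline\Omega$; $\Gamma_t[x]=\{\gamma:\gamma(t)=x\}$; $e_t(\gamma)=\gamma(t)$; $m^\eta(t)=e_t\sharp\eta$; $J_\eta[\gamma]=\int_0^T[L(\gamma,\dot\gamma)+F(\gamma,m^\eta(t))]dt+G(\gamma(T),m^\eta(T))$; $\Gamma^\eta[x]$ minimizers of $J_\eta$ over $\Gamma_0[x]$. Constrained MFG equilibrium for $m_0$: Borel probability $\eta$ on $\Gamma$ with $e_0\sharp\eta=m_0$ and $\mathrm{supp}\,\eta\subset\bigcup_x\Gamma^\eta[x]$. Mild solution: $(u,m)\in C([0,T]\times\overline\Omega)\times C([0,T];\mathcal P(\overline\Omega))$ with, for some equilibrium $\eta$, $m(t)=e_t\sharp\eta$ and $u(t,x)=\inf_{\gamma\in\Gamma_t[x]}\{\int_t^T[L(\gamma,\dot\gamma)+F(\gamma(s),m(s))]ds+G(\gamma(T),m(T))\}$. $\partial Q_m=\{(t,x)\in(0,T)\times\partial\Omega:x\in\mathrm{supp}(m(t))\}$. $D^+u(t,x)$ is the set of $(p_1,p_2)\in\mathbb R\times\mathbb R^n$ with $\limsup_{(s,y)\to(t,x),(s,y)\in(0,T)\times\overline\Omega}\frac{u(s,y)-u(t,x)-p_1(s-t)-\langle p_2,y-x\rangle}{|s-t|+|y-x|}\le0$. *)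

theory Defs
  imports "HOL-Probability.Probability"
begin

definition C2_with_grad :: "'a::euclidean_space set \<Rightarrow> ('a \<Rightarrow> real) \<Rightarrow> ('a \<Rightarrow> 'a) \<Rightarrow> bool" where
  "C2_with_grad S f g \<longleftrightarrow>
     (\<exists>Dg. (\<forall>x\<in>S. (f has_derivative (\<lambda>h. g x \<bullet> h)) (at x)) \<and>
           (\<forall>x\<in>S. (g has_derivative Dg x) (at x)) \<and>
           (\<forall>h. continuous_on S (\<lambda>x. Dg x h)))"

definition local_defining_fn :: "'a::euclidean_space set \<Rightarrow> 'a \<Rightarrow> real \<Rightarrow> ('a \<Rightarrow> real) \<Rightarrow> ('a \<Rightarrow> 'a) \<Rightarrow> bool" where
  "local_defining_fn \<Omega> x0 r \<psi> g \<longleftrightarrow>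
     r > 0 \<and> C2_with_grad (ball x0 r) \<psi> g \<and> (\<forall>y\<in>ball x0 r. g y \<noteq> 0) \<and>
     \<Omega> \<inter> ball x0 r = {y \<in> ball x0 r. \<psi> y < 0}"

definition C2_boundary :: "'a::euclidean_space set \<Rightarrow> bool" where
  "C2_boundary \<Omega> \<longleftrightarrow> (\<forall>x0\<in>frontier \<Omega>. \<exists>r \<psi> g. local_defining_fn \<Omega> x0 r \<psi> g)"

definition outward_normal :: "'a::euclidean_space set \<Rightarrow> 'a \<Rightarrow> 'a" where
  "outward_normal \<Omega> x = (SOME \<nu>. \<exists>r \<psi> g. local_defining_fn \<Omega> x r \<psi> g \<and> \<nu> = g x /\<^sub>R norm (g x))"

definition Prob_on :: "'a::euclidean_space set \<Rightarrow> 'a measure set" where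
  "Prob_on K = {\<mu>. prob_space \<mu> \<and> sets \<mu> = sets borel \<and> emeasure \<mu> K = 1}"

definition KR_dist :: "'a::euclidean_space measure \<Rightarrow> 'a measure \<Rightarrow> real" where
  "KR_dist \<mu> \<nu> = (SUP f\<in>{f. 1-lipschitz_on UNIV f}. (\<integral>x. f x \<partial>\<mu>) - (\<integral>x. f x \<partial>\<nu>))"

definition msupport :: "'b::topological_space measure \<Rightarrow> 'b set" where
  "msupport M = {x. \<forall>S. open S \<and> x \<in> S \<longrightarrow> emeasure M S > 0}"

definition abs_cont_on :: "real set \<Rightarrow> (real \<Rightarrow> 'a::real_normed_vector) \<Rightarrow> bool" where
  "abs_cont_on S \<gamma> \<longleftrightarrow>
     (\<forall>\<epsilon>>0. \<exists>\<delta>>0. \<forall>(I::nat set) a b. finite I \<and> (\<forall>i\<in>I. a i \<le> b i \<and> a i \<in> S \<and> b i \<in> S) \<and>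
        pairwise (\<lambda>i j. {a i<..<b i} \<inter> {a j<..<b j} = {}) I \<and> (\<Sum>i\<in>I. b i - a i) < \<delta>
        \<longrightarrow> (\<Sum>i\<in>I. norm (\<gamma> (b i) - \<gamma> (a i))) < \<epsilon>)"

text \<open>Continuous curves [0,T] \<rightarrow> closure \<Omega>, represented as bounded continuous
  functions on the real line that are constant outside [0,T] (so the sup metric is
  the uniform metric on [0,T]).\<close>
definition Cpaths :: "'a::euclidean_space set \<Rightarrow> real \<Rightarrow> (real \<Rightarrow>\<^sub>C 'a) set" where
  "Cpaths \<Omega> T = {\<gamma>. (\<forall>s. apply_bcontfun \<gamma> s = apply_bcontfun \<gamma> (max 0 (min T s))) \<and>
                    (\<forall>s\<in>{0..T}. apply_bcontfun \<gamma> s \<in> closure \<Omega>)}"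

definition Gamma :: "'a::euclidean_space set \<Rightarrow> real \<Rightarrow> (real \<Rightarrow>\<^sub>C 'a) set" where
  "Gamma \<Omega> T = {\<gamma> \<in> Cpaths \<Omega> T. abs_cont_on {0..T} (apply_bcontfun \<gamma>)}"

definition Gamma_at :: "'a::euclidean_space set \<Rightarrow> real \<Rightarrow> real \<Rightarrow> 'a \<Rightarrow> (real \<Rightarrow>\<^sub>C 'a) set" where
  "Gamma_at \<Omega> T t x = {\<gamma> \<in> Gamma \<Omega> T. apply_bcontfun \<gamma> t = x}"

definition ext_integral :: "real set \<Rightarrow> (real \<Rightarrow> real) \<Rightarrow> ereal" where
  "ext_integral S f = enn2ereal (\<integral>\<^sup>+s\<in>S. ennreal (f s) \<partial>lebesgue)
                       - enn2ereal (\<integral>\<^sup>+s\<in>S. ennreal (- f s) \<partial>lebesgue)"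

definition cost :: "('a::euclidean_space \<Rightarrow> 'a \<Rightarrow> real) \<Rightarrow> ('a \<Rightarrow> 'a measure \<Rightarrow> real) \<Rightarrow>
    ('a \<Rightarrow> 'a measure \<Rightarrow> real) \<Rightarrow> real \<Rightarrow> (real \<Rightarrow> 'a measure) \<Rightarrow> real \<Rightarrow> (real \<Rightarrow>\<^sub>C 'a) \<Rightarrow> ereal" where
  "cost L F G T m t \<gamma> =
     ext_integral {t..T} (\<lambda>s. L (apply_bcontfun \<gamma> s) (vector_derivative (apply_bcontfun \<gamma>) (at s))
                              + F (apply_bcontfun \<gamma> s) (m s))
     + ereal (G (apply_bcontfun \<gamma> T) (m T))"

definition eval_flow :: "(real \<Rightarrow>\<^sub>C 'a::euclidean_space) measure \<Rightarrow> real \<Rightarrow> 'a measure" where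
  "eval_flow \<eta> t = distr \<eta> borel (\<lambda>\<gamma>. apply_bcontfun \<gamma> t)"

definition optimal_curves :: "'a::euclidean_space set \<Rightarrow> real \<Rightarrow> ('a \<Rightarrow> 'a \<Rightarrow> real) \<Rightarrow>
    ('a \<Rightarrow> 'a measure \<Rightarrow> real) \<Rightarrow> ('a \<Rightarrow> 'a measure \<Rightarrow> real) \<Rightarrow> (real \<Rightarrow>\<^sub>C 'a) measure \<Rightarrow> 'a \<Rightarrow> (real \<Rightarrow>\<^sub>C 'a) set" where
  "optimal_curves \<Omega> T L F G \<eta> x =
     {\<gamma> \<in> Gamma_at \<Omega> T 0 x. \<forall>\<gamma>'\<in>Gamma_at \<Omega> T 0 x.
        cost L F G T (eval_flow \<eta>) 0 \<gamma> \<le> cost L F G T (eval_flow \<eta>) 0 \<gamma>'}"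

definition constrained_equilibrium :: "'a::euclidean_space set \<Rightarrow> real \<Rightarrow> ('a \<Rightarrow> 'a \<Rightarrow> real) \<Rightarrow>
    ('a \<Rightarrow> 'a measure \<Rightarrow> real) \<Rightarrow> ('a \<Rightarrow> 'a measure \<Rightarrow> real) \<Rightarrow> 'a measure \<Rightarrow> (real \<Rightarrow>\<^sub>C 'a) measure \<Rightarrow> bool" where
  "constrained_equilibrium \<Omega> T L F G m0 \<eta> \<longleftrightarrow>
     prob_space \<eta> \<and> sets \<eta> = sets borel \<and> emeasure \<eta> (Cpaths \<Omega> T) = 1 \<and>
     eval_flow \<eta> 0 = m0 \<and>
     msupport \<eta> \<subseteq> (\<Union>x\<in>closure \<Omega>. optimal_curves \<Omega> T L F G \<eta> x)"

definition mild_solution :: "'a::euclidean_space set \<Rightarrow> real \<Rightarrow> ('a \<Rightarrow> 'a \<Rightarrow> real) \<Rightarrow>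
    ('a \<Rightarrow> 'a measure \<Rightarrow> real) \<Rightarrow> ('a \<Rightarrow> 'a measure \<Rightarrow> real) \<Rightarrow>
    (real \<Rightarrow> 'a \<Rightarrow> real) \<Rightarrow> (real \<Rightarrow> 'a measure) \<Rightarrow> bool" where
  "mild_solution \<Omega> T L F G u m \<longleftrightarrow>
     continuous_on ({0..T} \<times> closure \<Omega>) (\<lambda>(t, x). u t x) \<and>
     (\<forall>t\<in>{0..T}. m t \<in> Prob_on (closure \<Omega>)) \<and>
     (\<forall>t\<in>{0..T}. \<forall>\<epsilon>>0. \<exists>\<delta>>0. \<forall>s\<in>{0..T}. \<bar>s - t\<bar> < \<delta> \<longrightarrow> KR_dist (m s) (m t) < \<epsilon>) \<and>
     (\<exists>\<eta>. constrained_equilibrium \<Omega> T L F G (m 0) \<eta> \<and>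
          (\<forall>t\<in>{0..T}. m t = eval_flow \<eta> t) \<and>
          (\<forall>t\<in>{0..T}. \<forall>x\<in>closure \<Omega>.
             ereal (u t x) = (INF \<gamma>\<in>Gamma_at \<Omega> T t x. cost L F G T m t \<gamma>)))"

definition Hamiltonian :: "('a::euclidean_space \<Rightarrow> 'a \<Rightarrow> real) \<Rightarrow> 'a \<Rightarrow> 'a \<Rightarrow> real" where
  "Hamiltonian L x p = (SUP v\<in>UNIV. - (p \<bullet> v) - L x v)"

definition tangential_Hamiltonian :: "'a::euclidean_space set \<Rightarrow> ('a \<Rightarrow> 'a \<Rightarrow> real) \<Rightarrow> 'a \<Rightarrow> 'a \<Rightarrow> real" where
  "tangential_Hamiltonian \<Omega> L x p =
     (SUP v\<in>{v. v \<bullet> outward_normal \<Omega> x = 0}. - (p \<bullet> v) - L x v)"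

definition superdiff :: "'a::euclidean_space set \<Rightarrow> real \<Rightarrow> (real \<Rightarrow> 'a \<Rightarrow> real) \<Rightarrow> real \<Rightarrow> 'a \<Rightarrow> (real \<times> 'a) set" where
  "superdiff \<Omega> T u t x =
     {(p1, p2). \<forall>\<epsilon>>0. \<exists>\<delta>>0. \<forall>s y. s \<in> {0<..<T} \<and> y \<in> closure \<Omega> \<and> \<bar>s - t\<bar> + norm (y - x) < \<delta> \<longrightarrow>
        u s y - u t x - p1 * (s - t) - p2 \<bullet> (y - x) \<le> \<epsilon> * (\<bar>s - t\<bar> + norm (y - x))}"

definition boundary_Q :: "'a::euclidean_space set \<Rightarrow> real \<Rightarrow> (real \<Rightarrow> 'a measure) \<Rightarrow> (real \<times> 'a) set" where
  "boundary_Q \<Omega> T m = {(t, x). t \<in> {0<..<T} \<and> x \<in> frontier \<Omega> \<and> x \<in> msupport (m t)}"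

definition semiconcave_lin :: "'a::euclidean_space set \<Rightarrow> real \<Rightarrow> ('a \<Rightarrow> real) \<Rightarrow> bool" where
  "semiconcave_lin U C f \<longleftrightarrow>
     (\<forall>x h. closed_segment (x - h) (x + h) \<subseteq> U \<longrightarrow> f (x + h) + f (x - h) - 2 * f x \<le> C * (norm h)\<^sup>2)"

end

theory Submission
  imports Defs "HOL-Complex_Analysis.Great_Picard"
begin

text \<open>
  Fix \<open>(p\<^sub>1, p\<^sub>2)\<close> in the superdifferential at \<open>(t, x)\<close> and call
  \<open>L(x,v) + F(x,m(t)) + p\<^sub>1 + \<langle>p\<^sub>2,v\<rangle>\<close> the defect of the equation at \<open>v\<close>; the claim is that the
  defect has minimum 0 on the tangent hyperplane. Running along a straight line into the domain and using
  dynamic programming shows it to be nonnegative at strictly inward velocities, hence at tangential ones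
  by continuity.

  For the converse, optimal curves have uniformly bounded energy, so by compactness some optimal curve
  \<open>\<gamma>\<close> in the support of the equilibrium satisfies \<open>\<gamma>(t) = x\<close>. Testing the superdifferential along \<open>\<gamma>\<close>
  backwards in time bounds the mean velocities over \<open>[t - h, t]\<close> and shows that the defect is nonpositive at
  each of their limits \<open>v\<close>. No regularity theory for constrained minimisers is needed to see that \<open>v\<close> is
  tangential: replacing \<open>\<gamma>\<close> on \<open>[t - h, t + h]\<close> by its chord, pushed slightly into the domain, changes
  the cost by \<open>o(h)\<close> only, whereas strong convexity of \<open>L\<close> gains the squared deviation of the velocity
  from its mean. Thus the mean velocities before and after \<open>t\<close> have the same limit, the former pointing out of
  the domain and the latter into it.

  Since curves are only absolutely continuous, this rests on the fundamental theorem of calculus for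
  such curves, which is obtained from Radon-Nikodym applied to the variation measure and from
  Lebesgue's differentiation theorem.
\<close>

section \<open>Absolutely continuous curves\<close>

definition nonoverlapping_in :: "real set \<Rightarrow> 'i set \<Rightarrow> ('i \<Rightarrow> real) \<Rightarrow> ('i \<Rightarrow> real) \<Rightarrow> bool" where
  "nonoverlapping_in S I a b \<longleftrightarrow> finite I \<and> (\<forall>i\<in>I. a i \<le> b i \<and> a i \<in> S \<and> b i \<in> S) \<and>
     pairwise (\<lambda>i j. {a i<..<b i} \<inter> {a j<..<b j} = {}) I"

definition increment_sum :: "(real \<Rightarrow> 'b::real_normed_vector) \<Rightarrow> 'i set \<Rightarrow> ('i \<Rightarrow> real) \<Rightarrow> ('i \<Rightarrow> real) \<Rightarrow> real" where
  "increment_sum f I a b = (\<Sum>i\<in>I. norm (f (b i) - f (a i)))"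

lemma nonoverlapping_inI:
  assumes "finite I" "\<And>i. i \<in> I \<Longrightarrow> a i \<le> b i" "\<And>i. i \<in> I \<Longrightarrow> a i \<in> S" "\<And>i. i \<in> I \<Longrightarrow> b i \<in> S"
    and "\<And>i j. i \<in> I \<Longrightarrow> j \<in> I \<Longrightarrow> i \<noteq> j \<Longrightarrow> {a i<..<b i} \<inter> {a j<..<b j} = {}"
  shows "nonoverlapping_in S I a b"
  unfolding nonoverlapping_in_def pairwise_def using assms(1-4) by (intro conjI ballI impI assms(5)) simp_all

lemma nonoverlapping_inD:
  assumes "nonoverlapping_in S I a b"
  shows "finite I" "\<And>i. i \<in> I \<Longrightarrow> a i \<le> b i" "\<And>i. i \<in> I \<Longrightarrow> a i \<in> S" "\<And>i. i \<in> I \<Longrightarrow> b i \<in> S"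
    and "\<And>i j. i \<in> I \<Longrightarrow> j \<in> I \<Longrightarrow> i \<noteq> j \<Longrightarrow> {a i<..<b i} \<inter> {a j<..<b j} = {}"
  using assms unfolding nonoverlapping_in_def by (simp_all add: pairwise_def)

lemma nonoverlapping_in_mono:
  "nonoverlapping_in S I a b \<Longrightarrow> S \<subseteq> S' \<Longrightarrow> nonoverlapping_in S' I a b"
  unfolding nonoverlapping_in_def by blast

lemma nonoverlapping_in_singleton:
  "x \<le> y \<Longrightarrow> x \<in> S \<Longrightarrow> y \<in> S \<Longrightarrow> nonoverlapping_in S {i} (\<lambda>_. x) (\<lambda>_. y)"
  by (auto simp: nonoverlapping_in_def)

lemma nonoverlapping_in_reindex:
  assumes "nonoverlapping_in S I a b" "bij_betw h J I"
  shows "nonoverlapping_in S J (a \<circ> h) (b \<circ> h)"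
proof (rule nonoverlapping_inI)
  note fam = nonoverlapping_inD[OF assms(1)] and mem = bij_betw_apply[OF assms(2)]
  show "finite J" using fam(1) bij_betw_finite[OF assms(2)] by simp
  show "{(a \<circ> h) i<..<(b \<circ> h) i} \<inter> {(a \<circ> h) j<..<(b \<circ> h) j} = {}" if "i \<in> J" "j \<in> J" "i \<noteq> j" for i j
    using fam(5)[OF mem[OF that(1)] mem[OF that(2)]] inj_on_eq_iff[OF bij_betw_imp_inj_on[OF assms(2)]] that
    by simp
qed (use nonoverlapping_inD[OF assms(1)] bij_betw_apply[OF assms(2)] in auto)

lemma increment_sum_reindex:
  "bij_betw h J I \<Longrightarrow> increment_sum f J (a \<circ> h) (b \<circ> h) = increment_sum f I a b"
  unfolding increment_sum_def o_def by (rule sum.reindex_bij_betw)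

lemma nonoverlapping_in_image_mono:
  assumes "nonoverlapping_in R I a b" "mono_on R r" "r ` R \<subseteq> S"
  shows "nonoverlapping_in S I (r \<circ> a) (r \<circ> b)"
proof (rule nonoverlapping_inI)
  note fam = nonoverlapping_inD[OF assms(1)]
  fix i j assume ij: "i \<in> I" "j \<in> I" "i \<noteq> j"
  have "b i \<le> a j \<or> b j \<le> a i \<or> a i = b i \<or> a j = b j"
  proof (rule ccontr)
    assume "\<not> ?thesis"
    then have "max (a i) (a j) < min (b i) (b j)" using fam(2)[OF ij(1)] fam(2)[OF ij(2)] by auto
    then obtain z where "max (a i) (a j) < z" "z < min (b i) (b j)" using dense by blast
    then have "z \<in> {a i<..<b i} \<inter> {a j<..<b j}" by auto
    then show False using fam(5)[OF ij] by auto
  qed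
  then show "{(r \<circ> a) i<..<(r \<circ> b) i} \<inter> {(r \<circ> a) j<..<(r \<circ> b) j} = {}"
    using mono_onD[OF assms(2), of "b i" "a j"] mono_onD[OF assms(2), of "b j" "a i"] fam ij by auto
qed (use nonoverlapping_inD[OF assms(1)] assms(2,3) in \<open>auto intro: mono_onD\<close>)

lemma nonoverlapping_length_le:
  assumes "nonoverlapping_in {x..y} I a b" "x \<le> y"
  shows "(\<Sum>i\<in>I. b i - a i) \<le> y - x"
proof -
  note fam = nonoverlapping_inD[OF assms(1)]
  have "(\<Sum>i\<in>I. b i - a i) = (\<Sum>i\<in>I. measure lborel {a i<..<b i})"
    using fam by (intro sum.cong) auto
  also have "\<dots> = measure lborel (\<Union>i\<in>I. {a i<..<b i})"
    using fam by (intro measure_finite_Union[symmetric]) (auto simp: disjoint_family_on_def)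
  also have "\<dots> \<le> measure lborel {x..y}"
  proof (rule measure_mono_fmeasurable)
    show "(\<Union>i\<in>I. {a i<..<b i}) \<subseteq> {x..y}" using fam(3,4) by fastforce
    show "(\<Union>i\<in>I. {a i<..<b i}) \<in> sets lborel" using fam(1) by (intro sets.finite_UN) auto
    show "{x..y} \<in> fmeasurable lborel" using fmeasurable_cbox[of x y] by simp
  qed
  finally show ?thesis using assms(2) by simp
qed

lemma nonoverlapping_in_Sigma:
  assumes outer: "nonoverlapping_in S I a b"
    and inner: "\<And>i. i \<in> I \<Longrightarrow> nonoverlapping_in {a i..b i} (J i) (p i) (q i)"
  shows "nonoverlapping_in (\<Union>i\<in>I. {a i..b i}) (Sigma I J) (\<lambda>(i, j). p i j) (\<lambda>(i, j). q i j)"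
proof (rule nonoverlapping_inI)
  note O = nonoverlapping_inD[OF outer] and N = nonoverlapping_inD[OF inner]
  show "finite (Sigma I J)" using O(1) N(1) by (rule finite_SigmaI)
  show "(case k of (i, j) \<Rightarrow> p i j) \<le> (case k of (i, j) \<Rightarrow> q i j)"
    "(case k of (i, j) \<Rightarrow> p i j) \<in> (\<Union>i\<in>I. {a i..b i})" "(case k of (i, j) \<Rightarrow> q i j) \<in> (\<Union>i\<in>I. {a i..b i})"
    if "k \<in> Sigma I J" for k
    using that N(2-4) by (auto intro!: bexI[of _ "fst k"])
  fix k l assume kl: "k \<in> Sigma I J" "l \<in> Sigma I J" "k \<noteq> l"
  obtain i j i' j' where pairs: "k = (i, j)" "l = (i', j')" by fastforce
  have sub: "{p i j<..<q i j} \<subseteq> {a i<..<b i}" if "i \<in> I" "j \<in> J i" for i j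
    using N(3,4)[OF that] by auto
  show "{(case k of (i, j) \<Rightarrow> p i j)<..<(case k of (i, j) \<Rightarrow> q i j)} \<inter>
      {(case l of (i, j) \<Rightarrow> p i j)<..<(case l of (i, j) \<Rightarrow> q i j)} = {}"
  proof (cases "i = i'")
    case True
    then show ?thesis using N(5)[of i j j'] kl pairs by auto
  next
    case False
    then have "{a i<..<b i} \<inter> {a i'<..<b i'} = {}" using O(5) kl pairs by blast
    moreover have "{p i j<..<q i j} \<subseteq> {a i<..<b i}" "{p i' j'<..<q i' j'} \<subseteq> {a i'<..<b i'}"
      using sub kl pairs by auto
    ultimately show ?thesis unfolding pairs prod.case by blast
  qed
qed

lemma abs_cont_onI:
  assumes "\<And>\<epsilon>. \<epsilon> > 0 \<Longrightarrow> \<exists>\<delta>>0. \<forall>(I::nat set) a b. nonoverlapping_in S I a b \<longrightarrow> (\<Sum>i\<in>I. b i - a i) < \<delta>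
      \<longrightarrow> increment_sum f I a b < \<epsilon>"
  shows "abs_cont_on S f"
  using assms unfolding abs_cont_on_def nonoverlapping_in_def increment_sum_def imp_conjL by simp

lemma abs_cont_onE:
  fixes f :: "real \<Rightarrow> 'b::real_normed_vector"
  assumes "abs_cont_on S f" "\<epsilon> > 0"
  obtains \<delta> where "\<delta> > 0"
    "\<And>(I::'i set) a b. nonoverlapping_in S I a b \<Longrightarrow> (\<Sum>i\<in>I. b i - a i) < \<delta> \<Longrightarrow> increment_sum f I a b < \<epsilon>"
proof -
  obtain \<delta> where "\<delta> > 0" and \<delta>: "\<And>(I::nat set) a b. nonoverlapping_in S I a b \<Longrightarrow> (\<Sum>i\<in>I. b i - a i) < \<delta>
      \<Longrightarrow> increment_sum f I a b < \<epsilon>"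
    using assms(1)[unfolded abs_cont_on_def, rule_format, OF assms(2)]
    unfolding nonoverlapping_in_def increment_sum_def by auto
  have "increment_sum f I a b < \<epsilon>"
    if fam: "nonoverlapping_in S I a b" and len: "(\<Sum>i\<in>I. b i - a i) < \<delta>" for I :: "'i set" and a b
  proof -
    obtain h where h: "bij_betw h {0..<card I} I"
      using ex_bij_betw_nat_finite[OF nonoverlapping_inD(1)[OF fam]] by blast
    have "(\<Sum>k = 0..<card I. (b \<circ> h) k - (a \<circ> h) k) < \<delta>"
      using len sum.reindex_bij_betw[OF h, of "\<lambda>i. b i - a i"] by simp
    from \<delta>[OF nonoverlapping_in_reindex[OF fam h] this] show ?thesis
      unfolding increment_sum_reindex[OF h] .
  qed
  with \<open>\<delta> > 0\<close> show ?thesis by (rule that)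
qed

lemma abs_cont_on_imp_continuous_on:
  fixes f :: "real \<Rightarrow> 'b::real_normed_vector"
  assumes "abs_cont_on S f"
  shows "continuous_on S f"
  unfolding continuous_on_iff
proof (intro ballI allI impI)
  fix x and \<epsilon> :: real assume "x \<in> S" "\<epsilon> > 0"
  obtain \<delta> where "\<delta> > 0" and \<delta>: "\<And>(I::unit set) a b. nonoverlapping_in S I a b \<Longrightarrow>
      (\<Sum>i\<in>I. b i - a i) < \<delta> \<Longrightarrow> increment_sum f I a b < \<epsilon>"
    by (rule abs_cont_onE[OF assms \<open>\<epsilon> > 0\<close>]) (rule that)
  have "dist (f y) (f x) < \<epsilon>" if "y \<in> S" "dist y x < \<delta>" for y
    using \<delta>[OF nonoverlapping_in_singleton[of x y S]] \<delta>[OF nonoverlapping_in_singleton[of y x S]] \<open>x \<in> S\<close> that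
    by (cases "x \<le> y") (auto simp: increment_sum_def dist_norm norm_minus_commute)
  then show "\<exists>\<delta>>0. \<forall>y\<in>S. dist y x < \<delta> \<longrightarrow> dist (f y) (f x) < \<epsilon>"
    using \<open>\<delta> > 0\<close> by blast
qed

lemma abs_cont_on_compose_norm_le:
  fixes f :: "real \<Rightarrow> 'b::real_normed_vector" and g :: "real \<Rightarrow> 'c::real_normed_vector"
  assumes f: "abs_cont_on S f" and r: "mono_on R r" "1-lipschitz_on R r" "r ` R \<subseteq> S"
    and g: "\<And>x y. x \<in> R \<Longrightarrow> y \<in> R \<Longrightarrow> norm (g x - g y) \<le> norm (f (r x) - f (r y))"
  shows "abs_cont_on R g"
proof (rule abs_cont_onI)
  fix \<epsilon> :: real assume "\<epsilon> > 0"
  obtain \<delta> where "\<delta> > 0" and \<delta>: "\<And>(I::nat set) a b. nonoverlapping_in S I a b \<Longrightarrow>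
      (\<Sum>i\<in>I. b i - a i) < \<delta> \<Longrightarrow> increment_sum f I a b < \<epsilon>"
    by (rule abs_cont_onE[OF f \<open>\<epsilon> > 0\<close>]) (rule that)
  have "increment_sum g I a b < \<epsilon>"
    if fam: "nonoverlapping_in R I a b" and len: "(\<Sum>i\<in>I. b i - a i) < \<delta>" for I :: "nat set" and a b
  proof -
    note I = nonoverlapping_inD[OF fam]
    have "increment_sum g I a b \<le> increment_sum f I (r \<circ> a) (r \<circ> b)"
      unfolding increment_sum_def using I g by (intro sum_mono) auto
    also have "\<dots> < \<epsilon>"
    proof (rule \<delta>[OF nonoverlapping_in_image_mono[OF fam r(1,3)]])
      have "(r \<circ> b) i - (r \<circ> a) i \<le> b i - a i" if "i \<in> I" for i
        using lipschitz_onD[OF r(2), of "b i" "a i"] I that by (fastforce simp: dist_real_def)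
      then show "(\<Sum>i\<in>I. (r \<circ> b) i - (r \<circ> a) i) < \<delta>" by (rule le_less_trans[OF sum_mono len])
    qed
    finally show ?thesis .
  qed
  then show "\<exists>\<delta>>0. \<forall>(I::nat set) a b. nonoverlapping_in R I a b \<longrightarrow> (\<Sum>i\<in>I. b i - a i) < \<delta>
      \<longrightarrow> increment_sum g I a b < \<epsilon>"
    using \<open>\<delta> > 0\<close> by blast
qed

lemma abs_cont_on_norm_le:
  fixes f :: "real \<Rightarrow> 'b::real_normed_vector" and g :: "real \<Rightarrow> 'c::real_normed_vector"
  assumes "abs_cont_on S f" "\<And>x y. x \<in> S \<Longrightarrow> y \<in> S \<Longrightarrow> norm (g x - g y) \<le> norm (f x - f y)"
  shows "abs_cont_on S g"
  by (rule abs_cont_on_compose_norm_le[OF assms(1), where r = "\<lambda>x. x"])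
    (use assms(2) in \<open>auto simp: mono_on_def lipschitz_on_def\<close>)

lemma abs_cont_on_compose:
  fixes f :: "real \<Rightarrow> 'b::real_normed_vector"
  assumes "abs_cont_on S f" "mono_on R r" "1-lipschitz_on R r" "r ` R \<subseteq> S"
  shows "abs_cont_on R (\<lambda>x. f (r x))"
  by (rule abs_cont_on_compose_norm_le[OF assms]) simp

lemma abs_cont_on_add:
  fixes f g :: "real \<Rightarrow> 'b::real_normed_vector"
  assumes "abs_cont_on S f" "abs_cont_on S g"
  shows "abs_cont_on S (\<lambda>x. f x + g x)"
proof (rule abs_cont_onI)
  fix \<epsilon> :: real assume "\<epsilon> > 0"
  then have "\<epsilon> / 2 > 0" by simp
  obtain \<delta> where "\<delta> > 0" and \<delta>: "\<And>(I::nat set) a b. nonoverlapping_in S I a b \<Longrightarrow>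
      (\<Sum>i\<in>I. b i - a i) < \<delta> \<Longrightarrow> increment_sum f I a b < \<epsilon> / 2"
    by (rule abs_cont_onE[OF assms(1) \<open>\<epsilon> / 2 > 0\<close>]) (rule that)
  obtain \<delta>' where "\<delta>' > 0" and \<delta>': "\<And>(I::nat set) a b. nonoverlapping_in S I a b \<Longrightarrow>
      (\<Sum>i\<in>I. b i - a i) < \<delta>' \<Longrightarrow> increment_sum g I a b < \<epsilon> / 2"
    by (rule abs_cont_onE[OF assms(2) \<open>\<epsilon> / 2 > 0\<close>]) (rule that)
  have "increment_sum (\<lambda>x. f x + g x) I a b < \<epsilon>"
    if "nonoverlapping_in S I a b" "(\<Sum>i\<in>I. b i - a i) < min \<delta> \<delta>'" for I :: "nat set" and a b
  proof -
    have "increment_sum (\<lambda>x. f x + g x) I a b \<le> increment_sum f I a b + increment_sum g I a b"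
      unfolding increment_sum_def sum.distrib[symmetric]
      by (intro sum_mono) (metis add_diff_add norm_triangle_ineq)
    also have "\<dots> < \<epsilon> / 2 + \<epsilon> / 2" using \<delta> \<delta>' that by (intro add_strict_mono) auto
    finally show ?thesis by simp
  qed
  then show "\<exists>\<delta>>0. \<forall>(I::nat set) a b. nonoverlapping_in S I a b \<longrightarrow> (\<Sum>i\<in>I. b i - a i) < \<delta>
      \<longrightarrow> increment_sum (\<lambda>x. f x + g x) I a b < \<epsilon>"
    using \<open>\<delta> > 0\<close> \<open>\<delta>' > 0\<close> by (intro exI[of _ "min \<delta> \<delta>'"]) auto
qed

lemma lipschitz_on_imp_abs_cont_on:
  fixes f :: "real \<Rightarrow> 'b::real_normed_vector"
  assumes "C-lipschitz_on S f"
  shows "abs_cont_on S f"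
proof (rule abs_cont_onI)
  fix \<epsilon> :: real assume "\<epsilon> > 0"
  have "C \<ge> 0" by (rule lipschitz_on_nonneg[OF assms])
  have "increment_sum f I a b < \<epsilon>"
    if fam: "nonoverlapping_in S I a b" and len: "(\<Sum>i\<in>I. b i - a i) < \<epsilon> / (C + 1)" for I :: "nat set" and a b
  proof -
    have "increment_sum f I a b \<le> (\<Sum>i\<in>I. C * (b i - a i))"
      unfolding increment_sum_def
    proof (rule sum_mono)
      fix i assume "i \<in> I"
      then show "norm (f (b i) - f (a i)) \<le> C * (b i - a i)"
        using lipschitz_onD[OF assms, of "b i" "a i"] nonoverlapping_inD(2-4)[OF fam] by (simp add: dist_norm)
    qed
    also have "\<dots> \<le> C * (\<epsilon> / (C + 1))"
      unfolding sum_distrib_left[symmetric] by (intro mult_left_mono less_imp_le[OF len] \<open>C \<ge> 0\<close>)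
    also have "\<dots> < \<epsilon>" using \<open>C \<ge> 0\<close> \<open>\<epsilon> > 0\<close> by (simp add: field_simps)
    finally show ?thesis .
  qed
  moreover have "\<epsilon> / (C + 1) > 0" using \<open>C \<ge> 0\<close> \<open>\<epsilon> > 0\<close> by simp
  ultimately show "\<exists>\<delta>>0. \<forall>(I::nat set) a b. nonoverlapping_in S I a b \<longrightarrow> (\<Sum>i\<in>I. b i - a i) < \<delta>
      \<longrightarrow> increment_sum f I a b < \<epsilon>"
    by blast
qed

lemma clamp_real_nonexpansive:
  fixes a b :: real
  assumes "a \<le> b"
  shows "mono_on R (\<lambda>s. max a (min b s))" "1-lipschitz_on R (\<lambda>s. max a (min b s))"
    "range (\<lambda>s. max a (min b s)) \<subseteq> {a..b}"
  using assms by (auto simp: mono_on_def lipschitz_on_def dist_real_def)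

lemma abs_cont_on_clamp:
  fixes f :: "real \<Rightarrow> 'b::real_normed_vector"
  assumes "abs_cont_on {a..b} f" "a \<le> b"
  shows "abs_cont_on R (\<lambda>s. f (max a (min b s)))"
  by (rule abs_cont_on_compose[OF assms(1)]) (use clamp_real_nonexpansive[OF assms(2)] in auto)

lemma abs_cont_on_join:
  fixes f g :: "real \<Rightarrow> 'b::real_normed_vector"
  assumes f: "abs_cont_on {a..b} f" and g: "abs_cont_on {a..b} g" and \<tau>: "\<tau> \<in> {a..b}" "f \<tau> = g \<tau>"
  shows "abs_cont_on {a..b} (\<lambda>s. if s \<le> \<tau> then f s else g s)"
proof -
  have "abs_cont_on {a..b} (\<lambda>s. f (min s \<tau>))"
    by (rule abs_cont_on_compose[OF f]) (use \<tau>(1) in \<open>auto simp: mono_on_def lipschitz_on_def dist_real_def\<close>)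
  moreover have "abs_cont_on {a..b} (\<lambda>s. g (max s \<tau>))"
    by (rule abs_cont_on_compose[OF g]) (use \<tau>(1) in \<open>auto simp: mono_on_def lipschitz_on_def dist_real_def\<close>)
  ultimately have "abs_cont_on {a..b} (\<lambda>s. f (min s \<tau>) + g (max s \<tau>))"
    by (rule abs_cont_on_add)
  then show ?thesis
    by (rule abs_cont_on_norm_le) (auto simp: min_def max_def \<tau>(2))
qed

definition variation_sums :: "(real \<Rightarrow> 'b::real_normed_vector) \<Rightarrow> real \<Rightarrow> real \<Rightarrow> real set" where
  "variation_sums f x y = {increment_sum f I a b | (I::nat set) a b. nonoverlapping_in {x..y} I a b}"

definition variation :: "(real \<Rightarrow> 'b::real_normed_vector) \<Rightarrow> real \<Rightarrow> real \<Rightarrow> real" where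
  "variation f x y = Sup (variation_sums f x y)"

lemma increment_sum_in_variation_sums:
  assumes "nonoverlapping_in {x..y} (I :: 'i set) a b"
  shows "increment_sum f I a b \<in> variation_sums f x y"
proof -
  obtain h where h: "bij_betw h {0..<card I} I"
    using ex_bij_betw_nat_finite[OF nonoverlapping_inD(1)[OF assms]] by blast
  show ?thesis
    unfolding variation_sums_def increment_sum_reindex[OF h, symmetric]
    using nonoverlapping_in_reindex[OF assms h] by blast
qed

lemma variation_sums_nonempty: "variation_sums f x y \<noteq> {}"
  using increment_sum_in_variation_sums[of x y "{} :: nat set"] by (auto simp: nonoverlapping_in_def)

lemma variation_sums_mono:
  assumes "{u..v} \<subseteq> {x..y}"
  shows "variation_sums f u v \<subseteq> variation_sums f x y"
  using nonoverlapping_in_mono[OF _ assms] unfolding variation_sums_def by fast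

lemma norm_diff_in_variation_sums:
  assumes "x \<le> y"
  shows "norm (f y - f x) \<in> variation_sums f x y"
  using increment_sum_in_variation_sums[OF nonoverlapping_in_singleton[of x y "{x..y}" "0::nat"]] assms
  by (auto simp: increment_sum_def)

lemma variation_sums_split:
  assumes "s \<in> variation_sums f x z" "x \<le> y" "y \<le> z"
  obtains s\<^sub>1 s\<^sub>2 where "s\<^sub>1 \<in> variation_sums f x y" "s\<^sub>2 \<in> variation_sums f y z" "s \<le> s\<^sub>1 + s\<^sub>2"
proof -
  obtain I :: "nat set" and a b where fam: "nonoverlapping_in {x..z} I a b" and s: "s = increment_sum f I a b"
    using assms(1) unfolding variation_sums_def by blast
  let ?l = "\<lambda>r. min r y" and ?u = "\<lambda>r. max r y"
  have "s \<le> increment_sum f I (?l \<circ> a) (?l \<circ> b) + increment_sum f I (?u \<circ> a) (?u \<circ> b)"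
    unfolding s increment_sum_def sum.distrib[symmetric]
  proof (rule sum_mono)
    fix i assume "i \<in> I"
    then have "f (b i) - f (a i) = (f (?l (b i)) - f (?l (a i))) + (f (?u (b i)) - f (?u (a i)))"
      using nonoverlapping_inD(2)[OF fam] by (fastforce simp: min_def max_def)
    then show "norm (f (b i) - f (a i)) \<le> norm (f ((?l \<circ> b) i) - f ((?l \<circ> a) i)) + norm (f ((?u \<circ> b) i) - f ((?u \<circ> a) i))"
      by (metis comp_apply norm_triangle_ineq)
  qed
  moreover have "nonoverlapping_in {x..y} I (?l \<circ> a) (?l \<circ> b)" "nonoverlapping_in {y..z} I (?u \<circ> a) (?u \<circ> b)"
    by (rule nonoverlapping_in_image_mono[OF fam]; use assms(2,3) in \<open>auto simp: mono_on_def\<close>)+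
  ultimately show ?thesis using that[OF increment_sum_in_variation_sums increment_sum_in_variation_sums] by blast
qed

lemma bdd_above_variation_sums_combine:
  assumes "bdd_above (variation_sums f x y)" "bdd_above (variation_sums f y z)" "x \<le> y" "y \<le> z"
  shows "bdd_above (variation_sums f x z)"
proof -
  obtain B C where B: "\<And>s. s \<in> variation_sums f x y \<Longrightarrow> s \<le> B" and C: "\<And>s. s \<in> variation_sums f y z \<Longrightarrow> s \<le> C"
    using assms(1,2) unfolding bdd_above_def by blast
  have "s \<le> B + C" if s: "s \<in> variation_sums f x z" for s
    by (rule variation_sums_split[OF s assms(3,4)]) (use B C add_mono order_trans in blast)
  then show ?thesis by (rule bdd_aboveI)
qed

lemma abs_cont_on_bdd_above_variation_sums:
  fixes f :: "real \<Rightarrow> 'b::real_normed_vector"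
  assumes f: "abs_cont_on {a..b} f" and sub: "{x..y} \<subseteq> {a..b}" and "x \<le> y"
  shows "bdd_above (variation_sums f x y)"
proof -
  obtain \<delta> where "\<delta> > 0" and \<delta>: "\<And>(I::nat set) p q. nonoverlapping_in {a..b} I p q \<Longrightarrow>
      (\<Sum>i\<in>I. q i - p i) < \<delta> \<Longrightarrow> increment_sum f I p q < 1"
    by (rule abs_cont_onE[OF f zero_less_one]) (rule that)
  have short: "bdd_above (variation_sums f x y)" if "{x..y} \<subseteq> {a..b}" "x \<le> y" "y - x < \<delta>" for x y
  proof (rule bdd_aboveI)
    fix s assume "s \<in> variation_sums f x y"
    then obtain I :: "nat set" and p q where fam: "nonoverlapping_in {x..y} I p q" and s: "s = increment_sum f I p q"
      unfolding variation_sums_def by blast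
    have "(\<Sum>i\<in>I. q i - p i) < \<delta>" using nonoverlapping_length_le[OF fam] that by linarith
    from \<delta>[OF nonoverlapping_in_mono[OF fam that(1)] this] show "s \<le> 1" by (simp add: s)
  qed
  have "bdd_above (variation_sums f x y)"
    if "{x..y} \<subseteq> {a..b}" "x \<le> y" "y - x \<le> real k * (\<delta> / 2)" for y and k :: nat
    using that
  proof (induction k arbitrary: y)
    case 0
    then show ?case using \<open>\<delta> > 0\<close> by (intro short) auto
  next
    case (Suc k)
    define z where "z = max x (y - \<delta> / 2)"
    have z: "x \<le> z" "z \<le> y" "y - z < \<delta>" "z - x \<le> real k * (\<delta> / 2)"
      using Suc.prems \<open>\<delta> > 0\<close> by (auto simp: z_def max_def field_simps)
    show ?case
      using Suc.prems(1) z by (intro bdd_above_variation_sums_combine[OF Suc.IH short]) auto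
  qed
  moreover obtain k :: nat where "(y - x) / (\<delta> / 2) \<le> k" using real_arch_simple by blast
  then have "y - x \<le> real k * (\<delta> / 2)" using \<open>\<delta> > 0\<close> by (simp add: field_simps)
  ultimately show ?thesis using sub \<open>x \<le> y\<close> by metis
qed

lemma norm_diff_le_variation:
  assumes "bdd_above (variation_sums f x y)" "x \<le> y"
  shows "norm (f y - f x) \<le> variation f x y"
  unfolding variation_def by (intro cSup_upper norm_diff_in_variation_sums assms)

lemma variation_le_combine:
  assumes "bdd_above (variation_sums f x y)" "bdd_above (variation_sums f y z)" "x \<le> y" "y \<le> z"
  shows "variation f x z \<le> variation f x y + variation f y z"
  unfolding variation_def[of f x z]
proof (rule cSup_least[OF variation_sums_nonempty])
  fix s assume s: "s \<in> variation_sums f x z"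
  obtain s\<^sub>1 s\<^sub>2 where "s\<^sub>1 \<in> variation_sums f x y" "s\<^sub>2 \<in> variation_sums f y z" "s \<le> s\<^sub>1 + s\<^sub>2"
    by (rule variation_sums_split[OF s assms(3,4)])
  then show "s \<le> variation f x y + variation f y z"
    using cSup_upper[OF _ assms(1)] cSup_upper[OF _ assms(2)] unfolding variation_def by fastforce
qed

lemma sum_Sup_le:
  fixes A :: "'i \<Rightarrow> real set"
  assumes "finite I" "\<And>i. i \<in> I \<Longrightarrow> A i \<noteq> {}" "\<And>s. (\<And>i. i \<in> I \<Longrightarrow> s i \<in> A i) \<Longrightarrow> (\<Sum>i\<in>I. s i) \<le> C"
  shows "(\<Sum>i\<in>I. Sup (A i)) \<le> C"
  using assms
proof (induction I arbitrary: C rule: finite_induct)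
  case empty
  then show ?case by simp
next
  case (insert k I)
  have "Sup (A k) \<le> C - (\<Sum>i\<in>I. Sup (A i))"
  proof (rule cSup_least)
    fix r assume r: "r \<in> A k"
    have "(\<Sum>i\<in>I. Sup (A i)) \<le> C - r"
    proof (rule insert.IH)
      fix s assume s: "\<And>i. i \<in> I \<Longrightarrow> s i \<in> A i"
      have "(\<Sum>i\<in>insert k I. (s(k := r)) i) \<le> C"
        using s r by (intro insert.prems(2)) auto
      moreover have "(\<Sum>i\<in>I. (s(k := r)) i) = (\<Sum>i\<in>I. s i)"
        using insert.hyps(2) by (intro sum.cong) auto
      ultimately show "(\<Sum>i\<in>I. s i) \<le> C - r" using insert.hyps by simp
    qed (use insert.prems in auto)
    then show "r \<le> C - (\<Sum>i\<in>I. Sup (A i))" by simp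
  qed (use insert.prems in auto)
  then show ?case using insert.hyps by simp
qed

lemma sum_variation_le:
  fixes I :: "'i set"
  assumes fam: "nonoverlapping_in S I a b"
    and refine: "\<And>(J :: ('i \<times> nat) set) p q. nonoverlapping_in (\<Union>i\<in>I. {a i..b i}) J p q \<Longrightarrow>
      (\<Sum>j\<in>J. q j - p j) \<le> (\<Sum>i\<in>I. b i - a i) \<Longrightarrow> increment_sum f J p q \<le> C"
  shows "(\<Sum>i\<in>I. variation f (a i) (b i)) \<le> C"
  unfolding variation_def
proof (rule sum_Sup_le[OF nonoverlapping_inD(1)[OF fam] variation_sums_nonempty])
  fix s assume "\<And>i. i \<in> I \<Longrightarrow> s i \<in> variation_sums f (a i) (b i)"
  then have "\<forall>i\<in>I. \<exists>(J::nat set) p q. nonoverlapping_in {a i..b i} J p q \<and> s i = increment_sum f J p q"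
    unfolding variation_sums_def by blast
  then obtain J :: "'i \<Rightarrow> nat set" and p q
    where inner: "\<And>i. i \<in> I \<Longrightarrow> nonoverlapping_in {a i..b i} (J i) (p i) (q i)"
      and s: "\<And>i. i \<in> I \<Longrightarrow> s i = increment_sum f (J i) (p i) (q i)"
    by metis
  note fin = nonoverlapping_inD(1)[OF fam] nonoverlapping_inD(1)[OF inner]
  have "(\<Sum>(i, j)\<in>Sigma I J. q i j - p i j) = (\<Sum>i\<in>I. \<Sum>j\<in>J i. q i j - p i j)"
    using fin by (simp add: sum.Sigma)
  also have "\<dots> \<le> (\<Sum>i\<in>I. b i - a i)"
    using nonoverlapping_length_le[OF inner] nonoverlapping_inD(2)[OF fam] by (intro sum_mono) auto
  finally have "increment_sum f (Sigma I J) (\<lambda>(i, j). p i j) (\<lambda>(i, j). q i j) \<le> C"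
    by (intro refine nonoverlapping_in_Sigma[OF fam inner]) (auto simp: case_prod_beta)
  moreover have "(\<Sum>i\<in>I. s i) = increment_sum f (Sigma I J) (\<lambda>(i, j). p i j) (\<lambda>(i, j). q i j)"
    using fin s by (simp add: increment_sum_def sum.Sigma case_prod_beta)
  ultimately show "(\<Sum>i\<in>I. s i) \<le> C" by simp
qed

lemma variation_additive:
  assumes bdd: "bdd_above (variation_sums f x z)" and xyz: "x \<le> y" "y \<le> z"
  shows "variation f x z = variation f x y + variation f y z"
proof (rule antisym)
  have "bdd_above (variation_sums f x y)" "bdd_above (variation_sums f y z)"
    using xyz by (auto intro!: bdd_above_mono[OF bdd] variation_sums_mono)
  then show "variation f x z \<le> variation f x y + variation f y z"
    using xyz by (rule variation_le_combine)
  define a b where "a = (\<lambda>right::bool. if right then y else x)" and "b = (\<lambda>right::bool. if right then z else y)"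
  have "nonoverlapping_in {x..z} UNIV a b"
    using xyz by (auto simp: nonoverlapping_in_def pairwise_def a_def b_def)
  then have "(\<Sum>i\<in>UNIV. variation f (a i) (b i)) \<le> variation f x z"
  proof (rule sum_variation_le)
    fix J :: "(bool \<times> nat) set" and p q
    assume "nonoverlapping_in (\<Union>i\<in>UNIV. {a i..b i}) J p q"
    then have "nonoverlapping_in {x..z} J p q"
      by (rule nonoverlapping_in_mono) (use xyz in \<open>simp add: UNIV_bool a_def b_def\<close>)
    then show "increment_sum f J p q \<le> variation f x z"
      unfolding variation_def by (intro cSup_upper[OF _ bdd] increment_sum_in_variation_sums)
  qed
  then show "variation f x y + variation f y z \<le> variation f x z"
    by (simp add: UNIV_bool a_def b_def add.commute)
qed

lemma abs_cont_on_variation: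
  fixes f :: "real \<Rightarrow> 'b::real_normed_vector"
  assumes f: "abs_cont_on {a..b} f"
  shows "abs_cont_on {a..b} (variation f a)"
proof (rule abs_cont_onI)
  fix \<epsilon> :: real assume "\<epsilon> > 0"
  obtain \<delta> where "\<delta> > 0" and \<delta>: "\<And>(J::(nat \<times> nat) set) p q. nonoverlapping_in {a..b} J p q \<Longrightarrow>
      (\<Sum>j\<in>J. q j - p j) < \<delta> \<Longrightarrow> increment_sum f J p q < \<epsilon> / 2"
    by (rule abs_cont_onE[OF f half_gt_zero[OF \<open>\<epsilon> > 0\<close>]]) (rule that)
  have "increment_sum (variation f a) I x y < \<epsilon>"
    if fam: "nonoverlapping_in {a..b} I x y" and len: "(\<Sum>i\<in>I. y i - x i) < \<delta>" for I :: "nat set" and x y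
  proof -
    note I = nonoverlapping_inD[OF fam]
    have "norm (variation f a (y i) - variation f a (x i)) = variation f (x i) (y i)" if "i \<in> I" for i
    proof -
      note bdd = abs_cont_on_bdd_above_variation_sums[OF f]
      have "variation f a (y i) = variation f a (x i) + variation f (x i) (y i)"
        using I(2-4)[OF that] by (intro variation_additive bdd) auto
      moreover have "0 \<le> variation f (x i) (y i)"
        by (rule order_trans[OF norm_ge_zero norm_diff_le_variation[OF bdd]]) (use I(2-4)[OF that] in auto)
      ultimately show ?thesis by simp
    qed
    then have "increment_sum (variation f a) I x y = (\<Sum>i\<in>I. variation f (x i) (y i))"
      unfolding increment_sum_def by (rule sum.cong[OF refl])
    also have "\<dots> \<le> \<epsilon> / 2"
    proof (rule sum_variation_le[OF fam])
      fix J :: "(nat \<times> nat) set" and p q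
      assume "nonoverlapping_in (\<Union>i\<in>I. {x i..y i}) J p q" "(\<Sum>j\<in>J. q j - p j) \<le> (\<Sum>i\<in>I. y i - x i)"
      moreover have "(\<Union>i\<in>I. {x i..y i}) \<subseteq> {a..b}" using I(3,4) by fastforce
      ultimately show "increment_sum f J p q \<le> \<epsilon> / 2"
        using len by (intro less_imp_le[OF \<delta>]) (auto intro: nonoverlapping_in_mono)
    qed
    finally show ?thesis using \<open>\<epsilon> > 0\<close> by simp
  qed
  then show "\<exists>\<delta>>0. \<forall>(I::nat set) x y. nonoverlapping_in {a..b} I x y \<longrightarrow> (\<Sum>i\<in>I. y i - x i) < \<delta>
      \<longrightarrow> increment_sum (variation f a) I x y < \<epsilon>"
    using \<open>\<delta> > 0\<close> by blast
qed

section \<open>The fundamental theorem of calculus for absolutely continuous curves\<close>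

lemma division_of_nonoverlapping:
  fixes p :: "real set set"
  assumes p: "p division_of D"
  shows "k \<in> p \<Longrightarrow> {Inf k..Sup k} = k" "nonoverlapping_in UNIV p Inf Sup"
    "(\<Sum>k\<in>p. Sup k - Inf k) = measure lebesgue D"
proof -
  have interval: "{Inf k..Sup k} = k" "Inf k \<le> Sup k" "interior k = {Inf k<..<Sup k}" "Sup k - Inf k = measure lebesgue k"
    if k: "k \<in> p" for k
  proof -
    obtain l u where "k = {l..u}" "l \<le> u" using division_ofD(3,4)[OF p k] by fastforce
    then show "{Inf k..Sup k} = k" "Inf k \<le> Sup k" "interior k = {Inf k<..<Sup k}" "Sup k - Inf k = measure lebesgue k"
      by auto
  qed
  then show "k \<in> p \<Longrightarrow> {Inf k..Sup k} = k" by blast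
  show "nonoverlapping_in UNIV p Inf Sup"
    using interval(2) division_ofD(1,5)[OF p] by (intro nonoverlapping_inI) (auto simp: interval(3)[symmetric])
  show "(\<Sum>k\<in>p. Sup k - Inf k) = measure lebesgue D"
    using interval(4) content_division[OF p] by simp
qed

lemma emeasure_interval_measure_division_le:
  fixes h :: "real \<Rightarrow> real"
  assumes h: "mono h" "continuous_on UNIV h" and p: "p division_of D"
  shows "emeasure (interval_measure h) D \<le> ennreal (increment_sum h p Inf Sup)"
proof -
  note I = nonoverlapping_inD[OF division_of_nonoverlapping(2)[OF p]]
  have emeasure_k: "emeasure (interval_measure h) k = ennreal (h (Sup k) - h (Inf k))" if "k \<in> p" for k
    using emeasure_interval_measure_Icc[of "Inf k" "Sup k" h] h I(2)[OF that]
    unfolding division_of_nonoverlapping(1)[OF p that] by (auto dest: monoD)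
  have k_borel: "k \<in> sets borel" if "k \<in> p" for k
    using atLeastAtMost_borel[of "Inf k" "Sup k"] unfolding division_of_nonoverlapping(1)[OF p that] .
  have "emeasure (interval_measure h) D = emeasure (interval_measure h) (\<Union>k\<in>p. k)"
    using division_ofD(6)[OF p] by simp
  also have "\<dots> \<le> (\<Sum>k\<in>p. emeasure (interval_measure h) k)"
    using I(1) k_borel by (intro emeasure_subadditive_finite) auto
  also have "\<dots> = (\<Sum>k\<in>p. ennreal \<bar>h (Sup k) - h (Inf k)\<bar>)"
    using emeasure_k monoD[OF h(1)] I(2) by (intro sum.cong) auto
  also have "\<dots> = ennreal (increment_sum h p Inf Sup)"
    unfolding increment_sum_def real_norm_def by (rule sum_ennreal) simp
  finally show ?thesis .
qed

lemma open_eq_incseq_divisions: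
  fixes V :: "real set"
  assumes "open V"
  obtains E p where "incseq E" "\<And>n::nat. p n division_of E n" "(\<Union>n. E n) = V"
proof -
  obtain \<D> where \<D>: "countable \<D>" "\<And>X. X \<in> \<D> \<Longrightarrow> \<exists>a b. X = cbox a b" "\<Union>\<D> = V"
    using open_countable_Union_open_cbox[OF assms] by metis
  define boxes where "boxes = from_nat_into (insert {} \<D>)"
  have boxes: "range boxes = insert {} \<D>"
    unfolding boxes_def by (rule range_from_nat_into) (use \<D>(1) in auto)
  have "{} = cbox 1 (0::real)" by simp
  then have cbox: "\<exists>a b. boxes n = cbox a b" for n
    using \<D>(2) boxes by (metis insert_iff rangeI)
  have "\<exists>p. p division_of \<Union>(boxes ` {..n})" for n
    by (rule elementary_unions_intervals[of "boxes ` {..n}"]) (use cbox in auto)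
  then obtain p where "\<And>n. p n division_of \<Union>(boxes ` {..n})" by metis
  moreover have "incseq (\<lambda>n. \<Union>(boxes ` {..n}))" by (auto simp: incseq_def intro: order_trans)
  moreover have "(\<Union>n. \<Union>(boxes ` {..n})) = V"
  proof -
    have "(\<Union>n. \<Union>(boxes ` {..n})) = \<Union>(range boxes)" by (auto intro: order_refl)
    then show ?thesis by (simp add: boxes \<D>(3))
  qed
  ultimately show ?thesis by (intro that)
qed

lemma emeasure_interval_measure_open_le:
  fixes h :: "real \<Rightarrow> real"
  assumes h: "mono h" "continuous_on UNIV h" and V: "open V" "emeasure lborel V < ennreal \<delta>"
    and small: "\<And>(p::real set set) a b. nonoverlapping_in UNIV p a b \<Longrightarrow>
      (\<Sum>k\<in>p. b k - a k) < \<delta> \<Longrightarrow> increment_sum h p a b < \<epsilon>"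
  shows "emeasure (interval_measure h) V \<le> ennreal \<epsilon>"
proof -
  obtain E p where E: "incseq E" "\<And>n::nat. p n division_of E n" "(\<Union>n. E n) = V"
    by (rule open_eq_incseq_divisions[OF V(1)]) (rule that)
  have E_borel: "E n \<in> sets borel" for n
    by (rule borel_closed[OF division_of_closed[OF E(2)]])
  have "emeasure (interval_measure h) (E n) \<le> ennreal \<epsilon>" for n
  proof -
    have "ennreal (measure lebesgue (E n)) = emeasure lborel (E n)"
      using emeasure_eq_measure2[OF lmeasurable_division[OF E(2)]] E_borel by simp
    also have "\<dots> \<le> emeasure lborel V"
      using E(3) V(1) by (intro emeasure_mono) auto
    finally have "measure lebesgue (E n) < \<delta>"
      using V(2) le_less_trans ennreal_less_iff[OF measure_nonneg] by blast
    then have "increment_sum h (p n) Inf Sup < \<epsilon>"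
      using division_of_nonoverlapping(2,3)[OF E(2)] by (intro small) auto
    then show ?thesis
      using emeasure_interval_measure_division_le[OF h E(2), of n] by (meson ennreal_leI less_imp_le order_trans)
  qed
  then have "(SUP n. emeasure (interval_measure h) (E n)) \<le> ennreal \<epsilon>" by (rule SUP_least)
  then show ?thesis
    using SUP_emeasure_incseq[of E "interval_measure h"] E E_borel by (simp add: image_subset_iff)
qed

lemma abs_cont_imp_absolutely_continuous_interval_measure:
  fixes h :: "real \<Rightarrow> real"
  assumes h: "mono h" "abs_cont_on UNIV h"
  shows "absolutely_continuous lborel (interval_measure h)"
  unfolding absolutely_continuous_def
proof
  fix N :: "real set" assume N: "N \<in> null_sets lborel"
  have "emeasure (interval_measure h) N \<le> 0 + ennreal \<epsilon>" if "\<epsilon> > 0" for \<epsilon> :: real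
  proof -
    obtain \<delta> where "\<delta> > 0" and \<delta>: "\<And>(p::real set set) a b. nonoverlapping_in UNIV p a b \<Longrightarrow>
        (\<Sum>k\<in>p. b k - a k) < \<delta> \<Longrightarrow> increment_sum h p a b < \<epsilon>"
      by (rule abs_cont_onE[OF h(2) \<open>\<epsilon> > 0\<close>]) (rule that)
    obtain V where V: "open V" "N \<subseteq> V" "emeasure lebesgue (V - N) < ennreal \<delta>"
      by (rule sets_lebesgue_outer_open[OF _ \<open>\<delta> > 0\<close>, of N]) (use N in auto)
    have "emeasure lborel V < ennreal \<delta>"
      using V emeasure_Diff_null_set[OF N, of V] N by (auto simp: null_sets_def)
    then have "emeasure (interval_measure h) V \<le> ennreal \<epsilon>"
      by (rule emeasure_interval_measure_open_le[OF h(1) abs_cont_on_imp_continuous_on[OF h(2)] V(1)]) (rule \<delta>)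
    moreover have "emeasure (interval_measure h) N \<le> emeasure (interval_measure h) V"
      using V by (intro emeasure_mono) auto
    ultimately show ?thesis by simp
  qed
  then have "emeasure (interval_measure h) N \<le> 0" by (rule ennreal_le_epsilon)
  then show "N \<in> null_sets (interval_measure h)" using N by (auto simp: null_sets_def)
qed

lemma abs_cont_mono_has_density:
  fixes h :: "real \<Rightarrow> real"
  assumes h: "mono h" "abs_cont_on UNIV h"
  obtains g where "\<And>s. 0 \<le> g s" "\<And>x y. x \<le> y \<Longrightarrow> (g has_integral (h y - h x)) {x..y}"
proof -
  let ?M = "interval_measure h"
  note abs_cont = abs_cont_imp_absolutely_continuous_interval_measure[OF h]
  have cont: "continuous_on UNIV h" by (rule abs_cont_on_imp_continuous_on[OF h(2)])
  then have "sigma_finite_measure ?M"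
    using monoD[OF h(1)]
    by (intro sigma_finite_interval_measure)
      (auto simp: continuous_on_eq_continuous_within intro: continuous_within_subset)
  then have finite: "AE s in lborel. RN_deriv lborel ?M s \<noteq> \<infinity>"
    by (rule sigma_finite_measure.RN_deriv_finite[OF sigma_finite_lborel]) (simp_all add: abs_cont)
  have density: "density lborel (RN_deriv lborel ?M) = ?M"
    by (rule sigma_finite_measure.density_RN_deriv[OF sigma_finite_lborel]) (simp_all add: abs_cont)
  define g where "g s = enn2real (RN_deriv lborel ?M s)" for s
  have "(g has_integral (h y - h x)) {x..y}" if "x \<le> y" for x y
  proof -
    have "(\<integral>\<^sup>+s\<in>{x..y}. ennreal (g s) \<partial>lborel) = (\<integral>\<^sup>+s\<in>{x..y}. RN_deriv lborel ?M s \<partial>lborel)"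
      using finite by (intro nn_integral_cong_AE) (auto simp: g_def less_top elim!: eventually_mono)
    also have "\<dots> = emeasure (density lborel (RN_deriv lborel ?M)) {x..y}"
      by (subst emeasure_density) auto
    also have "\<dots> = ennreal (h y - h x)"
      unfolding density using that cont monoD[OF h(1)] by (intro emeasure_interval_measure_Icc) auto
    finally have "(\<integral>\<^sup>+s. ennreal (indicator {x..y} s * g s) \<partial>lborel) = ennreal (h y - h x)"
      by (simp add: nn_integral_set_ennreal mult.commute)
    then have "((\<lambda>s. indicator {x..y} s * g s) has_integral (h y - h x)) UNIV"
      using monoD[OF h(1) that] by (intro nn_integral_has_integral) (auto simp: g_def)
    then show ?thesis
      using has_integral_restrict_UNIV[of "{x..y}" g] by (simp add: indicator_times_eq_if)
  qed
  then show ?thesis by (intro that[of g]) (simp add: g_def)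
qed

lemma abs_cont_real_has_density:
  fixes f :: "real \<Rightarrow> real"
  assumes f: "abs_cont_on {a..b} f" and ab: "a \<le> b"
  obtains g where "\<And>x y. g absolutely_integrable_on {x..y}"
    "\<And>x y. x \<le> y \<Longrightarrow> (g has_integral (f (max a (min b y)) - f (max a (min b x)))) {x..y}"
proof -
  define c where "c s = max a (min b s)" for s
  have c: "c s \<in> {a..b}" "mono c" for s using ab by (auto simp: c_def mono_def)
  define V where "V s = variation f a (c s)" for s
  have "\<bar>f (c y) - f (c x)\<bar> \<le> V y - V x" if "x \<le> y" for x y
  proof -
    have xy: "a \<le> c x" "c x \<le> c y" "c y \<le> b" using c monoD[OF c(2) that] by auto
    note bdd = abs_cont_on_bdd_above_variation_sums[OF f]
    have "V y - V x = variation f (c x) (c y)"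
      using variation_additive[of f a "c y" "c x"] bdd[of a "c y"] xy by (simp add: V_def)
    then show ?thesis using norm_diff_le_variation[of f "c x" "c y"] bdd[of "c x" "c y"] xy by simp
  qed
  then have mono: "mono V" "mono (\<lambda>s. V s + f (c s))" unfolding mono_def by (smt (verit))+
  have V: "abs_cont_on UNIV V" and fc: "abs_cont_on UNIV (\<lambda>s. f (c s))"
    unfolding V_def c_def by (intro abs_cont_on_clamp abs_cont_on_variation f ab)+
  obtain g\<^sub>1 where g\<^sub>1: "\<And>s. 0 \<le> g\<^sub>1 s" "\<And>x y. x \<le> y \<Longrightarrow> (g\<^sub>1 has_integral (V y - V x)) {x..y}"
    by (rule abs_cont_mono_has_density[OF mono(1) V]) (rule that)
  obtain g\<^sub>2 where g\<^sub>2: "\<And>s. 0 \<le> g\<^sub>2 s"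
    "\<And>x y. x \<le> y \<Longrightarrow> (g\<^sub>2 has_integral (V y + f (c y) - (V x + f (c x)))) {x..y}"
    by (rule abs_cont_mono_has_density[OF mono(2) abs_cont_on_add[OF V fc]]) (rule that)
  show ?thesis
  proof (rule that[of "\<lambda>s. g\<^sub>2 s - g\<^sub>1 s"])
    fix x y :: real
    show "((\<lambda>s. g\<^sub>2 s - g\<^sub>1 s) has_integral (f (max a (min b y)) - f (max a (min b x)))) {x..y}" if "x \<le> y"
      using has_integral_diff[OF g\<^sub>2(2)[OF that] g\<^sub>1(2)[OF that]] by (simp add: c_def algebra_simps)
    have "g\<^sub>1 integrable_on {x..y}" "g\<^sub>2 integrable_on {x..y}"
      using g\<^sub>1(2)[of x y] g\<^sub>2(2)[of x y] by (cases "x \<le> y"; force)+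
    then show "(\<lambda>s. g\<^sub>2 s - g\<^sub>1 s) absolutely_integrable_on {x..y}"
      using g\<^sub>1(1) g\<^sub>2(1) by (intro set_integral_diff nonnegative_absolutely_integrable_1) auto
  qed
qed

lemma abs_cont_has_density:
  fixes f :: "real \<Rightarrow> 'b::euclidean_space"
  assumes f: "abs_cont_on {a..b} f" and ab: "a \<le> b"
  obtains g where "\<And>x y. g absolutely_integrable_on {x..y}"
    "\<And>x y. x \<le> y \<Longrightarrow> (g has_integral (f (max a (min b y)) - f (max a (min b x)))) {x..y}"
proof -
  have "\<exists>g. (\<forall>x y. g absolutely_integrable_on {x..y}) \<and>
      (\<forall>x y. x \<le> y \<longrightarrow> (g has_integral ((f (max a (min b y)) - f (max a (min b x))) \<bullet> e)) {x..y})"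
    if e: "e \<in> Basis" for e
  proof -
    have "abs_cont_on {a..b} (\<lambda>s. f s \<bullet> e)"
      by (rule abs_cont_on_norm_le[OF f]) (use e in \<open>auto simp: inner_diff_left[symmetric] intro: Basis_le_norm\<close>)
    then show ?thesis
      by (rule abs_cont_real_has_density[OF _ ab]) (auto simp: inner_diff_left)
  qed
  then obtain g where g: "\<And>e x y. e \<in> Basis \<Longrightarrow> g e absolutely_integrable_on {x..y}"
    "\<And>e x y. e \<in> Basis \<Longrightarrow> x \<le> y \<Longrightarrow>
      (g e has_integral ((f (max a (min b y)) - f (max a (min b x))) \<bullet> e)) {x..y}"
    by metis
  show ?thesis
  proof (rule that[of "\<lambda>s. \<Sum>e\<in>Basis. g e s *\<^sub>R e"])
    show "(\<lambda>s. \<Sum>e\<in>Basis. g e s *\<^sub>R e) absolutely_integrable_on {x..y}" for x y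
      by (intro absolutely_integrable_sum absolutely_integrable_scaleR_right g) auto
    show "((\<lambda>s. \<Sum>e\<in>Basis. g e s *\<^sub>R e) has_integral (f (max a (min b y)) - f (max a (min b x)))) {x..y}"
      if "x \<le> y" for x y
      unfolding has_integral_componentwise_iff[of "\<lambda>s. \<Sum>e\<in>Basis. g e s *\<^sub>R e"] using g(2) that by simp
  qed
qed

lemma right_derivative_of_integral_AE:
  fixes f g :: "real \<Rightarrow> 'b::euclidean_space"
  assumes f: "\<And>x y. x \<le> y \<Longrightarrow> (g has_integral (f y - f x)) {x..y}"
  obtains N where "negligible N" "\<And>s. s \<notin> N \<Longrightarrow> (f has_vector_derivative g s) (at_right s)"
proof -
  have "g integrable_on cbox x y" for x y
    using f[of x y] by (cases "x \<le> y") auto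
  then obtain N where N: "negligible N" "\<And>s e. \<lbrakk>s \<notin> N; 0 < e\<rbrakk> \<Longrightarrow> \<exists>d>0. \<forall>h. 0 < h \<and> h < d \<longrightarrow>
      norm (integral (cbox s (s + h *\<^sub>R One)) g /\<^sub>R h ^ DIM(real) - g s) < e"
    using integrable_ccontinuous_explicit by blast
  have "(f has_vector_derivative g s) (at_right s)" if s: "s \<notin> N" for s
    unfolding has_vector_derivative_def has_derivative_within_alt
  proof (intro conjI allI impI bounded_linear_scaleR_left)
    fix e :: real assume "e > 0"
    obtain d where d: "d > 0" "\<And>h. 0 < h \<Longrightarrow> h < d \<Longrightarrow> norm (integral {s..s + h} g /\<^sub>R h - g s) < e"
      using N(2)[OF s \<open>e > 0\<close>] by auto
    have "norm (f y - f s - (y - s) *\<^sub>R g s) \<le> e * norm (y - s)" if y: "s < y" "norm (y - s) < d" for y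
    proof -
      have "f y - f s - (y - s) *\<^sub>R g s = (y - s) *\<^sub>R (integral {s..s + (y - s)} g /\<^sub>R (y - s) - g s)"
        using y integral_unique[OF f[of s y]] by (simp add: scaleR_diff_right)
      then show ?thesis using d(2)[of "y - s"] y by (simp add: mult.commute mult_left_mono less_imp_le)
    qed
    then show "\<exists>d>0. \<forall>y\<in>{s<..}. norm (y - s) < d \<longrightarrow> norm (f y - f s - (y - s) *\<^sub>R g s) \<le> e * norm (y - s)"
      using d(1) by auto
  qed
  with N(1) show ?thesis by (rule that)
qed

lemma derivative_of_integral_AE:
  fixes f g :: "real \<Rightarrow> 'b::euclidean_space"
  assumes f: "\<And>x y. x \<le> y \<Longrightarrow> (g has_integral (f y - f x)) {x..y}"
  obtains N where "negligible N" "\<And>s. s \<notin> N \<Longrightarrow> (f has_vector_derivative g s) (at s)"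
proof -
  obtain N where N: "negligible N" "\<And>s. s \<notin> N \<Longrightarrow> (f has_vector_derivative g s) (at_right s)"
    by (rule right_derivative_of_integral_AE[OF f]) (assumption, rule that)
  have "((\<lambda>s. g (- s)) has_integral (- f (- y) - - f (- x))) {x..y}" if "x \<le> y" for x y
    using has_integral_reflect_real[of g "f (- x) - f (- y)" "- x" "- y"] f[of "- y" "- x"] that by simp
  then obtain N' where N': "negligible N'"
    "\<And>s. s \<notin> N' \<Longrightarrow> ((\<lambda>s. - f (- s)) has_vector_derivative g (- s)) (at_right s)"
    by (rule right_derivative_of_integral_AE) (assumption, rule that)
  have left: "(f has_vector_derivative g s) (at_left s)" if "s \<notin> uminus ` N'" for s
  proof -
    have "- s \<notin> N'" using that by (metis image_eqI minus_minus)
    moreover have "uminus ` {..<s} = {- s<..}" by simp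
    ultimately have "((\<lambda>s. - f (- s)) has_vector_derivative g s) (at (- s) within uminus ` {..<s})"
      using N'(2)[of "- s"] by simp
    moreover have "(uminus has_vector_derivative - 1) (at s within {..<s})"
      by (auto intro!: derivative_eq_intros)
    ultimately have "((\<lambda>s. - f (- s)) \<circ> uminus has_vector_derivative (- 1) *\<^sub>R g s) (at_left s)"
      by (intro vector_diff_chain_within)
    then show ?thesis using has_vector_derivative_minus by (fastforce simp: o_def)
  qed
  have "(f has_vector_derivative g s) (at s)" if "s \<notin> N \<union> uminus ` N'" for s
    using N(2)[of s] left[of s] that
    unfolding has_vector_derivative_def has_derivative_iff_norm by (auto intro: filterlim_split_at)
  moreover have "negligible (N \<union> uminus ` N')"
    by (intro negligible_Un N(1) negligible_differentiable_image_negligible N'(1)) (auto simp: differentiable_on_def)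
  ultimately show ?thesis using that[of "N \<union> uminus ` N'"] by simp
qed

abbreviation velocity :: "(real \<Rightarrow> 'b::real_normed_vector) \<Rightarrow> real \<Rightarrow> 'b" where
  "velocity f \<equiv> (\<lambda>s. vector_derivative f (at s))"

lemma velocity_eq_on_interval:
  fixes f g :: "real \<Rightarrow> 'b::real_normed_vector"
  assumes "\<And>s. s \<in> {a..b} \<Longrightarrow> f s = g s" "s \<in> {a<..<b}"
  shows "velocity f s = velocity g s"
proof (rule vector_derivative_cong_eq)
  have "eventually (\<lambda>x. x \<in> {a<..<b}) (nhds s)"
    using assms(2) by (intro eventually_nhds_in_open) auto
  then show "eventually (\<lambda>x. x \<in> UNIV \<longrightarrow> f x = g x) (nhds s)"
    by eventually_elim (use assms(1) in auto)
qed auto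

theorem abs_cont_fundamental_theorem_of_calculus:
  fixes f :: "real \<Rightarrow> 'b::euclidean_space"
  assumes f: "abs_cont_on {a..b} f"
  shows "velocity f absolutely_integrable_on {a..b}"
    and "a \<le> x \<Longrightarrow> x \<le> y \<Longrightarrow> y \<le> b \<Longrightarrow>
      (velocity f has_integral (f y - f x)) {x..y}"
proof -
  have "velocity f absolutely_integrable_on {a..b} \<and>
     (\<forall>x y. a \<le> x \<and> x \<le> y \<and> y \<le> b \<longrightarrow> (velocity f has_integral (f y - f x)) {x..y})"
  proof (cases "a \<le> b")
    case True
    obtain g where g: "\<And>x y. g absolutely_integrable_on {x..y}"
      "\<And>x y. x \<le> y \<Longrightarrow> (g has_integral (f (max a (min b y)) - f (max a (min b x)))) {x..y}"
      by (rule abs_cont_has_density[OF f True]) (rule that)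
    obtain N where N: "negligible N"
      "\<And>s. s \<notin> N \<Longrightarrow> ((\<lambda>s. f (max a (min b s))) has_vector_derivative g s) (at s)"
      by (rule derivative_of_integral_AE[OF g(2)]) (assumption, rule that)
    have null: "negligible (insert a (insert b N))" using N(1) by simp
    have velocity_eq: "velocity f s = g s" if "s \<in> {a..b} - insert a (insert b N)" for s
    proof -
      have "velocity f s = velocity (\<lambda>s. f (max a (min b s))) s"
        by (rule velocity_eq_on_interval[of a b]) (use that in auto)
      also have "\<dots> = g s" by (rule vector_derivative_at[OF N(2)]) (use that in auto)
      finally show ?thesis .
    qed
    have "(velocity f has_integral (f y - f x)) {x..y}" if "a \<le> x" "x \<le> y" "y \<le> b" for x y
    proof (rule has_integral_spike[OF null])
      show "(g has_integral (f y - f x)) {x..y}" using g(2)[of x y] that by simp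
    qed (use velocity_eq that in auto)
    moreover have "velocity f absolutely_integrable_on {a..b}"
      by (rule absolutely_integrable_spike[OF g(1) null velocity_eq])
    ultimately show ?thesis by blast
  qed auto
  then show "velocity f absolutely_integrable_on {a..b}"
    "a \<le> x \<Longrightarrow> x \<le> y \<Longrightarrow> y \<le> b \<Longrightarrow> (velocity f has_integral (f y - f x)) {x..y}"
    by blast+
qed

section \<open>Lagrangians with quadratic growth\<close>

lemma power2_norm_add_le:
  fixes a b :: "'b::real_normed_vector"
  shows "(norm (a + b))\<^sup>2 \<le> 2 * (norm a)\<^sup>2 + 2 * (norm b)\<^sup>2"
proof -
  have "(norm (a + b))\<^sup>2 \<le> (norm a + norm b)\<^sup>2" by (intro power_mono norm_triangle_ineq) simp
  also have "\<dots> \<le> 2 * (norm a)\<^sup>2 + 2 * (norm b)\<^sup>2"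
    using sum_squares_bound[of "norm a" "norm b"] by (simp add: power2_sum)
  finally show ?thesis .
qed

lemma has_derivative_partial:
  assumes "((\<lambda>(z, w). f z w) has_derivative D) (at (y, v))"
  shows "((\<lambda>z. f z v) has_derivative (\<lambda>h. D (h, 0))) (at y)"
    and "(f y has_derivative (\<lambda>k. D (0, k))) (at v)"
proof -
  have "((\<lambda>z. (z, v)) has_derivative (\<lambda>h. (h, 0))) (at y)"
    by (auto intro!: derivative_eq_intros)
  from has_derivative_compose[OF this assms]
  show "((\<lambda>z. f z v) has_derivative (\<lambda>h. D (h, 0))) (at y)" by simp
  have "((\<lambda>w. (y, w)) has_derivative (\<lambda>k. (0, k))) (at v)"
    by (auto intro!: derivative_eq_intros)
  from has_derivative_compose[OF this assms]
  show "(f y has_derivative (\<lambda>k. D (0, k))) (at v)" by simp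
qed

lemma has_derivative_along_line:
  fixes f :: "'b::real_normed_vector \<Rightarrow> 'c::real_normed_vector"
  assumes "(f has_derivative D) (at (p + s *\<^sub>R d))"
  shows "((\<lambda>s. f (p + s *\<^sub>R d)) has_vector_derivative D d) (at s)"
proof -
  have "((\<lambda>s. p + s *\<^sub>R d) has_derivative (\<lambda>h. h *\<^sub>R d)) (at s)"
    by (auto intro!: derivative_eq_intros)
  from has_derivative_compose[OF this assms] show ?thesis
    using linear_scale[OF bounded_linear.linear[OF has_derivative_bounded_linear[OF assms]]]
    by (simp add: has_vector_derivative_def)
qed

lemma second_order_taylor:
  fixes f :: "'b::real_inner \<Rightarrow> real"
  assumes f: "\<And>v. (f has_derivative (\<lambda>k. g v \<bullet> k)) (at v)" and g: "\<And>v. (g has_derivative H v) (at v)"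
  obtains z where "f (v + d) = f v + g v \<bullet> d + H z d \<bullet> d / 2"
proof -
  define \<phi> where "\<phi> = (\<lambda>(k::nat) s. if k = 0 then f (v + s *\<^sub>R d)
      else if k = 1 then g (v + s *\<^sub>R d) \<bullet> d else H (v + s *\<^sub>R d) d \<bullet> d)"
  have "(\<phi> k has_real_derivative \<phi> (Suc k) s) (at s)" if "k < 2" for k :: nat and s
  proof (cases "k = 0")
    case True
    then show ?thesis
      using has_derivative_along_line[OF f] by (simp add: \<phi>_def has_real_derivative_iff_has_vector_derivative)
  next
    case False
    then have "k = 1" using that by simp
    moreover have "((\<lambda>s. g (v + s *\<^sub>R d) \<bullet> d) has_vector_derivative H (v + s *\<^sub>R d) d \<bullet> d) (at s)"
      by (rule bounded_linear.has_vector_derivative[OF bounded_linear_inner_left has_derivative_along_line[OF g]])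
    ultimately show ?thesis by (simp add: \<phi>_def has_real_derivative_iff_has_vector_derivative)
  qed
  then obtain s where "\<phi> 0 1 = (\<Sum>k<2. \<phi> k 0 / fact k * 1 ^ k) + \<phi> 2 s / fact 2 * 1 ^ 2"
    using Maclaurin[of 1 2 \<phi> "\<phi> 0"] by auto
  then show ?thesis by (intro that[of "v + s *\<^sub>R d"]) (simp add: \<phi>_def eval_nat_numeral)
qed

lemma gradient_bound_imp_lipschitz:
  fixes f :: "'b::real_inner \<Rightarrow> real"
  assumes S: "convex S" "y \<in> S" "z \<in> S"
    and f: "\<And>x. x \<in> S \<Longrightarrow> (f has_derivative (\<lambda>h. g x \<bullet> h)) (at x)" "\<And>x. x \<in> S \<Longrightarrow> norm (g x) \<le> B"
  shows "\<bar>f y - f z\<bar> \<le> B * norm (y - z)"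
proof -
  have "norm (f y - f z) \<le> B * norm (y - z)"
  proof (rule differentiable_bound[OF S(1)])
    fix x assume x: "x \<in> S"
    show "(f has_derivative (\<lambda>h. g x \<bullet> h)) (at x within S)"
      by (rule has_derivative_at_withinI[OF f(1)[OF x]])
    show "onorm (\<lambda>h. g x \<bullet> h) \<le> B"
    proof (rule onorm_bound)
      show "0 \<le> B" using norm_ge_zero f(2)[OF x] by (rule order_trans)
      show "norm (g x \<bullet> h) \<le> B * norm h" for h
        using Cauchy_Schwarz_ineq2[of "g x" h] mult_right_mono[OF f(2)[OF x] norm_ge_zero[of h]] by simp
    qed
  qed (use S in auto)
  then show ?thesis by simp
qed

locale lagrangian =
  fixes U :: "'a::euclidean_space set"
    and M c_mu :: real
    and L :: "'a \<Rightarrow> 'a \<Rightarrow> real"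
    and Lx Lv :: "'a \<Rightarrow> 'a \<Rightarrow> 'a"
    and Lvx Lvv :: "'a \<Rightarrow> 'a \<Rightarrow> 'a \<Rightarrow> 'a"
  assumes open_U: "open U"
    and L0_C1: "\<forall>y\<in>U. \<forall>v. ((\<lambda>(z, w). L z w) has_derivative
                   (\<lambda>(h, k). Lx y v \<bullet> h + Lv y v \<bullet> k)) (at (y, v))"
    and L0_bound: "\<forall>y\<in>U. \<bar>L y 0\<bar> + norm (Lx y 0) + norm (Lv y 0) \<le> M"
    and L1_diff: "\<forall>y\<in>U. \<forall>v. ((\<lambda>(z, w). Lv z w) has_derivative
                   (\<lambda>(h, k). Lvx y v h + Lvv y v k)) (at (y, v))"
    and L1_mu: "c_mu > 0"
    and L1_vv: "\<forall>y\<in>U. \<forall>v k. (norm k)\<^sup>2 / c_mu \<le> Lvv y v k \<bullet> k \<and> Lvv y v k \<bullet> k \<le> c_mu * (norm k)\<^sup>2"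
    and L1_vx: "\<forall>y\<in>U. \<forall>v h. norm (Lvx y v h) \<le> c_mu * (1 + norm v) * norm h"
begin

lemma continuous_on_L: "continuous_on (U \<times> UNIV) (\<lambda>(y, v). L y v)"
  using L0_C1 by (auto intro!: continuous_at_imp_continuous_on has_derivative_continuous)

lemma continuous_on_L_path:
  assumes "continuous_on S p" "continuous_on S v" "p ` S \<subseteq> U"
  shows "continuous_on S (\<lambda>s. L (p s) (v s))"
proof -
  have "continuous_on S ((\<lambda>(y, v). L y v) \<circ> (\<lambda>s. (p s, v s)))"
    using assms by (intro continuous_on_compose continuous_on_subset[OF continuous_on_L] continuous_intros) auto
  then show ?thesis by (simp add: o_def)
qed

lemma L_bound_at_0:
  assumes "y \<in> U"
  shows "\<bar>L y 0\<bar> \<le> M" "norm (Lx y 0) \<le> M" "norm (Lv y 0) \<le> M" "0 \<le> M"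
  using L0_bound[rule_format, OF assms] norm_ge_zero[of "Lx y 0"] norm_ge_zero[of "Lv y 0"] by linarith+

lemma Lvx_zero: "y \<in> U \<Longrightarrow> Lvx y v 0 = 0"
  using L1_vx[rule_format, of y v 0] by simp

lemma Lvv_zero: "y \<in> U \<Longrightarrow> Lvv y v 0 = 0"
  using linear_0[OF bounded_linear.linear[OF has_derivative_bounded_linear[OF L1_diff[rule_format, of y v]]]]
  by (simp add: zero_prod_def Lvx_zero)

lemma has_derivative_L:
  assumes "y \<in> U"
  shows "((\<lambda>z. L z v) has_derivative (\<lambda>h. Lx y v \<bullet> h)) (at y)"
    and "(L y has_derivative (\<lambda>k. Lv y v \<bullet> k)) (at v)"
  using has_derivative_partial[OF L0_C1[rule_format, OF assms]] by simp_all

lemma has_derivative_Lv: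
  assumes "y \<in> U"
  shows "((\<lambda>z. Lv z v) has_derivative Lvx y v) (at y)"
    and "(Lv y has_derivative Lvv y v) (at v)"
  using has_derivative_partial[OF L1_diff[rule_format, OF assms]] Lvx_zero[OF assms] Lvv_zero[OF assms]
  by simp_all

lemma L_quadratic_bounds:
  assumes y: "y \<in> U"
  shows "L y w + Lv y w \<bullet> d + (norm d)\<^sup>2 / (2 * c_mu) \<le> L y (w + d)"
    and "L y (w + d) \<le> L y w + Lv y w \<bullet> d + c_mu / 2 * (norm d)\<^sup>2"
proof -
  obtain z where "L y (w + d) = L y w + Lv y w \<bullet> d + Lvv y z d \<bullet> d / 2"
    by (rule second_order_taylor[OF has_derivative_L(2)[OF y] has_derivative_Lv(2)[OF y]])
  then show "L y w + Lv y w \<bullet> d + (norm d)\<^sup>2 / (2 * c_mu) \<le> L y (w + d)"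
    "L y (w + d) \<le> L y w + Lv y w \<bullet> d + c_mu / 2 * (norm d)\<^sup>2"
    using L1_vv[rule_format, OF y, of d z] by simp_all
qed

definition coercivity_const :: real where "coercivity_const = M + c_mu * M\<^sup>2"

lemma L_coercive:
  assumes y: "y \<in> U"
  shows "(norm v)\<^sup>2 / (4 * c_mu) - coercivity_const \<le> L y v"
proof -
  have "- (M * norm v) \<le> Lv y 0 \<bullet> v"
    using Cauchy_Schwarz_ineq2[of "Lv y 0" v] mult_right_mono[OF L_bound_at_0(3)[OF y], of "norm v"] by simp
  moreover have "L y 0 + Lv y 0 \<bullet> v + (norm v)\<^sup>2 / (2 * c_mu) \<le> L y v"
    using L_quadratic_bounds(1)[OF y, of 0 v] by simp
  moreover have "M * norm v \<le> (norm v)\<^sup>2 / (4 * c_mu) + c_mu * M\<^sup>2"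
  proof -
    have "0 \<le> (norm v / (2 * c_mu) - M)\<^sup>2 * c_mu" using L1_mu by simp
    also have "\<dots> = (norm v)\<^sup>2 / (4 * c_mu) + c_mu * M\<^sup>2 - M * norm v"
      using L1_mu by (simp add: power2_eq_square field_simps)
    finally show ?thesis by simp
  qed
  moreover have "(norm v)\<^sup>2 / (2 * c_mu) = (norm v)\<^sup>2 / (4 * c_mu) + (norm v)\<^sup>2 / (4 * c_mu)"
    using L1_mu by (simp add: field_simps)
  ultimately show ?thesis using L_bound_at_0(1)[OF y] unfolding coercivity_const_def by linarith
qed

lemma Lv_lipschitz_x:
  assumes S: "convex S" "S \<subseteq> U" "y \<in> S" "z \<in> S"
  shows "norm (Lv y w - Lv z w) \<le> c_mu * (1 + norm w) * norm (y - z)"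
proof (rule differentiable_bound[OF S(1)])
  fix x assume "x \<in> S"
  then have x: "x \<in> U" using S(2) by blast
  show "((\<lambda>z. Lv z w) has_derivative Lvx x w) (at x within S)"
    by (rule has_derivative_at_withinI[OF has_derivative_Lv(1)[OF x]])
  show "onorm (Lvx x w) \<le> c_mu * (1 + norm w)"
    using L1_vx x L1_mu by (intro onorm_bound) auto
qed (use S in auto)

definition lipschitz_const :: real where "lipschitz_const = M + 2 * c_mu"

lemma lipschitz_const_pos: "y \<in> U \<Longrightarrow> 0 < lipschitz_const"
  using L_bound_at_0(4) L1_mu by (fastforce simp: lipschitz_const_def)

lemma L_lipschitz_x:
  assumes S: "convex S" "S \<subseteq> U" "y \<in> S" "z \<in> S"
  shows "\<bar>L y v - L z v\<bar> \<le> lipschitz_const * (1 + (norm v)\<^sup>2) * norm (y - z)"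
proof -
  have yz: "y \<in> U" "z \<in> U" using S by auto
  have "\<bar>L y 0 - L z 0\<bar> \<le> M * norm (y - z)"
    by (rule gradient_bound_imp_lipschitz[OF S(1,3,4), where g = "\<lambda>x. Lx x 0"])
      (use has_derivative_L(1) L_bound_at_0(2) S(2) in auto)
  moreover have "\<bar>(L y v - L z v) - (L y 0 - L z 0)\<bar> \<le> c_mu * (1 + norm v) * norm (y - z) * norm (v - 0)"
  proof (rule gradient_bound_imp_lipschitz[where S = "cball 0 (norm v)" and g = "\<lambda>w. Lv y w - Lv z w"])
    fix w :: 'a assume "w \<in> cball 0 (norm v)"
    show "((\<lambda>w. L y w - L z w) has_derivative (\<lambda>k. (Lv y w - Lv z w) \<bullet> k)) (at w)"
      using has_derivative_diff[OF has_derivative_L(2)[OF yz(1), of w] has_derivative_L(2)[OF yz(2), of w]]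
      by (simp add: inner_diff_left)
    have "c_mu * (1 + norm w) * norm (y - z) \<le> c_mu * (1 + norm v) * norm (y - z)"
      using L1_mu \<open>w \<in> cball 0 (norm v)\<close> by (intro mult_right_mono mult_left_mono) auto
    then show "norm (Lv y w - Lv z w) \<le> c_mu * (1 + norm v) * norm (y - z)"
      using Lv_lipschitz_x[OF S, of w] by linarith
  qed auto
  ultimately have "\<bar>L y v - L z v\<bar> \<le> (M + c_mu * (norm v + (norm v)\<^sup>2)) * norm (y - z)"
    by (simp add: power2_eq_square algebra_simps)
  also have "\<dots> \<le> (lipschitz_const * (1 + (norm v)\<^sup>2)) * norm (y - z)"
  proof (rule mult_right_mono)
    have "2 * norm v \<le> 1 + (norm v)\<^sup>2" using sum_squares_bound[of 1 "norm v"] by simp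
    then have "norm v + (norm v)\<^sup>2 \<le> 2 * (1 + (norm v)\<^sup>2)"
      using norm_ge_zero[of v] by (smt (verit) zero_le_power2)
    then have "c_mu * (norm v + (norm v)\<^sup>2) \<le> c_mu * (2 * (1 + (norm v)\<^sup>2))" using L1_mu by simp
    moreover have "M \<le> M * (1 + (norm v)\<^sup>2)" using L_bound_at_0(4)[OF yz(1)] by (simp add: algebra_simps)
    ultimately show "M + c_mu * (norm v + (norm v)\<^sup>2) \<le> lipschitz_const * (1 + (norm v)\<^sup>2)"
      by (simp add: lipschitz_const_def algebra_simps)
  qed simp
  finally show ?thesis .
qed

lemma L_expansion_bounds:
  assumes S: "convex S" "S \<subseteq> U" "y \<in> S" "x \<in> S" and \<rho>: "norm (y - x) \<le> \<rho>" and \<kappa>: "\<kappa> = lipschitz_const * \<rho>"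
  shows "L x w + Lv x w \<bullet> (v - w) + (1 / (2 * c_mu) - 2 * \<kappa>) * (norm (v - w))\<^sup>2 - \<kappa> * (1 + 2 * (norm w)\<^sup>2) \<le> L y v"
    and "L y v \<le> L x w + Lv x w \<bullet> (v - w) + (c_mu / 2 + 2 * \<kappa>) * (norm (v - w))\<^sup>2 + \<kappa> * (1 + 2 * (norm w)\<^sup>2)"
proof -
  have x: "x \<in> U" using S by blast
  have "(norm v)\<^sup>2 \<le> 2 * (norm (v - w))\<^sup>2 + 2 * (norm w)\<^sup>2"
    using power2_norm_add_le[of "v - w" w] by simp
  then have "lipschitz_const * (1 + (norm v)\<^sup>2) * norm (y - x) \<le>
      lipschitz_const * (1 + (2 * (norm (v - w))\<^sup>2 + 2 * (norm w)\<^sup>2)) * \<rho>"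
    using lipschitz_const_pos[OF x] \<rho> by (intro mult_mono) auto
  then have "\<bar>L y v - L x v\<bar> \<le> 2 * \<kappa> * (norm (v - w))\<^sup>2 + \<kappa> * (1 + 2 * (norm w)\<^sup>2)"
    using L_lipschitz_x[OF S, of v] by (simp add: \<kappa> algebra_simps)
  then show "L x w + Lv x w \<bullet> (v - w) + (1 / (2 * c_mu) - 2 * \<kappa>) * (norm (v - w))\<^sup>2 - \<kappa> * (1 + 2 * (norm w)\<^sup>2) \<le> L y v"
    "L y v \<le> L x w + Lv x w \<bullet> (v - w) + (c_mu / 2 + 2 * \<kappa>) * (norm (v - w))\<^sup>2 + \<kappa> * (1 + 2 * (norm w)\<^sup>2)"
    using L_quadratic_bounds[OF x, of w "v - w"] by (simp_all add: algebra_simps)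
qed

end

section \<open>The cost functional\<close>

lemma ext_integral_cong_AE:
  assumes "AE s in lebesgue. s \<in> S \<longrightarrow> f s = g s"
  shows "ext_integral S f = ext_integral S g"
proof -
  have "(\<integral>\<^sup>+s\<in>S. ennreal (f s) \<partial>lebesgue) = (\<integral>\<^sup>+s\<in>S. ennreal (g s) \<partial>lebesgue)"
    "(\<integral>\<^sup>+s\<in>S. ennreal (- f s) \<partial>lebesgue) = (\<integral>\<^sup>+s\<in>S. ennreal (- g s) \<partial>lebesgue)"
    by (rule nn_integral_cong_AE, use assms in \<open>auto simp: indicator_def elim!: eventually_mono\<close>)+
  then show ?thesis by (simp add: ext_integral_def)
qed

lemma ext_integral_bounded_below:
  fixes f :: "real \<Rightarrow> real"
  assumes meas: "f \<in> borel_measurable (lebesgue_on {a..b})" and lb: "\<And>s. s \<in> {a..b} \<Longrightarrow> - C \<le> f s"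
  shows "f absolutely_integrable_on {a..b} \<Longrightarrow> ext_integral {a..b} f = ereal (integral {a..b} f)"
    and "\<not> f absolutely_integrable_on {a..b} \<Longrightarrow> ext_integral {a..b} f = \<infinity>"
proof -
  let ?f = "\<lambda>s. indicator {a..b} s *\<^sub>R f s"
  have f_meas: "?f \<in> borel_measurable lebesgue"
    using meas by (simp add: borel_measurable_restrict_space_iff)
  have pos: "(\<integral>\<^sup>+s\<in>{a..b}. ennreal (f s) \<partial>lebesgue) = (\<integral>\<^sup>+s. ennreal (?f s) \<partial>lebesgue)"
    and neg: "(\<integral>\<^sup>+s\<in>{a..b}. ennreal (- f s) \<partial>lebesgue) = (\<integral>\<^sup>+s. ennreal (- ?f s) \<partial>lebesgue)"
    by (rule nn_integral_cong, auto simp: indicator_def)+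
  have "(\<integral>\<^sup>+s. ennreal (- ?f s) \<partial>lebesgue) \<le> (\<integral>\<^sup>+s. ennreal \<bar>C\<bar> * indicator {a..b} s \<partial>lebesgue)"
    using lb by (intro nn_integral_mono) (fastforce simp: indicator_def intro: ennreal_leI)
  also have "\<dots> = ennreal \<bar>C\<bar> * emeasure lebesgue {a..b}" by (rule nn_integral_cmult_indicator) simp
  also have "\<dots> < \<infinity>" by (simp add: ennreal_mult_less_top emeasure_lborel_Icc_eq)
  finally have neg_finite: "(\<integral>\<^sup>+s. ennreal (- ?f s) \<partial>lebesgue) < \<infinity>" .
  show "ext_integral {a..b} f = ereal (integral {a..b} f)" if int: "f absolutely_integrable_on {a..b}"
  proof -
    have "integrable lebesgue ?f" using int by (simp add: set_integrable_def)
    then obtain r q where rq: "0 \<le> r" "0 \<le> q" "(\<integral>\<^sup>+s. ennreal (?f s) \<partial>lebesgue) = ennreal r"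
       "(\<integral>\<^sup>+s. ennreal (- ?f s) \<partial>lebesgue) = ennreal q" "integral\<^sup>L lebesgue ?f = r - q"
      by (rule integrableE)
    have "integral {a..b} f = r - q"
      using set_lebesgue_integral_eq_integral(2)[OF int] rq(5) by (simp add: set_lebesgue_integral_def)
    then show ?thesis unfolding ext_integral_def pos neg rq(3,4) using rq(1,2) by (simp add: enn2ereal_ennreal)
  qed
  show "ext_integral {a..b} f = \<infinity>" if "\<not> f absolutely_integrable_on {a..b}"
  proof -
    have "(\<integral>\<^sup>+s. ennreal (?f s) \<partial>lebesgue) = \<infinity>"
      using that neg_finite f_meas unfolding set_integrable_def real_integrable_def by auto
    moreover have "enn2ereal (\<integral>\<^sup>+s. ennreal (- ?f s) \<partial>lebesgue) \<noteq> \<infinity>"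
      using neg_finite by (auto simp: less_top_ennreal enn2ereal_ennreal)
    ultimately show ?thesis
      unfolding ext_integral_def pos neg by (simp add: enn2ereal_top top_ereal_def)
  qed
qed

lemma Gamma_closure: "\<gamma> \<in> Gamma \<Omega> T \<Longrightarrow> s \<in> {0..T} \<Longrightarrow> apply_bcontfun \<gamma> s \<in> closure \<Omega>"
  by (simp add: Gamma_def Cpaths_def)

lemma Gamma_velocity:
  assumes "\<gamma> \<in> Gamma \<Omega> T"
  shows "velocity (apply_bcontfun \<gamma>) absolutely_integrable_on {0..T}"
    and "0 \<le> a \<Longrightarrow> a \<le> b \<Longrightarrow> b \<le> T \<Longrightarrow>
      (velocity (apply_bcontfun \<gamma>) has_integral (apply_bcontfun \<gamma> b - apply_bcontfun \<gamma> a)) {a..b}"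
  using assms abs_cont_fundamental_theorem_of_calculus[of 0 T "apply_bcontfun \<gamma>"] by (simp_all add: Gamma_def)

lemma Gamma_from_curve:
  fixes p :: "real \<Rightarrow> 'a::euclidean_space"
  assumes "0 \<le> T" and ac: "abs_cont_on {0..T} p" and cl: "\<And>s. s \<in> {0..T} \<Longrightarrow> p s \<in> closure \<Omega>"
  obtains c where "c \<in> Gamma \<Omega> T" "\<And>s. s \<in> {0..T} \<Longrightarrow> apply_bcontfun c s = p s"
proof -
  have "continuous_on (cbox 0 T) p" using abs_cont_on_imp_continuous_on[OF ac] by simp
  then obtain c :: "real \<Rightarrow>\<^sub>C 'a" where c: "\<And>s. s \<in> cbox 0 T \<Longrightarrow> c s = p s" "\<And>s. c s = p (clamp 0 T s)"
    by (rule continuous_on_cbox_bcontfunE) (rule that)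
  have "clamp 0 T s = max 0 (min T s)" for s :: real
    using \<open>0 \<le> T\<close> unfolding clamp_def Basis_real_def by (simp add: max_def min_def)
  then have "c s = c (max 0 (min T s))" for s
    using c(2)[of s] c(1)[of "max 0 (min T s)"] \<open>0 \<le> T\<close> by simp
  moreover have "abs_cont_on {0..T} (apply_bcontfun c)"
    by (rule abs_cont_on_norm_le[OF ac]) (use c(1) in auto)
  ultimately have "c \<in> Gamma \<Omega> T"
    using c(1) cl by (auto simp: Gamma_def Cpaths_def)
  then show ?thesis using that c(1) by auto
qed

lemma Gamma_join:
  assumes "\<alpha> \<in> Gamma \<Omega> T" "\<beta> \<in> Gamma \<Omega> T" "\<tau> \<in> {0..T}" "apply_bcontfun \<alpha> \<tau> = apply_bcontfun \<beta> \<tau>"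
  obtains \<sigma> where "\<sigma> \<in> Gamma \<Omega> T" "\<And>s. s \<in> {0..\<tau>} \<Longrightarrow> apply_bcontfun \<sigma> s = apply_bcontfun \<alpha> s"
    "\<And>s. s \<in> {\<tau>..T} \<Longrightarrow> apply_bcontfun \<sigma> s = apply_bcontfun \<beta> s"
proof -
  define p where "p s = (if s \<le> \<tau> then apply_bcontfun \<alpha> s else apply_bcontfun \<beta> s)" for s
  have "abs_cont_on {0..T} p"
    using assms unfolding p_def by (intro abs_cont_on_join) (auto simp: Gamma_def)
  moreover have "0 \<le> T" using assms(3) by simp
  moreover have "p s \<in> closure \<Omega>" if "s \<in> {0..T}" for s
    using assms(1,2) that by (auto simp: p_def Gamma_closure)
  ultimately obtain \<sigma> where \<sigma>: "\<sigma> \<in> Gamma \<Omega> T" "\<And>s. s \<in> {0..T} \<Longrightarrow> apply_bcontfun \<sigma> s = p s"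
    using Gamma_from_curve by metis
  show ?thesis
    using \<sigma>(2) assms(3,4) by (intro that[OF \<sigma>(1)]) (auto simp: p_def)
qed

lemma C1_imp_lipschitz_on:
  fixes p p' :: "real \<Rightarrow> 'b::real_normed_vector"
  assumes deriv: "\<And>s. s \<in> {a..b} \<Longrightarrow> (p has_vector_derivative p' s) (at s within {a..b})"
    and cont: "continuous_on {a..b} p'"
  obtains B where "B-lipschitz_on {a..b} p"
proof -
  have "bounded (p' ` {a..b})"
    by (intro compact_imp_bounded compact_continuous_image cont) simp
  then obtain B where B: "0 < B" "\<And>s. s \<in> {a..b} \<Longrightarrow> norm (p' s) \<le> B" unfolding bounded_pos by auto
  have "norm (p s - p r) \<le> B * norm (s - r)" if "s \<in> {a..b}" "r \<in> {a..b}" for s r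
  proof (rule differentiable_bound[of "{a..b}"])
    fix s assume s: "s \<in> {a..b}"
    show "(p has_derivative (\<lambda>h. h *\<^sub>R p' s)) (at s within {a..b})"
      using deriv[OF s] by (simp add: has_vector_derivative_def)
    show "onorm (\<lambda>h. h *\<^sub>R p' s) \<le> B"
      using B(1) B(2)[OF s] by (intro onorm_bound) (auto simp: mult.commute[of B] mult_left_mono)
  qed (use that in auto)
  then have "B-lipschitz_on {a..b} p"
    using B(1) by (auto simp: lipschitz_on_def dist_norm)
  then show ?thesis by (rule that)
qed

locale mfg_data = lagrangian U M c_mu L Lx Lv Lvx Lvv
  for U :: "'a::euclidean_space set"
    and M c_mu :: real
    and L :: "'a \<Rightarrow> 'a \<Rightarrow> real"
    and Lx Lv :: "'a \<Rightarrow> 'a \<Rightarrow> 'a"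
    and Lvx Lvv :: "'a \<Rightarrow> 'a \<Rightarrow> 'a \<Rightarrow> 'a" +
  fixes \<Omega> :: "'a set"
    and T kappa :: real
    and F G :: "'a \<Rightarrow> 'a measure \<Rightarrow> real"
    and m :: "real \<Rightarrow> 'a measure"
  assumes T_pos: "T > 0"
    and bounded_Omega: "bounded \<Omega>"
    and closure_subset_U: "closure \<Omega> \<subseteq> U"
    and D1: "\<forall>y\<in>U. \<forall>m1\<in>Prob_on (closure \<Omega>). \<forall>m2\<in>Prob_on (closure \<Omega>).
               \<bar>F y m1 - F y m2\<bar> + \<bar>G y m1 - G y m2\<bar> \<le> kappa * KR_dist m1 m2"
    and D2: "\<forall>\<mu>\<in>Prob_on (closure \<Omega>). \<exists>DF DG.
               (\<forall>y\<in>U. ((\<lambda>z. F z \<mu>) has_derivative (\<lambda>h. DF y \<bullet> h)) (at y)) \<and>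
               (\<forall>y\<in>U. ((\<lambda>z. G z \<mu>) has_derivative (\<lambda>h. DG y \<bullet> h)) (at y)) \<and>
               continuous_on U DF \<and> continuous_on U DG \<and>
               bounded ((\<lambda>z. F z \<mu>) ` U) \<and> bounded ((\<lambda>z. G z \<mu>) ` U) \<and>
               (\<forall>y\<in>U. norm (DF y) + norm (DG y) \<le> kappa)"
    and m_prob: "\<forall>t\<in>{0..T}. m t \<in> Prob_on (closure \<Omega>)"
    and m_cont: "\<forall>t\<in>{0..T}. \<forall>\<epsilon>>0. \<exists>\<delta>>0. \<forall>s\<in>{0..T}. \<bar>s - t\<bar> < \<delta> \<longrightarrow> KR_dist (m s) (m t) < \<epsilon>"
begin

lemma Gamma_in_U: "\<gamma> \<in> Gamma \<Omega> T \<Longrightarrow> s \<in> {0..T} \<Longrightarrow> apply_bcontfun \<gamma> s \<in> U"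
  using Gamma_closure closure_subset_U by blast

lemma isCont_F:
  assumes "s \<in> {0..T}" "y \<in> U"
  shows "isCont (\<lambda>z. F z (m s)) y"
proof -
  have "m s \<in> Prob_on (closure \<Omega>)" using m_prob assms(1) by blast
  then obtain DF where "((\<lambda>z. F z (m s)) has_derivative (\<lambda>h. DF y \<bullet> h)) (at y)"
    using D2 assms(2) by blast
  then show ?thesis by (rule has_derivative_continuous)
qed

lemma F_uniformly_continuous_in_time:
  assumes s: "s \<in> {0..T}" and "\<epsilon> > 0"
  obtains \<delta> where "\<delta> > 0"
    "\<And>r y. r \<in> {0..T} \<Longrightarrow> \<bar>r - s\<bar> < \<delta> \<Longrightarrow> y \<in> U \<Longrightarrow> \<bar>F y (m r) - F y (m s)\<bar> < \<epsilon>"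
proof -
  have "\<epsilon> / (\<bar>kappa\<bar> + 1) > 0" using \<open>\<epsilon> > 0\<close> by simp
  then obtain \<delta> where \<delta>: "\<delta> > 0"
    "\<And>r. r \<in> {0..T} \<Longrightarrow> \<bar>r - s\<bar> < \<delta> \<Longrightarrow> KR_dist (m r) (m s) < \<epsilon> / (\<bar>kappa\<bar> + 1)"
    using m_cont s by blast
  have "\<bar>F y (m r) - F y (m s)\<bar> < \<epsilon>" if r: "r \<in> {0..T}" "\<bar>r - s\<bar> < \<delta>" and y: "y \<in> U" for r y
  proof -
    obtain DF DG where "norm (DF y :: 'a) + norm (DG y :: 'a) \<le> kappa"
      using D2 m_prob s y by metis
    then have "0 \<le> kappa" by (smt (verit) norm_ge_zero)
    have "\<bar>F y (m r) - F y (m s)\<bar> \<le> kappa * KR_dist (m r) (m s)"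
      using D1[rule_format, OF y, of "m r" "m s"] m_prob r(1) s by fastforce
    also have "\<dots> \<le> kappa * (\<epsilon> / (kappa + 1))"
      using \<delta>(2)[OF r] \<open>0 \<le> kappa\<close> by (intro mult_left_mono) auto
    also have "\<dots> < \<epsilon>" using \<open>0 \<le> kappa\<close> \<open>\<epsilon> > 0\<close> by (simp add: field_simps)
    finally show ?thesis .
  qed
  with \<delta>(1) show ?thesis by (rule that)
qed

lemma continuous_on_F: "continuous_on ({0..T} \<times> U) (\<lambda>(s, y). F y (m s))"
  unfolding continuous_on_iff
proof (intro ballI allI impI)
  fix sy and \<epsilon> :: real assume "sy \<in> {0..T} \<times> U" "\<epsilon> > 0"
  then obtain s y where sy: "sy = (s, y)" "s \<in> {0..T}" "y \<in> U" by auto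
  obtain \<delta>\<^sub>1 where \<delta>\<^sub>1: "\<delta>\<^sub>1 > 0"
    "\<And>r z. r \<in> {0..T} \<Longrightarrow> \<bar>r - s\<bar> < \<delta>\<^sub>1 \<Longrightarrow> z \<in> U \<Longrightarrow> \<bar>F z (m r) - F z (m s)\<bar> < \<epsilon> / 2"
    by (rule F_uniformly_continuous_in_time[OF sy(2) half_gt_zero[OF \<open>\<epsilon> > 0\<close>]]) (rule that)
  obtain \<delta>\<^sub>2 where \<delta>\<^sub>2: "\<delta>\<^sub>2 > 0" "\<And>z. dist z y < \<delta>\<^sub>2 \<Longrightarrow> dist (F z (m s)) (F y (m s)) < \<epsilon> / 2"
    using isCont_F[OF sy(2,3)] half_gt_zero[OF \<open>\<epsilon> > 0\<close>] unfolding continuous_at_eps_delta by blast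
  have "dist (F z (m r)) (F y (m s)) < \<epsilon>"
    if "r \<in> {0..T}" "z \<in> U" "dist (r, z) (s, y) < min \<delta>\<^sub>1 \<delta>\<^sub>2" for r z
  proof -
    have "dist (F z (m r)) (F z (m s)) < \<epsilon> / 2"
      using \<delta>\<^sub>1(2)[of r z] dist_fst_le[of "(r, z)" "(s, y)"] that by (simp add: dist_real_def)
    moreover have "dist (F z (m s)) (F y (m s)) < \<epsilon> / 2"
      using \<delta>\<^sub>2(2)[of z] dist_snd_le[of "(r, z)" "(s, y)"] that by simp
    ultimately show ?thesis
      using dist_triangle[of "F z (m r)" "F y (m s)" "F z (m s)"] by linarith
  qed
  then show "\<exists>\<delta>>0. \<forall>sy'\<in>{0..T} \<times> U. dist sy' sy < \<delta> \<longrightarrow>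
      dist (case sy' of (s, y) \<Rightarrow> F y (m s)) (case sy of (s, y) \<Rightarrow> F y (m s)) < \<epsilon>"
    using \<delta>\<^sub>1(1) \<delta>\<^sub>2(1) by (intro exI[of _ "min \<delta>\<^sub>1 \<delta>\<^sub>2"]) (auto simp: sy(1))
qed

lemma continuous_on_F_path:
  assumes "continuous_on S p" "S \<subseteq> {0..T}" "p ` S \<subseteq> U"
  shows "continuous_on S (\<lambda>s. F (p s) (m s))"
proof -
  have "continuous_on S ((\<lambda>(s, y). F y (m s)) \<circ> (\<lambda>s. (s, p s)))"
    using assms by (intro continuous_on_compose continuous_on_subset[OF continuous_on_F] continuous_intros) auto
  then show ?thesis by (simp add: o_def)
qed

definition F_bound :: real where
  "F_bound = (SOME B. \<forall>s\<in>{0..T}. \<forall>y\<in>closure \<Omega>. \<bar>F y (m s)\<bar> \<le> B)"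

lemma F_bound:
  assumes "s \<in> {0..T}" "y \<in> closure \<Omega>"
  shows "\<bar>F y (m s)\<bar> \<le> F_bound"
proof -
  have "compact (closure \<Omega>)"
    using bounded_Omega by (simp add: compact_eq_bounded_closed bounded_closure)
  then have "bounded ((\<lambda>(s, y). F y (m s)) ` ({0..T} \<times> closure \<Omega>))"
    using closure_subset_U
    by (intro compact_imp_bounded compact_continuous_image compact_Times continuous_on_subset[OF continuous_on_F]) auto
  then have "\<exists>B. \<forall>s\<in>{0..T}. \<forall>y\<in>closure \<Omega>. \<bar>F y (m s)\<bar> \<le> B"
    unfolding bounded_iff by (auto simp: image_iff)
  from someI_ex[OF this] show ?thesis using assms unfolding F_bound_def by blast
qed

definition G_bound :: real where "G_bound = (SOME B. \<forall>y\<in>U. \<bar>G y (m T)\<bar> \<le> B)"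

lemma G_bound:
  assumes "y \<in> U"
  shows "\<bar>G y (m T)\<bar> \<le> G_bound"
proof -
  have "m T \<in> Prob_on (closure \<Omega>)" using m_prob T_pos by auto
  then have "bounded ((\<lambda>z. G z (m T)) ` U)" using D2 by blast
  then have "\<exists>B. \<forall>y\<in>U. \<bar>G y (m T)\<bar> \<le> B" unfolding bounded_iff by auto
  from someI_ex[OF this] show ?thesis using assms unfolding G_bound_def by blast
qed

definition running_cost :: "(real \<Rightarrow> 'a) \<Rightarrow> (real \<Rightarrow> 'a) \<Rightarrow> real \<Rightarrow> real" where
  "running_cost p v s = L (p s) (v s) + F (p s) (m s)"

abbreviation curve_cost :: "(real \<Rightarrow>\<^sub>C 'a) \<Rightarrow> real \<Rightarrow> real" where
  "curve_cost \<gamma> \<equiv> running_cost (apply_bcontfun \<gamma>) (velocity (apply_bcontfun \<gamma>))"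

lemma cost_eq_ext_integral:
  "cost L F G T m t \<gamma> = ext_integral {t..T} (curve_cost \<gamma>) + ereal (G (\<gamma> T) (m T))"
  unfolding cost_def running_cost_def ..

lemma continuous_on_running_cost:
  assumes "continuous_on S p" "continuous_on S v" "S \<subseteq> {0..T}" "p ` S \<subseteq> U"
  shows "continuous_on S (running_cost p v)"
  unfolding running_cost_def using assms
  by (intro continuous_on_add continuous_on_L_path continuous_on_F_path) auto

lemma running_cost_coercive:
  assumes "s \<in> {0..T}" "p s \<in> closure \<Omega>"
  shows "(norm (v s))\<^sup>2 / (4 * c_mu) - (coercivity_const + F_bound) \<le> running_cost p v s"
  using L_coercive[of "p s" "v s"] F_bound[OF assms] assms(2) closure_subset_U
  unfolding running_cost_def by fastforce

lemma curve_cost_lower_bound: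
  assumes "\<gamma> \<in> Gamma \<Omega> T" "s \<in> {0..T}"
  shows "- (coercivity_const + F_bound) \<le> curve_cost \<gamma> s"
proof -
  have "0 \<le> (norm (velocity (apply_bcontfun \<gamma>) s))\<^sup>2 / (4 * c_mu)" using L1_mu by simp
  then show ?thesis
    using running_cost_coercive[OF assms(2), where p = "apply_bcontfun \<gamma>" and v = "velocity (apply_bcontfun \<gamma>)"]
      Gamma_closure[OF assms] by linarith
qed

lemma curve_cost_measurable:
  assumes \<gamma>: "\<gamma> \<in> Gamma \<Omega> T" and ab: "0 \<le> a" "b \<le> T"
  shows "curve_cost \<gamma> \<in> borel_measurable (lebesgue_on {a..b})"
proof -
  let ?K = "closure \<Omega> \<times> (UNIV :: 'a set)" and ?v = "velocity (apply_bcontfun \<gamma>)"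
  have "continuous_on ?K (\<lambda>(y, v). L y v)"
    by (rule continuous_on_subset[OF continuous_on_L]) (use closure_subset_U in auto)
  then have L_meas: "(\<lambda>q. indicator ?K q *\<^sub>R (case q of (y, v) \<Rightarrow> L y v)) \<in> borel_measurable borel"
    by (intro borel_measurable_continuous_on_indicator) (auto intro!: borel_closed closed_Times)
  have "?v absolutely_integrable_on {a..b}"
    by (rule absolutely_integrable_on_subinterval[OF Gamma_velocity(1)[OF \<gamma>]]) (use ab in auto)
  then have v_meas: "?v \<in> borel_measurable (lebesgue_on {a..b})"
    by (intro integrable_imp_measurable) (simp add: absolutely_integrable_on_def)
  have \<gamma>_meas: "apply_bcontfun \<gamma> \<in> borel_measurable (lebesgue_on {a..b})"
    by (intro continuous_imp_measurable_on_sets_lebesgue) auto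
  have "(\<lambda>s. indicator ?K (\<gamma> s, ?v s) *\<^sub>R L (\<gamma> s) (?v s)) \<in> borel_measurable (lebesgue_on {a..b})"
    using measurable_compose[OF borel_measurable_Pair[OF \<gamma>_meas v_meas] L_meas] by simp
  moreover have "(\<lambda>s. F (\<gamma> s) (m s)) \<in> borel_measurable (lebesgue_on {a..b})"
    using ab Gamma_in_U[OF \<gamma>]
    by (intro continuous_imp_measurable_on_sets_lebesgue continuous_on_F_path) auto
  ultimately have "(\<lambda>s. indicator ?K (\<gamma> s, ?v s) *\<^sub>R L (\<gamma> s) (?v s) + F (\<gamma> s) (m s))
      \<in> borel_measurable (lebesgue_on {a..b})"
    by (rule borel_measurable_add)
  then show ?thesis
    by (rule measurable_cong[THEN iffD1, rotated])
      (use Gamma_closure[OF \<gamma>] ab in \<open>auto simp: running_cost_def indicator_def\<close>)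
qed

lemma cost_eq:
  assumes \<gamma>: "\<gamma> \<in> Gamma \<Omega> T" and t: "t \<in> {0..T}"
  shows "curve_cost \<gamma> absolutely_integrable_on {t..T} \<Longrightarrow>
      cost L F G T m t \<gamma> = ereal (integral {t..T} (curve_cost \<gamma>) + G (\<gamma> T) (m T))"
    and "\<not> curve_cost \<gamma> absolutely_integrable_on {t..T} \<Longrightarrow> cost L F G T m t \<gamma> = \<infinity>"
  using ext_integral_bounded_below[OF curve_cost_measurable[OF \<gamma>, of t T], of "coercivity_const + F_bound"]
    curve_cost_lower_bound[OF \<gamma>] t
  unfolding cost_eq_ext_integral by auto

lemma curve_cost_cong:
  assumes "\<And>s. s \<in> {a..b} \<Longrightarrow> apply_bcontfun \<alpha> s = apply_bcontfun \<beta> s" "s \<in> {a..b} - {a, b}"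
  shows "curve_cost \<alpha> s = curve_cost \<beta> s"
  using velocity_eq_on_interval[of a b "apply_bcontfun \<alpha>" "apply_bcontfun \<beta>" s] assms
  unfolding running_cost_def by auto

lemma integral_curve_cost_cong:
  assumes "\<And>s. s \<in> {a..b} \<Longrightarrow> apply_bcontfun \<alpha> s = apply_bcontfun \<beta> s"
  shows "curve_cost \<alpha> absolutely_integrable_on {a..b} \<longleftrightarrow> curve_cost \<beta> absolutely_integrable_on {a..b}"
    and "integral {a..b} (curve_cost \<alpha>) = integral {a..b} (curve_cost \<beta>)"
proof -
  have interior: "curve_cost \<alpha> s = curve_cost \<beta> s" if "s \<in> {a..b} - {a, b}" for s
    by (rule curve_cost_cong[OF assms that])
  show "curve_cost \<alpha> absolutely_integrable_on {a..b} \<longleftrightarrow> curve_cost \<beta> absolutely_integrable_on {a..b}"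
    by (rule absolutely_integrable_spike_eq[of "{a, b}"]) (use interior in auto)
  show "integral {a..b} (curve_cost \<alpha>) = integral {a..b} (curve_cost \<beta>)"
    by (rule integral_spike[of "{a, b}"]) (use interior in auto)
qed

lemma cost_cong:
  assumes "t \<le> T" "\<And>s. s \<in> {t..T} \<Longrightarrow> apply_bcontfun \<alpha> s = apply_bcontfun \<beta> s"
  shows "cost L F G T m t \<alpha> = cost L F G T m t \<beta>"
proof -
  have "{t, T} \<in> null_sets lebesgue" by (simp add: negligible_iff_null_sets[symmetric])
  then have "AE s in lebesgue. s \<in> {t..T} \<longrightarrow> curve_cost \<alpha> s = curve_cost \<beta> s"
    by (rule AE_I') (use curve_cost_cong[OF assms(2)] in auto)
  then show ?thesis
    using assms unfolding cost_eq_ext_integral by (simp add: ext_integral_cong_AE)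
qed

lemma cost_split:
  assumes \<gamma>: "\<gamma> \<in> Gamma \<Omega> T" and ab: "0 \<le> a" "a \<le> b" "b \<le> T"
    and int: "curve_cost \<gamma> absolutely_integrable_on {a..b}"
  shows "cost L F G T m a \<gamma> = ereal (integral {a..b} (curve_cost \<gamma>)) + cost L F G T m b \<gamma>"
proof (cases "curve_cost \<gamma> absolutely_integrable_on {b..T}")
  case True
  then have "curve_cost \<gamma> absolutely_integrable_on {a..T}"
    by (rule absolutely_integrable_on_combine[OF int _ ab(2,3)])
  moreover from this have
    "integral {a..T} (curve_cost \<gamma>) = integral {a..b} (curve_cost \<gamma>) + integral {b..T} (curve_cost \<gamma>)"
    using ab by (simp add: Henstock_Kurzweil_Integration.integral_combine absolutely_integrable_on_def)
  ultimately show ?thesis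
    using cost_eq(1)[OF \<gamma> _ True] cost_eq(1)[OF \<gamma>, of a] ab by simp
next
  case False
  then have "\<not> curve_cost \<gamma> absolutely_integrable_on {a..T}"
    by (rule contrapos_nn) (erule absolutely_integrable_on_subinterval, use ab in auto)
  then show ?thesis using cost_eq(2)[OF \<gamma> _ False] cost_eq(2)[OF \<gamma>, of a] ab by simp
qed

lemma Gamma_join_cost:
  assumes \<alpha>: "\<alpha> \<in> Gamma \<Omega> T" and \<beta>: "\<beta> \<in> Gamma \<Omega> T" and ab: "0 \<le> a" "a \<le> b" "b \<le> T"
    and meet: "apply_bcontfun \<alpha> b = apply_bcontfun \<beta> b"
    and int: "curve_cost \<alpha> absolutely_integrable_on {a..b}"
  obtains \<sigma> where "\<sigma> \<in> Gamma_at \<Omega> T a (\<alpha> a)"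
    "cost L F G T m a \<sigma> = ereal (integral {a..b} (curve_cost \<alpha>)) + cost L F G T m b \<beta>"
proof -
  obtain \<sigma> where \<sigma>: "\<sigma> \<in> Gamma \<Omega> T" "\<And>s. s \<in> {0..b} \<Longrightarrow> apply_bcontfun \<sigma> s = apply_bcontfun \<alpha> s"
    "\<And>s. s \<in> {b..T} \<Longrightarrow> apply_bcontfun \<sigma> s = apply_bcontfun \<beta> s"
    by (rule Gamma_join[OF \<alpha> \<beta> _ meet]) (use ab that in auto)
  have on_ab: "apply_bcontfun \<sigma> s = apply_bcontfun \<alpha> s" if "s \<in> {a..b}" for s
    using \<sigma>(2) ab that by auto
  have "curve_cost \<sigma> absolutely_integrable_on {a..b}"
    using integral_curve_cost_cong(1)[OF on_ab] int by simp
  from cost_split[OF \<sigma>(1) ab this]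
  have "cost L F G T m a \<sigma> = ereal (integral {a..b} (curve_cost \<alpha>)) + cost L F G T m b \<beta>"
    using integral_curve_cost_cong(2)[OF on_ab] cost_cong[OF ab(3) \<sigma>(3)] by simp
  moreover have "\<sigma> \<in> Gamma_at \<Omega> T a (\<alpha> a)" using \<sigma>(1,2) ab by (simp add: Gamma_at_def)
  ultimately show ?thesis using that by blast
qed

lemma C1_competitor:
  fixes p p' :: "real \<Rightarrow> 'a"
  assumes ab: "0 \<le> a" "a \<le> b" "b \<le> T"
    and deriv: "\<And>s. s \<in> {a..b} \<Longrightarrow> (p has_vector_derivative p' s) (at s within {a..b})"
    and cont: "continuous_on {a..b} p'" and cl: "\<And>s. s \<in> {a..b} \<Longrightarrow> p s \<in> closure \<Omega>"
  obtains c where "c \<in> Gamma \<Omega> T" "\<And>s. s \<in> {a..b} \<Longrightarrow> apply_bcontfun c s = p s"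
    "curve_cost c absolutely_integrable_on {a..b}"
    "(running_cost p p' has_integral integral {a..b} (curve_cost c)) {a..b}"
proof -
  obtain B where "B-lipschitz_on {a..b} p" by (rule C1_imp_lipschitz_on[OF deriv cont])
  then have "abs_cont_on {0..T} (\<lambda>s. p (max a (min b s)))"
    by (intro abs_cont_on_clamp[OF lipschitz_on_imp_abs_cont_on ab(2)])
  then obtain c where c: "c \<in> Gamma \<Omega> T" "\<And>s. s \<in> {0..T} \<Longrightarrow> apply_bcontfun c s = p (max a (min b s))"
    by (rule Gamma_from_curve[rotated]) (use T_pos ab cl that in auto)
  have cp: "apply_bcontfun c s = p s" if "s \<in> {a..b}" for s using c(2)[of s] that ab by auto
  have interior: "curve_cost c s = running_cost p p' s" if s: "s \<in> {a..b} - {a, b}" for s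
  proof -
    have "(p has_vector_derivative p' s) (at s)"
      using deriv[of s] s at_within_Icc_at[of a s b] by auto
    then show ?thesis
      using velocity_eq_on_interval[of a b "apply_bcontfun c" p s] cp s
      by (simp add: running_cost_def vector_derivative_at)
  qed
  have "continuous_on {a..b} p"
    unfolding continuous_on_eq_continuous_within using has_vector_derivative_continuous[OF deriv] by blast
  then have "continuous_on {a..b} (running_cost p p')"
    using ab cl closure_subset_U cont by (intro continuous_on_running_cost) auto
  then have int: "running_cost p p' absolutely_integrable_on {a..b}"
    using absolutely_integrable_continuous[of a b "running_cost p p'"] by simp
  have "integral {a..b} (curve_cost c) = integral {a..b} (running_cost p p')"
    by (rule integral_spike[of "{a, b}"]) (use interior in auto)
  moreover have "curve_cost c absolutely_integrable_on {a..b}"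
    by (rule absolutely_integrable_spike[OF int, of "{a, b}"]) (use interior in auto)
  ultimately show ?thesis
    using that[OF c(1) cp] integrable_integral[of "running_cost p p'" "{a..b}"] int
    by (simp add: absolutely_integrable_on_def)
qed

text \<open>Optimality is stated relative to \<open>m\<close>, which agrees with the evaluation flow on \<open>[0, T]\<close> only.\<close>
definition optimal :: "(real \<Rightarrow>\<^sub>C 'a) \<Rightarrow> bool" where
  "optimal \<gamma> \<longleftrightarrow> \<gamma> \<in> Gamma \<Omega> T \<and>
     (\<forall>\<sigma>\<in>Gamma_at \<Omega> T 0 (\<gamma> 0). cost L F G T m 0 \<gamma> \<le> cost L F G T m 0 \<sigma>)"

lemma optimal_in_Gamma: "optimal \<gamma> \<Longrightarrow> \<gamma> \<in> Gamma \<Omega> T"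
  by (simp add: optimal_def)

lemma optimal_cost_upper_bound:
  assumes opt: "optimal \<gamma>"
  shows "cost L F G T m 0 \<gamma> \<le> ereal (T * (M + F_bound) + G_bound)"
proof -
  have x0: "\<gamma> 0 \<in> closure \<Omega>" "\<gamma> 0 \<in> U"
    using Gamma_closure[OF optimal_in_Gamma[OF opt], of 0] Gamma_in_U[OF optimal_in_Gamma[OF opt], of 0] T_pos by auto
  obtain c where c: "c \<in> Gamma \<Omega> T" "\<And>s. s \<in> {0..T} \<Longrightarrow> apply_bcontfun c s = \<gamma> 0"
    "curve_cost c absolutely_integrable_on {0..T}"
    "(running_cost (\<lambda>_. \<gamma> 0) (\<lambda>_. 0) has_integral integral {0..T} (curve_cost c)) {0..T}"
    by (rule C1_competitor[of 0 T "\<lambda>_. \<gamma> 0" "\<lambda>_. 0"]) (use T_pos x0 that in auto)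
  have "integral {0..T} (curve_cost c) \<le> (T - 0) * (M + F_bound)"
  proof (rule has_integral_le[OF c(4)])
    show "((\<lambda>_. M + F_bound) has_integral (T - 0) * (M + F_bound)) {0..T}"
      using has_integral_const_real[of "M + F_bound" 0 T] T_pos by simp
    show "running_cost (\<lambda>_. \<gamma> 0) (\<lambda>_. 0) s \<le> M + F_bound" if "s \<in> {0..T}" for s
      using F_bound[OF that x0(1)] L_bound_at_0(1)[OF x0(2)] unfolding running_cost_def by linarith
  qed
  moreover have "G (c T) (m T) \<le> G_bound"
    using G_bound[OF x0(2)] c(2)[of T] T_pos by simp
  ultimately have bound: "integral {0..T} (curve_cost c) + G (c T) (m T) \<le> T * (M + F_bound) + G_bound"
    by simp
  have "cost L F G T m 0 \<gamma> \<le> cost L F G T m 0 c"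
    using opt c(1,2) T_pos by (simp add: optimal_def Gamma_at_def)
  also have "\<dots> = ereal (integral {0..T} (curve_cost c) + G (c T) (m T))"
    using cost_eq(1)[OF c(1) _ c(3)] T_pos by simp
  also have "\<dots> \<le> ereal (T * (M + F_bound) + G_bound)" using bound by simp
  finally show ?thesis .
qed

lemma optimal_integrable:
  assumes "optimal \<gamma>" "0 \<le> a" "b \<le> T"
  shows "curve_cost \<gamma> absolutely_integrable_on {a..b}"
proof -
  have "curve_cost \<gamma> absolutely_integrable_on {0..T}"
    using cost_eq(2)[OF optimal_in_Gamma[OF assms(1)], of 0] optimal_cost_upper_bound[OF assms(1)] T_pos by fastforce
  then show ?thesis
    by (rule absolutely_integrable_on_subinterval) (use assms(2,3) in auto)
qed

lemma optimal_cost_eq: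
  assumes "optimal \<gamma>" "t \<in> {0..T}"
  shows "cost L F G T m t \<gamma> = ereal (integral {t..T} (curve_cost \<gamma>) + G (\<gamma> T) (m T))"
  using cost_eq(1)[OF optimal_in_Gamma[OF assms(1)] assms(2) optimal_integrable[OF assms(1)]] assms(2) by simp

lemma optimal_tail:
  assumes opt: "optimal \<gamma>" and a: "0 \<le> a" "a \<le> T" and \<sigma>: "\<sigma> \<in> Gamma_at \<Omega> T a (\<gamma> a)"
  shows "cost L F G T m a \<gamma> \<le> cost L F G T m a \<sigma>"
proof -
  note \<gamma> = optimal_in_Gamma[OF opt] and int = optimal_integrable[OF opt order_refl a(2)]
  have \<sigma>': "\<sigma> \<in> Gamma \<Omega> T" "apply_bcontfun \<gamma> a = \<sigma> a" using \<sigma> by (auto simp: Gamma_at_def)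
  obtain \<tau> where \<tau>: "\<tau> \<in> Gamma_at \<Omega> T 0 (\<gamma> 0)"
    "cost L F G T m 0 \<tau> = ereal (integral {0..a} (curve_cost \<gamma>)) + cost L F G T m a \<sigma>"
    by (rule Gamma_join_cost[OF \<gamma> \<sigma>'(1) order_refl a \<sigma>'(2) int])
  have "cost L F G T m 0 \<gamma> \<le> cost L F G T m 0 \<tau>"
    using opt \<tau>(1) by (simp add: optimal_def)
  then show ?thesis
    unfolding \<tau>(2) cost_split[OF \<gamma> order_refl a int] by (simp add: ereal_add_le_add_iff)
qed

lemma optimal_on_interval:
  assumes opt: "optimal \<gamma>" and ab: "0 \<le> a" "a \<le> b" "b \<le> T" and c: "c \<in> Gamma \<Omega> T"
    and ends: "apply_bcontfun c a = \<gamma> a" "apply_bcontfun c b = \<gamma> b"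
    and int: "curve_cost c absolutely_integrable_on {a..b}"
  shows "integral {a..b} (curve_cost \<gamma>) \<le> integral {a..b} (curve_cost c)"
proof -
  note \<gamma> = optimal_in_Gamma[OF opt]
  obtain \<sigma> where \<sigma>: "\<sigma> \<in> Gamma_at \<Omega> T a (c a)"
    "cost L F G T m a \<sigma> = ereal (integral {a..b} (curve_cost c)) + cost L F G T m b \<gamma>"
    by (rule Gamma_join_cost[OF c \<gamma> ab ends(2) int])
  have "cost L F G T m a \<gamma> \<le> cost L F G T m a \<sigma>"
    using \<sigma>(1) ab ends(1) by (intro optimal_tail[OF opt]) auto
  then show ?thesis
    using \<sigma>(2) cost_split[OF \<gamma> ab optimal_integrable[OF opt ab(1,3)]] optimal_cost_eq[OF opt, of b] ab by simp
qed

end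

locale mfg_solution = mfg_data U M c_mu L Lx Lv Lvx Lvv \<Omega> T kappa F G m
  for U :: "'a::euclidean_space set"
    and M c_mu :: real
    and L :: "'a \<Rightarrow> 'a \<Rightarrow> real"
    and Lx Lv :: "'a \<Rightarrow> 'a \<Rightarrow> 'a"
    and Lvx Lvv :: "'a \<Rightarrow> 'a \<Rightarrow> 'a \<Rightarrow> 'a"
    and \<Omega> :: "'a set"
    and T kappa :: real
    and F G :: "'a \<Rightarrow> 'a measure \<Rightarrow> real"
    and m :: "real \<Rightarrow> 'a measure" +
  fixes u :: "real \<Rightarrow> 'a \<Rightarrow> real"
  assumes mild: "mild_solution \<Omega> T L F G u m"
begin

lemma value_function:
  "t \<in> {0..T} \<Longrightarrow> x \<in> closure \<Omega> \<Longrightarrow> ereal (u t x) = (INF \<gamma>\<in>Gamma_at \<Omega> T t x. cost L F G T m t \<gamma>)"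
  using mild unfolding mild_solution_def by blast

lemma value_le_cost:
  assumes "\<gamma> \<in> Gamma \<Omega> T" "t \<in> {0..T}"
  shows "ereal (u t (\<gamma> t)) \<le> cost L F G T m t \<gamma>"
  unfolding value_function[OF assms(2) Gamma_closure[OF assms]]
  by (rule INF_lower) (use assms in \<open>simp add: Gamma_at_def\<close>)

lemma value_along_optimal:
  assumes opt: "optimal \<gamma>" and ab: "0 \<le> a" "a \<le> b" "b \<le> T"
  shows "integral {a..b} (curve_cost \<gamma>) + u b (\<gamma> b) \<le> u a (\<gamma> a)"
proof -
  note \<gamma> = optimal_in_Gamma[OF opt]
  have "cost L F G T m a \<gamma> \<le> ereal (u a (\<gamma> a))"
    using ab Gamma_closure[OF \<gamma>, of a]
    by (subst value_function) (auto intro!: INF_greatest optimal_tail[OF opt])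
  moreover have "ereal (u b (\<gamma> b)) \<le> cost L F G T m b \<gamma>" using value_le_cost[OF \<gamma>] ab by simp
  ultimately show ?thesis
    using cost_split[OF \<gamma> ab optimal_integrable[OF opt ab(1,3)]] optimal_cost_eq[OF opt, of b] ab by simp
qed

lemma value_dynamic_programming:
  assumes ab: "0 \<le> a" "a \<le> b" "b \<le> T" and c: "c \<in> Gamma \<Omega> T"
    and int: "curve_cost c absolutely_integrable_on {a..b}"
  shows "u a (c a) \<le> integral {a..b} (curve_cost c) + u b (c b)"
proof -
  have "ereal (u a (c a) - integral {a..b} (curve_cost c)) \<le> cost L F G T m b \<sigma>"
    if \<sigma>: "\<sigma> \<in> Gamma_at \<Omega> T b (c b)" for \<sigma>
  proof -
    have \<sigma>': "\<sigma> \<in> Gamma \<Omega> T" "apply_bcontfun c b = \<sigma> b" using \<sigma> by (auto simp: Gamma_at_def)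
    obtain \<tau> where \<tau>: "\<tau> \<in> Gamma_at \<Omega> T a (c a)"
      "cost L F G T m a \<tau> = ereal (integral {a..b} (curve_cost c)) + cost L F G T m b \<sigma>"
      by (rule Gamma_join_cost[OF c \<sigma>'(1) ab \<sigma>'(2) int])
    then have "ereal (u a (c a)) \<le> ereal (integral {a..b} (curve_cost c)) + cost L F G T m b \<sigma>"
      using value_le_cost[of \<tau> a] ab by (auto simp: Gamma_at_def)
    then show ?thesis by (cases "cost L F G T m b \<sigma>") auto
  qed
  then have "ereal (u a (c a) - integral {a..b} (curve_cost c)) \<le> ereal (u b (c b))"
    using ab Gamma_closure[OF c, of b] by (subst value_function) (auto intro!: INF_greatest)
  then show ?thesis by simp
qed

end

section \<open>Optimal curves through points of the support\<close>

lemma closed_msupport: "closed (msupport \<eta>)"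
proof -
  have "- msupport \<eta> = \<Union>{S. open S \<and> emeasure \<eta> S = 0}"
    by (auto simp: msupport_def zero_less_iff_neq_zero)
  then have "open (- msupport \<eta>)" by (auto intro: open_Union)
  then show ?thesis by (simp add: closed_def)
qed

definition countable_network_on :: "'b::topological_space set \<Rightarrow> 'b set set \<Rightarrow> bool" where
  "countable_network_on C \<N> \<longleftrightarrow> countable \<N> \<and> (\<forall>S. open S \<longrightarrow> (\<forall>x\<in>S \<inter> C. \<exists>N\<in>\<N>. x \<in> N \<and> N \<subseteq> S))"

lemma msupport_meets_open:
  assumes sets: "sets \<eta> = sets borel" and C: "C \<in> sets \<eta>" "emeasure \<eta> (- C) = 0"
    and network: "countable_network_on C \<N>" and A: "open A" "emeasure \<eta> A > 0"
  shows "msupport \<eta> \<inter> A \<noteq> {}"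
proof
  assume empty: "msupport \<eta> \<inter> A = {}"
  define \<N>\<^sub>0 where "\<N>\<^sub>0 = {N \<in> \<N>. \<exists>S. open S \<and> emeasure \<eta> S = 0 \<and> N \<subseteq> S}"
  have "\<forall>N\<in>\<N>\<^sub>0. \<exists>S. open S \<and> emeasure \<eta> S = 0 \<and> N \<subseteq> S" by (simp add: \<N>\<^sub>0_def)
  from bchoice[OF this] obtain S where S: "\<forall>N\<in>\<N>\<^sub>0. open (S N) \<and> emeasure \<eta> (S N) = 0 \<and> N \<subseteq> S N" ..
  have "countable \<N>\<^sub>0"
    using network countable_subset[of \<N>\<^sub>0 \<N>] by (auto simp: \<N>\<^sub>0_def countable_network_on_def)
  then have null_cover: "(\<Union>N\<in>\<N>\<^sub>0. S N) \<in> null_sets \<eta>"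
    by (rule null_sets_UN') (use S sets in \<open>auto simp: null_sets_def\<close>)
  have null_compl: "- C \<in> null_sets \<eta>"
    using C sets_eq_imp_space_eq[OF sets] sets.compl_sets[OF C(1)] by (simp add: null_sets_def Compl_eq_Diff_UNIV)
  have cover: "A \<subseteq> (\<Union>N\<in>\<N>\<^sub>0. S N) \<union> - C"
  proof
    fix x assume "x \<in> A"
    show "x \<in> (\<Union>N\<in>\<N>\<^sub>0. S N) \<union> - C"
    proof (cases "x \<in> C")
      case True
      have "x \<notin> msupport \<eta>" using \<open>x \<in> A\<close> empty by blast
      then obtain W where W: "open W" "x \<in> W" "emeasure \<eta> W = 0"
        unfolding msupport_def by (auto simp: zero_less_iff_neq_zero)
      then obtain N where "N \<in> \<N>" "x \<in> N" "N \<subseteq> W"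
        using network True unfolding countable_network_on_def by blast
      then have "N \<in> \<N>\<^sub>0" using W by (auto simp: \<N>\<^sub>0_def)
      then show ?thesis using S \<open>x \<in> N\<close> by blast
    qed simp
  qed
  have "A \<in> null_sets \<eta>"
    by (rule null_sets_subset[OF null_sets.Un[OF null_cover null_compl] _ cover]) (use A(1) sets in simp)
  then show False using A(2) by (auto simp: null_sets_def)
qed

lemma dist_Cpaths_le:
  assumes "0 \<le> T" "x \<in> Cpaths \<Omega> T" "y \<in> Cpaths \<Omega> T"
    and "\<And>s. s \<in> {0..T} \<Longrightarrow> dist (apply_bcontfun x s) (apply_bcontfun y s) \<le> e"
  shows "dist x y \<le> e"
proof (rule dist_bound)
  fix s
  have "x s = x (max 0 (min T s))" "y s = y (max 0 (min T s))" using assms(2,3) by (auto simp: Cpaths_def)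
  moreover have "max 0 (min T s) \<in> {0..T}" using assms(1) by auto
  ultimately show "dist (x s) (y s) \<le> e" using assms(4) by metis
qed

text \<open>Curves within distance \<open>\<epsilon>\<close> of the step function with mesh \<open>1 / k\<close> and values \<open>ds\<close>.\<close>
definition step_tube :: "'a::euclidean_space set \<Rightarrow> real \<Rightarrow> real \<Rightarrow> nat \<Rightarrow> 'a list \<Rightarrow> (real \<Rightarrow>\<^sub>C 'a) set" where
  "step_tube \<Omega> T \<epsilon> k ds =
     {x \<in> Cpaths \<Omega> T. \<forall>s\<in>{0..T}. dist (apply_bcontfun x s) (ds ! nat \<lfloor>s * real k\<rfloor>) < \<epsilon>}"

lemma dist_le_in_step_tube:
  assumes "0 \<le> T" "x \<in> step_tube \<Omega> T \<epsilon> k ds" "y \<in> step_tube \<Omega> T \<epsilon> k ds"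
  shows "dist x y \<le> 2 * \<epsilon>"
proof (rule dist_Cpaths_le[OF assms(1)])
  show "x \<in> Cpaths \<Omega> T" "y \<in> Cpaths \<Omega> T" using assms(2,3) by (auto simp: step_tube_def)
  fix s assume s: "s \<in> {0..T}"
  let ?d = "ds ! nat \<lfloor>s * real k\<rfloor>"
  have "dist (x s) ?d < \<epsilon>" "dist (y s) ?d < \<epsilon>" using assms(2,3) s by (auto simp: step_tube_def)
  then show "dist (x s) (y s) \<le> 2 * \<epsilon>" using dist_triangle2[of "x s" "y s" ?d] by linarith
qed

lemma step_tube_exists:
  fixes D :: "'a::euclidean_space set"
  assumes x: "x \<in> Cpaths \<Omega> T" and "\<epsilon> > 0" and dense: "\<And>X. open X \<Longrightarrow> X \<noteq> {} \<Longrightarrow> \<exists>d\<in>D. d \<in> X"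
  obtains k ds where "ds \<in> lists D" "x \<in> step_tube \<Omega> T \<epsilon> k ds"
proof -
  have "uniformly_continuous_on {0..T} (apply_bcontfun x)"
    by (intro compact_uniformly_continuous) auto
  then obtain d where d: "d > 0" "\<And>r s. r \<in> {0..T} \<Longrightarrow> s \<in> {0..T} \<Longrightarrow> \<bar>s - r\<bar> < d \<Longrightarrow> dist (x s) (x r) < \<epsilon> / 2"
    using half_gt_zero[OF \<open>\<epsilon> > 0\<close>] unfolding uniformly_continuous_on_def dist_real_def by metis
  obtain k :: nat where k: "k > 0" "1 / real k < d"
    using reals_Archimedean[OF d(1)] unfolding inverse_eq_divide by (meson zero_less_Suc)
  have "\<exists>q\<in>D. dist (x (real i / real k)) q < \<epsilon> / 2" for i
    using dense[of "ball (x (real i / real k)) (\<epsilon> / 2)"] \<open>\<epsilon> > 0\<close> by (auto simp: not_le)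
  then obtain q where q: "\<And>i. q i \<in> D" "\<And>i. dist (x (real i / real k)) (q i) < \<epsilon> / 2" by metis
  define ds where "ds = map q [0..<Suc (nat \<lfloor>T * real k\<rfloor>)]"
  have "dist (x s) (ds ! nat \<lfloor>s * real k\<rfloor>) < \<epsilon>" if s: "s \<in> {0..T}" for s
  proof -
    define i where "i = nat \<lfloor>s * real k\<rfloor>"
    have "0 \<le> s * real k" "s * real k \<le> T * real k" using s by (auto intro: mult_right_mono)
    then have i: "real i \<le> s * real k" "s * real k < real i + 1" "i \<le> nat \<lfloor>T * real k\<rfloor>"
      unfolding i_def by (linarith, linarith, intro nat_mono floor_mono)
    then have "real i / real k \<le> s" "s < (real i + 1) / real k"
      using k(1) by (simp_all add: pos_divide_le_eq pos_less_divide_eq)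
    then have "dist (x s) (x (real i / real k)) < \<epsilon> / 2"
      using s k by (intro d(2)) (auto simp: add_divide_distrib)
    moreover have "ds ! i = q i" using i(3) by (simp add: ds_def del: upt_Suc)
    ultimately show ?thesis
      using q(2)[of i] dist_triangle[of "x s" "q i" "x (real i / real k)"] unfolding i_def by simp
  qed
  then have "x \<in> step_tube \<Omega> T \<epsilon> k ds" using x by (simp add: step_tube_def)
  moreover have "ds \<in> lists D" using q(1) by (auto simp: ds_def)
  ultimately show ?thesis using that by blast
qed

lemma Cpaths_countable_network:
  assumes "0 \<le> T"
  obtains \<N> where "countable_network_on (Cpaths \<Omega> T :: (real \<Rightarrow>\<^sub>C 'a::euclidean_space) set) \<N>"
proof -
  obtain D :: "'a set" where D: "countable D" "\<And>X. open X \<Longrightarrow> X \<noteq> {} \<Longrightarrow> \<exists>d\<in>D. d \<in> X"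
    using countable_dense_exists by blast
  define \<N> where "\<N> = (\<lambda>(n, k, ds). step_tube \<Omega> T (1 / real (Suc n)) k ds) ` (UNIV \<times> UNIV \<times> lists D)"
  have "\<exists>N\<in>\<N>. x \<in> N \<and> N \<subseteq> S" if "open S" and x: "x \<in> S \<inter> Cpaths \<Omega> T" for S x
  proof -
    obtain e where "e > 0" "ball x e \<subseteq> S" using \<open>open S\<close> x openE by blast
    obtain n where n: "1 / real (Suc n) < e / 2"
      using reals_Archimedean[OF half_gt_zero[OF \<open>e > 0\<close>]] by (auto simp: inverse_eq_divide)
    obtain k ds where ds: "ds \<in> lists D" "x \<in> step_tube \<Omega> T (1 / real (Suc n)) k ds"
      by (rule step_tube_exists[of x \<Omega> T "1 / real (Suc n)" D]) (use x D(2) in auto)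
    have "step_tube \<Omega> T (1 / real (Suc n)) k ds \<subseteq> ball x e"
    proof
      fix y assume "y \<in> step_tube \<Omega> T (1 / real (Suc n)) k ds"
      from dist_le_in_step_tube[OF assms ds(2) this] show "y \<in> ball x e" using n by simp
    qed
    moreover have "step_tube \<Omega> T (1 / real (Suc n)) k ds \<in> \<N>"
      unfolding \<N>_def using ds(1) by (intro image_eqI[of _ _ "(n, k, ds)"]) auto
    ultimately show ?thesis using ds(2) \<open>ball x e \<subseteq> S\<close> by blast
  qed
  moreover have "countable \<N>" using D(1) by (simp add: \<N>_def)
  ultimately show ?thesis
    using that[of \<N>] unfolding countable_network_on_def by blast
qed

lemma Cpaths_Arzela_Ascoli:
  fixes f :: "nat \<Rightarrow> real \<Rightarrow>\<^sub>C 'a::euclidean_space"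
  assumes T: "T \<ge> 0" and f: "\<And>n. f n \<in> Cpaths \<Omega> T" and bdd: "bounded \<Omega>"
    and equi: "\<And>e. e > 0 \<Longrightarrow> \<exists>d>0. \<forall>n. \<forall>a\<in>{0..T}. \<forall>b\<in>{0..T}. \<bar>b - a\<bar> < d \<longrightarrow> norm (f n b - f n a) < e"
  obtains l k where "strict_mono (k :: nat \<Rightarrow> nat)" "(\<lambda>n. f (k n)) \<longlonglongrightarrow> l"
proof -
  obtain B where B: "\<And>y. y \<in> closure \<Omega> \<Longrightarrow> norm y \<le> B"
    using bounded_closure[OF bdd] unfolding bounded_iff by blast
  obtain g k where gk: "strict_mono (k :: nat \<Rightarrow> nat)"
    "\<And>e. 0 < e \<Longrightarrow> \<exists>N. \<forall>n x. n \<ge> N \<and> x \<in> {0..T} \<longrightarrow> norm (f (k n) x - g x) < e"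
  proof (rule Arzela_Ascoli[of "{0..T}" "\<lambda>n. apply_bcontfun (f n)" B])
    show "norm (f n x) \<le> B" if "x \<in> {0..T}" for n x
      using f[of n] that by (intro B) (auto simp: Cpaths_def)
    show "\<exists>d>0. \<forall>n y. y \<in> {0..T} \<and> norm (x - y) < d \<longrightarrow> norm (f n x - f n y) < e"
      if x: "x \<in> {0..T}" and e: "0 < e" for x e
    proof -
      obtain d where "d > 0" "\<And>n a b. a \<in> {0..T} \<Longrightarrow> b \<in> {0..T} \<Longrightarrow> \<bar>b - a\<bar> < d \<Longrightarrow> norm (f n b - f n a) < e"
        using equi[OF e] by blast
      then show ?thesis using x by (intro exI[of _ d]) auto
    qed
  qed (use that in auto)
  have "uniform_limit UNIV (\<lambda>n. apply_bcontfun (f (k n))) (\<lambda>s. g (max 0 (min T s))) sequentially"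
  proof (rule uniform_limitI)
    fix e :: real assume "e > 0"
    then obtain N where N: "\<And>n x. n \<ge> N \<Longrightarrow> x \<in> {0..T} \<Longrightarrow> norm (f (k n) x - g x) < e"
      using gk(2) by blast
    have "dist (f (k n) s) (g (max 0 (min T s))) < e" if "n \<ge> N" for n s
    proof -
      have "f (k n) s = f (k n) (max 0 (min T s))" using f[of "k n"] by (auto simp: Cpaths_def)
      moreover have "max 0 (min T s) \<in> {0..T}" using T by auto
      ultimately show ?thesis using N[OF that] by (metis dist_norm)
    qed
    then show "\<forall>\<^sub>F n in sequentially. \<forall>x\<in>UNIV. dist (f (k n) x) (g (max 0 (min T x))) < e"
      unfolding eventually_sequentially by blast
  qed
  then obtain l where "(\<lambda>n. f (k n)) \<longlonglongrightarrow> l"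
    by (rule uniform_limit_bcontfunE) auto
  with gk(1) show ?thesis by (rule that)
qed

lemma continuous_on_apply_bcontfun_at: "continuous_on UNIV (\<lambda>\<gamma>. apply_bcontfun \<gamma> t)"
  unfolding continuous_on_iff using dist_fun_lt_imp_dist_val_lt by blast

lemma msupport_eval_flow_approx:
  fixes \<eta> :: "(real \<Rightarrow>\<^sub>C 'a::euclidean_space) measure"
  assumes "T > 0" and \<eta>: "prob_space \<eta>" "sets \<eta> = sets borel" "emeasure \<eta> (Cpaths \<Omega> T) = 1"
    and x: "x \<in> msupport (eval_flow \<eta> t)" and "e > 0"
  obtains \<gamma> where "\<gamma> \<in> msupport \<eta>" "dist (apply_bcontfun \<gamma> t) x < e"
proof -
  let ?A = "(\<lambda>\<gamma>. apply_bcontfun \<gamma> t) -` ball x e"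
  interpret prob_space \<eta> by (rule \<eta>(1))
  have space: "space \<eta> = UNIV" using sets_eq_imp_space_eq[OF \<eta>(2)] by simp
  have C: "Cpaths \<Omega> T \<in> sets \<eta>"
    using \<eta>(3) emeasure_notin_sets by (metis zero_neq_one)
  have "emeasure \<eta> (- Cpaths \<Omega> T) = emeasure \<eta> (space \<eta>) - emeasure \<eta> (Cpaths \<Omega> T)"
    using emeasure_compl[OF C] \<eta>(3) by (simp add: space Compl_eq_Diff_UNIV)
  then have "emeasure \<eta> (- Cpaths \<Omega> T) = 0" using \<eta>(3) emeasure_space_1 by simp
  moreover obtain \<N> where "countable_network_on (Cpaths \<Omega> T :: (real \<Rightarrow>\<^sub>C 'a) set) \<N>"
    by (rule Cpaths_countable_network[OF less_imp_le[OF \<open>T > 0\<close>]])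
  moreover have "open ?A"
    by (rule open_vimage[OF open_ball continuous_on_apply_bcontfun_at])
  moreover have "emeasure \<eta> ?A > 0"
  proof -
    have "(\<lambda>\<gamma>. apply_bcontfun \<gamma> t) \<in> borel_measurable \<eta>"
      using borel_measurable_continuous_onI[OF continuous_on_apply_bcontfun_at] measurable_cong_sets[OF \<eta>(2) refl]
      by blast
    then have "emeasure (eval_flow \<eta> t) (ball x e) = emeasure \<eta> ?A"
      by (simp add: eval_flow_def emeasure_distr space)
    moreover have "emeasure (eval_flow \<eta> t) (ball x e) > 0"
      using x[unfolded msupport_def, simplified, rule_format, of "ball x e"] \<open>e > 0\<close> by simp
    ultimately show ?thesis by simp
  qed
  ultimately have "msupport \<eta> \<inter> ?A \<noteq> {}"
    by (intro msupport_meets_open[OF \<eta>(2) C])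
  then show ?thesis using that by (auto simp: dist_commute)
qed

lemma has_integral_norm_diff_power2:
  fixes f :: "real \<Rightarrow> 'b::euclidean_space"
  assumes f: "(f has_integral I) {a..b}" and sq: "(\<lambda>s. (norm (f s))\<^sup>2) integrable_on {a..b}" and "a \<le> b"
  shows "((\<lambda>s. (norm (f s - w))\<^sup>2) has_integral
    (integral {a..b} (\<lambda>s. (norm (f s))\<^sup>2) - 2 * (I \<bullet> w) + (b - a) * (norm w)\<^sup>2)) {a..b}"
proof -
  have "((\<lambda>s. f s \<bullet> w) has_integral (I \<bullet> w)) {a..b}"
    using has_integral_linear[OF f bounded_linear_inner_left] by (simp add: o_def)
  then have "((\<lambda>s. (norm (f s))\<^sup>2 - 2 * (f s \<bullet> w) + (norm w)\<^sup>2) has_integral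
    (integral {a..b} (\<lambda>s. (norm (f s))\<^sup>2) - 2 * (I \<bullet> w) + (b - a) * (norm w)\<^sup>2)) {a..b}"
    using has_integral_const_real[of "(norm w)\<^sup>2" a b] \<open>a \<le> b\<close>
    by (intro has_integral_add has_integral_diff has_integral_mult_right integrable_integral[OF sq]) auto
  moreover have "(norm (f s - w))\<^sup>2 = (norm (f s))\<^sup>2 - 2 * (f s \<bullet> w) + (norm w)\<^sup>2" for s
    by (simp add: power2_norm_eq_inner inner_diff_left inner_diff_right inner_commute)
  ultimately show ?thesis by simp
qed

lemma power2_norm_integral_le:
  fixes f :: "real \<Rightarrow> 'b::euclidean_space"
  assumes f: "(f has_integral I) {a..b}" and "(\<lambda>s. (norm (f s))\<^sup>2) integrable_on {a..b}" "a \<le> b"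
  shows "(norm I)\<^sup>2 \<le> (b - a) * integral {a..b} (\<lambda>s. (norm (f s))\<^sup>2)"
proof (cases "a = b")
  case True
  then have "(f has_integral 0) {a..b}" by (simp add: has_integral_refl)
  then have "I = 0" by (rule has_integral_unique[OF f])
  then show ?thesis using True by simp
next
  case False
  let ?w = "I /\<^sub>R (b - a)" and ?E = "integral {a..b} (\<lambda>s. (norm (f s))\<^sup>2)"
  have "0 \<le> ?E - 2 * (I \<bullet> ?w) + (b - a) * (norm ?w)\<^sup>2"
    by (rule has_integral_nonneg[OF has_integral_norm_diff_power2[OF assms]]) simp
  also have "I \<bullet> ?w = (norm I)\<^sup>2 / (b - a)"
    by (simp add: power2_norm_eq_inner divide_inverse_commute)
  also have "(b - a) * (norm ?w)\<^sup>2 = (norm I)\<^sup>2 / (b - a)"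
    using False by (simp add: power2_eq_square divide_simps)
  finally have "(norm I)\<^sup>2 / (b - a) \<le> ?E" by simp
  then show ?thesis using False \<open>a \<le> b\<close> by (simp add: pos_divide_le_eq mult.commute)
qed

context mfg_data
begin

lemma optimal_energy_integrable:
  assumes opt: "optimal \<gamma>" and ab: "0 \<le> a" "b \<le> T"
  shows "(\<lambda>s. (norm (velocity (apply_bcontfun \<gamma>) s))\<^sup>2) integrable_on {a..b}"
proof -
  note \<gamma> = optimal_in_Gamma[OF opt]
  let ?v = "velocity (apply_bcontfun \<gamma>)" and ?k = "coercivity_const + F_bound"
  have "curve_cost \<gamma> integrable_on {0..T}"
    using optimal_integrable[OF opt, of 0 T] by (simp add: absolutely_integrable_on_def)
  then have dominating: "(\<lambda>s. 4 * c_mu * (curve_cost \<gamma> s + ?k)) integrable_on {0..T}"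
    by (intro integrable_on_mult_right integrable_add) auto
  have "?v integrable_on {0..T}" using Gamma_velocity(1)[OF \<gamma>] by (simp add: absolutely_integrable_on_def)
  then have "?v \<in> borel_measurable (lebesgue_on {0..T})" by (rule integrable_imp_measurable)
  then have "(\<lambda>s. (norm (?v s))\<^sup>2) \<in> borel_measurable (lebesgue_on {0..T})" by measurable
  then have "(\<lambda>s. (norm (?v s))\<^sup>2) integrable_on {0..T}"
  proof (rule measurable_bounded_by_integrable_imp_integrable[OF _ dominating])
    fix s assume s: "s \<in> {0..T}"
    have "(norm (?v s))\<^sup>2 / (4 * c_mu) \<le> curve_cost \<gamma> s + ?k"
      using running_cost_coercive[OF s, of "apply_bcontfun \<gamma>" ?v] Gamma_closure[OF \<gamma> s] by linarith
    then show "norm ((norm (?v s))\<^sup>2) \<le> 4 * c_mu * (curve_cost \<gamma> s + ?k)"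
      using L1_mu by (simp add: field_simps)
  qed simp
  then show ?thesis by (rule integrable_on_subinterval) (use ab in auto)
qed

lemma optimal_energy_le_cost:
  assumes opt: "optimal \<gamma>" and ab: "0 \<le> a" "a \<le> b" "b \<le> T"
  shows "integral {a..b} (\<lambda>s. (norm (velocity (apply_bcontfun \<gamma>) s))\<^sup>2) / (4 * c_mu)
      - (b - a) * (coercivity_const + F_bound) \<le> integral {a..b} (curve_cost \<gamma>)"
proof -
  let ?v = "velocity (apply_bcontfun \<gamma>)" and ?k = "coercivity_const + F_bound"
  have lower: "((\<lambda>s. (norm (?v s))\<^sup>2 / (4 * c_mu) - ?k) has_integral
      (integral {a..b} (\<lambda>s. (norm (?v s))\<^sup>2) / (4 * c_mu) - (b - a) * ?k)) {a..b}"
    using has_integral_diff[OF has_integral_divide[OF integrable_integral[OF optimal_energy_integrable[OF opt ab(1,3)]]]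
        has_integral_const_real[of ?k a b]] ab(2) by simp
  have upper: "(curve_cost \<gamma> has_integral integral {a..b} (curve_cost \<gamma>)) {a..b}"
    using optimal_integrable[OF opt ab(1,3)] by (simp add: absolutely_integrable_on_def integrable_integral)
  show ?thesis
  proof (rule has_integral_le[OF lower upper])
    fix s assume "s \<in> {a..b}"
    then have s: "s \<in> {0..T}" using ab by auto
    show "(norm (?v s))\<^sup>2 / (4 * c_mu) - ?k \<le> curve_cost \<gamma> s"
      by (rule running_cost_coercive) (use s Gamma_closure[OF optimal_in_Gamma[OF opt] s] in auto)
  qed
qed

definition energy_bound :: real where
  "energy_bound = 4 * c_mu * (T * (M + F_bound) + 2 * G_bound + T * (coercivity_const + F_bound))"

lemma optimal_energy_le:
  assumes opt: "optimal \<gamma>"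
  shows "integral {0..T} (\<lambda>s. (norm (velocity (apply_bcontfun \<gamma>) s))\<^sup>2) \<le> energy_bound"
proof -
  have "- G_bound \<le> G (\<gamma> T) (m T)"
    using G_bound[OF Gamma_in_U[OF optimal_in_Gamma[OF opt]], of T] T_pos by simp
  moreover have "integral {0..T} (curve_cost \<gamma>) + G (\<gamma> T) (m T) \<le> T * (M + F_bound) + G_bound"
    using optimal_cost_upper_bound[OF opt] optimal_cost_eq[OF opt, of 0] T_pos by simp
  ultimately have "integral {0..T} (\<lambda>s. (norm (velocity (apply_bcontfun \<gamma>) s))\<^sup>2) / (4 * c_mu) \<le>
      T * (M + F_bound) + 2 * G_bound + T * (coercivity_const + F_bound)"
    using optimal_energy_le_cost[OF opt, of 0 T] T_pos by simp
  then show ?thesis using L1_mu by (simp add: energy_bound_def field_simps)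
qed

lemma optimal_holder:
  assumes opt: "optimal \<gamma>" and ab: "0 \<le> a" "a \<le> b" "b \<le> T"
  shows "(norm (\<gamma> b - \<gamma> a))\<^sup>2 \<le> (b - a) * energy_bound"
proof -
  let ?E = "\<lambda>a b. integral {a..b} (\<lambda>s. (norm (velocity (apply_bcontfun \<gamma>) s))\<^sup>2)"
  have "(norm (\<gamma> b - \<gamma> a))\<^sup>2 \<le> (b - a) * ?E a b"
    by (rule power2_norm_integral_le[OF Gamma_velocity(2)[OF optimal_in_Gamma[OF opt] ab]
          optimal_energy_integrable[OF opt ab(1,3)] ab(2)])
  also have "\<dots> \<le> (b - a) * ?E 0 T"
    using ab optimal_energy_integrable[OF opt]
    by (intro mult_left_mono integral_subset_le) auto
  also have "\<dots> \<le> (b - a) * energy_bound"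
    using optimal_energy_le[OF opt] ab(2) by (intro mult_left_mono) auto
  finally show ?thesis .
qed

lemma optimal_equicontinuous:
  assumes "e > 0"
  shows "\<exists>d>0. \<forall>\<gamma>. optimal \<gamma> \<longrightarrow> (\<forall>a\<in>{0..T}. \<forall>b\<in>{0..T}. \<bar>b - a\<bar> < d \<longrightarrow> norm (\<gamma> b - \<gamma> a) < e)"
proof -
  define d where "d = e\<^sup>2 / (\<bar>energy_bound\<bar> + 1)"
  have "d > 0" using assms by (simp add: d_def)
  have ordered: "norm (\<gamma> b - \<gamma> a) < e" if "optimal \<gamma>" "0 \<le> a" "a \<le> b" "b \<le> T" "b - a < d" for \<gamma> a b
  proof (rule power2_less_imp_less)
    have "(norm (\<gamma> b - \<gamma> a))\<^sup>2 \<le> (b - a) * (\<bar>energy_bound\<bar> + 1)"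
      using optimal_holder[OF that(1-4)] that(3) mult_left_mono[of energy_bound "\<bar>energy_bound\<bar> + 1" "b - a"] by linarith
    also have "\<dots> < d * (\<bar>energy_bound\<bar> + 1)" using that(5) by (intro mult_strict_right_mono) auto
    also have "\<dots> = e\<^sup>2" by (simp add: d_def)
    finally show "(norm (\<gamma> b - \<gamma> a))\<^sup>2 < e\<^sup>2" .
  qed (use assms in simp)
  have "norm (\<gamma> b - \<gamma> a) < e" if "optimal \<gamma>" "a \<in> {0..T}" "b \<in> {0..T}" "\<bar>b - a\<bar> < d" for \<gamma> a b
    using ordered[of \<gamma> a b] ordered[of \<gamma> b a] that by (cases "a \<le> b") (auto simp: norm_minus_commute)
  then show ?thesis using \<open>d > 0\<close> by blast
qed

lemma equilibrium_optimal:
  assumes \<eta>: "constrained_equilibrium \<Omega> T L F G m\<^sub>0 \<eta>" and m: "\<And>s. s \<in> {0..T} \<Longrightarrow> m s = eval_flow \<eta> s"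
    and \<gamma>: "\<gamma> \<in> msupport \<eta>"
  shows "optimal \<gamma>"
proof -
  obtain x where x: "\<gamma> \<in> Gamma_at \<Omega> T 0 x"
    "\<And>\<sigma>. \<sigma> \<in> Gamma_at \<Omega> T 0 x \<Longrightarrow> cost L F G T (eval_flow \<eta>) 0 \<gamma> \<le> cost L F G T (eval_flow \<eta>) 0 \<sigma>"
    using \<eta> \<gamma> unfolding constrained_equilibrium_def optimal_curves_def by blast
  have "cost L F G T (eval_flow \<eta>) 0 \<sigma> = cost L F G T m 0 \<sigma>" for \<sigma>
    unfolding cost_def using m T_pos
    by (intro arg_cong2[where f = "(+)"] ext_integral_cong_AE AE_I2) auto
  then show ?thesis using x unfolding optimal_def by (auto simp: Gamma_at_def)
qed

end

lemma (in mfg_solution) optimal_curve_through: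
  assumes t: "t \<in> {0..T}" and x: "x \<in> msupport (m t)"
  obtains \<gamma> where "optimal \<gamma>" "apply_bcontfun \<gamma> t = x"
proof -
  obtain \<eta> where equilibrium: "constrained_equilibrium \<Omega> T L F G (m 0) \<eta>" and m: "\<And>s. s \<in> {0..T} \<Longrightarrow> m s = eval_flow \<eta> s"
    using mild unfolding mild_solution_def by blast
  then have \<eta>: "prob_space \<eta>" "sets \<eta> = sets borel" "emeasure \<eta> (Cpaths \<Omega> T) = 1"
    by (auto simp: constrained_equilibrium_def)
  have "\<exists>\<gamma>. \<gamma> \<in> msupport \<eta> \<and> dist (apply_bcontfun \<gamma> t) x < 1 / real (Suc n)" for n
    using msupport_eval_flow_approx[OF T_pos \<eta>, of x t "1 / real (Suc n)"] x m[OF t] by auto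
  then obtain f where f: "\<And>n. f n \<in> msupport \<eta>" "\<And>n. dist (apply_bcontfun (f n) t) x < 1 / real (Suc n)" by metis
  have f_opt: "optimal (f n)" for n by (rule equilibrium_optimal[OF equilibrium m f(1)])
  obtain l k where lk: "strict_mono (k :: nat \<Rightarrow> nat)" "(\<lambda>n. f (k n)) \<longlonglongrightarrow> l"
  proof (rule Cpaths_Arzela_Ascoli[OF less_imp_le[OF T_pos] _ bounded_Omega])
    show "f n \<in> Cpaths \<Omega> T" for n using optimal_in_Gamma[OF f_opt] by (simp add: Gamma_def)
    show "\<exists>d>0. \<forall>n. \<forall>a\<in>{0..T}. \<forall>b\<in>{0..T}. \<bar>b - a\<bar> < d \<longrightarrow> norm (f n b - f n a) < e" if "e > 0" for e
      using optimal_equicontinuous[OF that] f_opt by metis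
  qed (rule that)
  have "optimal l"
    using closed_sequentially[OF closed_msupport _ lk(2)] f(1) by (intro equilibrium_optimal[OF equilibrium m]) auto
  moreover have "apply_bcontfun l t = x"
  proof (rule LIMSEQ_unique)
    show "(\<lambda>n. apply_bcontfun (f (k n)) t) \<longlonglongrightarrow> apply_bcontfun l t"
      by (rule continuous_on_tendsto_compose[OF continuous_on_apply_bcontfun_at lk(2)]) auto
    have "(\<lambda>n. apply_bcontfun (f n) t) \<longlonglongrightarrow> x"
      by (rule LIMSEQ_norm_0[of "\<lambda>n. apply_bcontfun (f n) t - x", THEN LIM_zero_cancel])
        (use f(2) in \<open>simp add: dist_norm\<close>)
    from LIMSEQ_subseq_LIMSEQ[OF this lk(1)]
    show "(\<lambda>n. apply_bcontfun (f (k n)) t) \<longlonglongrightarrow> x" by (simp add: o_def)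
  qed
  ultimately show ?thesis by (rule that)
qed

section \<open>Local geometry of the boundary\<close>

lemma nonpos_if_le_small_multiples:
  fixes a b :: real
  assumes "\<And>\<epsilon>. \<epsilon> > 0 \<Longrightarrow> a \<le> \<epsilon> * b"
  shows "a \<le> 0"
proof (rule tendsto_lowerbound)
  have "((\<lambda>\<epsilon>. \<epsilon> * b) \<longlongrightarrow> 0 * b) (at_right 0)" by (intro tendsto_intros)
  then show "((\<lambda>\<epsilon>. \<epsilon> * b) \<longlongrightarrow> 0) (at_right 0)" by simp
  show "\<forall>\<^sub>F \<epsilon> in at_right 0. a \<le> \<epsilon> * b"
    using eventually_at_right_less[of 0] by eventually_elim (rule assms)
qed simp

lemma eventually_less_along_descent_direction:
  fixes f :: "'b::real_normed_vector \<Rightarrow> real"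
  assumes "(f has_derivative D) (at y)" "D w < 0"
  shows "\<forall>\<^sub>F s in at_right 0. f (y + s *\<^sub>R w) < f y"
proof -
  have "((\<lambda>s. f (y + s *\<^sub>R w)) has_real_derivative D w) (at 0)"
    using has_derivative_along_line[of f D y 0 w] assms(1)
    by (simp add: has_real_derivative_iff_has_vector_derivative)
  from DERIV_neg_dec_right[OF this assms(2)] show ?thesis
    unfolding eventually_at_right_field by auto
qed

locale boundary_chart =
  fixes \<Omega> :: "'a::euclidean_space set" and x :: 'a and r :: real and \<psi> :: "'a \<Rightarrow> real" and g :: "'a \<Rightarrow> 'a"
  assumes chart: "local_defining_fn \<Omega> x r \<psi> g" and open_Omega: "open \<Omega>" and x_frontier: "x \<in> frontier \<Omega>"
begin

lemma radius_pos: "r > 0"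
  and has_derivative_psi: "y \<in> ball x r \<Longrightarrow> (\<psi> has_derivative (\<lambda>h. g y \<bullet> h)) (at y)"
  and gradient_nonzero: "y \<in> ball x r \<Longrightarrow> g y \<noteq> 0"
  and in_Omega_iff: "y \<in> ball x r \<Longrightarrow> y \<in> \<Omega> \<longleftrightarrow> \<psi> y < 0"
  and isCont_gradient: "y \<in> ball x r \<Longrightarrow> isCont g y"
  using chart has_derivative_continuous unfolding local_defining_fn_def C2_with_grad_def by blast+

lemma center_in_ball: "x \<in> ball x r"
  using radius_pos by simp

lemma isCont_psi: "y \<in> ball x r \<Longrightarrow> isCont \<psi> y"
  using has_derivative_psi has_derivative_continuous by blast

lemma psi_mean_value:
  assumes "p \<in> ball x R" "q \<in> ball x R" "R \<le> r"
  obtains \<xi> where "\<xi> \<in> ball x R" "\<psi> q - \<psi> p = g \<xi> \<bullet> (q - p)"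
proof -
  have seg: "p + s *\<^sub>R (q - p) \<in> ball x R" if "0 \<le> s" "s \<le> 1" for s
  proof -
    have "(1 - s) *\<^sub>R p + s *\<^sub>R q \<in> ball x R"
      using assms(1,2) that by (intro convexD) auto
    then show ?thesis by (simp add: algebra_simps)
  qed
  have "((\<lambda>s. \<psi> (p + s *\<^sub>R (q - p))) has_real_derivative g (p + s *\<^sub>R (q - p)) \<bullet> (q - p)) (at s)"
    if "0 \<le> s" "s \<le> 1" for s
    unfolding has_real_derivative_iff_has_vector_derivative
    by (rule has_derivative_along_line[OF has_derivative_psi]) (use seg[OF that] subset_ball[OF assms(3)] in blast)
  from MVT2[OF zero_less_one this] obtain s where "0 < s" "s < 1" "\<psi> q - \<psi> p = g (p + s *\<^sub>R (q - p)) \<bullet> (q - p)"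
    by auto
  then show ?thesis using that[of "p + s *\<^sub>R (q - p)"] seg[of s] by simp
qed

lemma psi_nonpos_on_closure:
  assumes y: "y \<in> ball x r" "y \<in> closure \<Omega>"
  shows "\<psi> y \<le> 0"
proof -
  obtain z where z: "\<And>n. z n \<in> \<Omega>" "z \<longlonglongrightarrow> y" using y(2) closure_sequential by metis
  have "\<forall>\<^sub>F n in sequentially. z n \<in> ball x r"
    by (rule topological_tendstoD[OF z(2) open_ball y(1)])
  then have "\<forall>\<^sub>F n in sequentially. \<psi> (z n) \<le> 0"
    by eventually_elim (use in_Omega_iff z(1) less_imp_le in blast)
  moreover have "(\<lambda>n. \<psi> (z n)) \<longlonglongrightarrow> \<psi> y"
    by (rule isCont_tendsto_compose[OF isCont_psi[OF y(1)] z(2)])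
  ultimately show ?thesis by (intro tendsto_upperbound) auto
qed

lemma in_closure_if_psi_nonpos:
  assumes y: "y \<in> ball x r" and "\<psi> y \<le> 0"
  shows "y \<in> closure \<Omega>"
proof (rule Lim_in_closed_set[OF closed_closure])
  let ?z = "\<lambda>s. y + s *\<^sub>R (- g y)"
  have "(?z \<longlongrightarrow> y + 0 *\<^sub>R (- g y)) (at_right 0)" by (intro tendsto_intros)
  then show lim: "(?z \<longlongrightarrow> y) (at_right 0)" by simp
  have "\<forall>\<^sub>F s in at_right 0. \<psi> (?z s) < \<psi> y"
    using gradient_nonzero[OF y]
    by (intro eventually_less_along_descent_direction[OF has_derivative_psi[OF y]]) simp
  moreover have "\<forall>\<^sub>F s in at_right 0. ?z s \<in> ball x r"
    by (rule topological_tendstoD[OF lim open_ball y])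
  ultimately show "\<forall>\<^sub>F s in at_right 0. ?z s \<in> closure \<Omega>"
  proof eventually_elim
    case (elim s)
    then show ?case using in_Omega_iff[of "?z s"] assms(2) closure_subset[of \<Omega>] by auto
  qed
qed simp

lemma psi_center: "\<psi> x = 0"
proof (rule antisym)
  have "x \<in> closure \<Omega>" "x \<notin> \<Omega>" using x_frontier open_Omega by (auto simp: frontier_def interior_open)
  then show "\<psi> x \<le> 0" "0 \<le> \<psi> x"
    using psi_nonpos_on_closure[OF center_in_ball] in_Omega_iff[OF center_in_ball] by auto
qed

lemma inward_segment_in_closure:
  assumes "g x \<bullet> w < 0"
  shows "\<forall>\<^sub>F s in at_right 0. x + s *\<^sub>R w \<in> closure \<Omega>"
proof -
  have "((\<lambda>s. x + s *\<^sub>R w) \<longlongrightarrow> x + 0 *\<^sub>R w) (at_right 0)" by (intro tendsto_intros)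
  then have "\<forall>\<^sub>F s in at_right 0. x + s *\<^sub>R w \<in> ball x r"
    by (rule topological_tendstoD) (use center_in_ball in auto)
  moreover have "\<forall>\<^sub>F s in at_right 0. \<psi> (x + s *\<^sub>R w) < \<psi> x"
    by (rule eventually_less_along_descent_direction[OF has_derivative_psi[OF center_in_ball] assms])
  ultimately show ?thesis
    by eventually_elim (simp add: psi_center in_closure_if_psi_nonpos)
qed

lemma inner_gradient_limit_secant_nonpos:
  assumes h: "(h \<longlongrightarrow> 0) A" "\<forall>\<^sub>F k in A. h k > (0::real)" and v: "(v \<longlongrightarrow> w) A"
    and cl: "\<forall>\<^sub>F k in A. x + h k *\<^sub>R v k \<in> closure \<Omega>" and "A \<noteq> bot"
  shows "g x \<bullet> w \<le> 0"
proof -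
  have "((\<lambda>k. x + h k *\<^sub>R v k) \<longlongrightarrow> x + 0 *\<^sub>R w) A" by (intro tendsto_intros h v)
  then have lim: "((\<lambda>k. x + h k *\<^sub>R v k) \<longlongrightarrow> x) A" by simp
  have "g x \<bullet> w \<le> \<epsilon> * norm w" if "\<epsilon> > 0" for \<epsilon>
  proof (rule tendsto_le[OF \<open>A \<noteq> bot\<close>])
    show "((\<lambda>k. g x \<bullet> v k) \<longlongrightarrow> g x \<bullet> w) A" "((\<lambda>k. \<epsilon> * norm (v k)) \<longlongrightarrow> \<epsilon> * norm w) A"
      by (intro tendsto_intros v)+
    obtain d where d: "d > 0"
      "\<And>y. norm (y - x) < d \<Longrightarrow> norm (\<psi> y - \<psi> x - g x \<bullet> (y - x)) \<le> \<epsilon> * norm (y - x)"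
      using has_derivative_psi[OF center_in_ball] \<open>\<epsilon> > 0\<close> unfolding has_derivative_at_alt by blast
    have "min d r > 0" using d(1) radius_pos by simp
    from tendstoD[OF lim this] h(2) cl show "\<forall>\<^sub>F k in A. g x \<bullet> v k \<le> \<epsilon> * norm (v k)"
    proof eventually_elim
      case (elim k)
      then have "\<psi> (x + h k *\<^sub>R v k) \<le> 0"
        by (intro psi_nonpos_on_closure) (auto simp: dist_norm)
      moreover have "norm (\<psi> (x + h k *\<^sub>R v k) - h k * (g x \<bullet> v k)) \<le> h k * (\<epsilon> * norm (v k))"
        using d(2)[of "x + h k *\<^sub>R v k"] elim by (simp add: psi_center dist_norm ac_simps)
      ultimately have "h k * (g x \<bullet> v k) \<le> h k * (\<epsilon> * norm (v k))" by simp
      then show ?case using elim(2) by simp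
    qed
  qed
  then show ?thesis by (rule nonpos_if_le_small_multiples)
qed

text \<open>The mean value theorem on the two parts of the chord: their slopes differ at most by the
  oscillation of the gradient.\<close>
lemma psi_on_chord_le:
  assumes ab: "a \<in> closure \<Omega>" "b \<in> closure \<Omega>" "a \<in> ball x R" "b \<in> ball x R"
    and R: "R \<le> r" "\<And>y. y \<in> ball x R \<Longrightarrow> norm (g y - g x) \<le> \<theta>" and l: "0 \<le> l" "l \<le> 1"
  shows "\<psi> (a + l *\<^sub>R (b - a)) \<le> l * (1 - l) * (2 * \<theta> * norm (b - a))"
proof -
  define y where "y = a + l *\<^sub>R (b - a)"
  have "(1 - l) *\<^sub>R a + l *\<^sub>R b \<in> ball x R" using ab l by (intro convexD) auto
  then have y: "y \<in> ball x R" by (simp add: y_def algebra_simps)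
  obtain \<xi> where \<xi>: "\<xi> \<in> ball x R" "\<psi> y - \<psi> a = g \<xi> \<bullet> (y - a)"
    by (rule psi_mean_value[OF ab(3) y R(1)])
  obtain \<zeta> where \<zeta>: "\<zeta> \<in> ball x R" "\<psi> b - \<psi> y = g \<zeta> \<bullet> (b - y)"
    by (rule psi_mean_value[OF y ab(4) R(1)])
  have "\<psi> a \<le> 0" "\<psi> b \<le> 0"
    using ab R(1) by (auto intro!: psi_nonpos_on_closure)
  then have vertices: "(1 - l) * \<psi> a \<le> 0" "l * \<psi> b \<le> 0" using l by (auto simp: mult_nonneg_nonpos)
  have "y - a = l *\<^sub>R (b - a)" "b - y = (1 - l) *\<^sub>R (b - a)" by (simp_all add: y_def algebra_simps)
  then have "\<psi> y = \<psi> a + l * (g \<xi> \<bullet> (b - a))" "\<psi> y = \<psi> b - (1 - l) * (g \<zeta> \<bullet> (b - a))"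
    using \<xi>(2) \<zeta>(2) by auto
  then have "(1 - l) * \<psi> y + l * \<psi> y = (1 - l) * (\<psi> a + l * (g \<xi> \<bullet> (b - a))) + l * (\<psi> b - (1 - l) * (g \<zeta> \<bullet> (b - a)))"
    by metis
  then have "\<psi> y = (1 - l) * \<psi> a + l * \<psi> b + l * (1 - l) * ((g \<xi> - g \<zeta>) \<bullet> (b - a))"
    by (simp add: algebra_simps inner_diff_left)
  also have "\<dots> \<le> l * (1 - l) * ((g \<xi> - g \<zeta>) \<bullet> (b - a))" using vertices by simp
  also have "\<dots> \<le> l * (1 - l) * (2 * \<theta> * norm (b - a))"
  proof (rule mult_left_mono)
    have "norm (g \<xi> - g \<zeta>) \<le> 2 * \<theta>"
      using R(2)[OF \<xi>(1)] R(2)[OF \<zeta>(1)] norm_triangle_ineq4[of "g \<xi> - g x" "g \<zeta> - g x"] by simp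
    then show "(g \<xi> - g \<zeta>) \<bullet> (b - a) \<le> 2 * \<theta> * norm (b - a)"
      by (intro order_trans[OF norm_cauchy_schwarz] mult_right_mono) auto
  qed (use l in simp)
  finally show ?thesis by (simp add: y_def)
qed

definition normal :: 'a where "normal = g x /\<^sub>R norm (g x)"

lemma norm_normal: "norm normal = 1"
  using gradient_nonzero[OF center_in_ball] by (simp add: normal_def)

lemma inner_gradient_normal: "g x \<bullet> normal = norm (g x)"
  using gradient_nonzero[OF center_in_ball] by (simp add: normal_def power2_norm_eq_inner[symmetric] power2_eq_square)

lemma psi_inward_le:
  assumes y: "y \<in> ball x R" "y - \<beta> *\<^sub>R normal \<in> ball x R" and "\<beta> \<ge> 0"
    and R: "R \<le> r" "\<And>y. y \<in> ball x R \<Longrightarrow> norm (g y - g x) \<le> \<theta>"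
  shows "\<psi> (y - \<beta> *\<^sub>R normal) \<le> \<psi> y - \<beta> * (norm (g x) - \<theta>)"
proof -
  obtain \<xi> where \<xi>: "\<xi> \<in> ball x R" "\<psi> (y - \<beta> *\<^sub>R normal) - \<psi> y = g \<xi> \<bullet> ((y - \<beta> *\<^sub>R normal) - y)"
    by (rule psi_mean_value[OF y R(1)])
  have "\<bar>(g \<xi> - g x) \<bullet> normal\<bar> \<le> \<theta>"
    using Cauchy_Schwarz_ineq2[of "g \<xi> - g x" normal] R(2)[OF \<xi>(1)] norm_normal by simp
  then have "norm (g x) - \<theta> \<le> g \<xi> \<bullet> normal" by (simp add: inner_diff_left inner_gradient_normal)
  then have "\<beta> * (norm (g x) - \<theta>) \<le> \<beta> * (g \<xi> \<bullet> normal)" using \<open>\<beta> \<ge> 0\<close> by (rule mult_left_mono)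
  then show ?thesis using \<xi>(2) by simp
qed

lemma gradient_oscillation_le:
  assumes "\<theta> > 0"
  obtains R where "R > 0" "R \<le> r" "\<And>y. y \<in> ball x R \<Longrightarrow> norm (g y - g x) \<le> \<theta>"
proof -
  obtain d where "d > 0" "\<And>y. dist y x < d \<Longrightarrow> dist (g y) (g x) < \<theta>"
    using isCont_gradient[OF center_in_ball] assms unfolding continuous_at_eps_delta by blast
  then show ?thesis
    using radius_pos by (intro that[of "min r d"]) (auto simp: dist_commute dist_norm less_imp_le)
qed

text \<open>The gain \<open>l (1 - l) \<omega> |b - a|\<close> of the inward push has the shape of the loss in \<open>psi_on_chord_le\<close>;
  as the gradient is continuous, \<open>\<theta>\<close> can be taken small enough for the gain to win.\<close>
lemma bumped_chord_in_closure:
  assumes "\<omega> > 0"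
  obtains \<rho> where "\<rho> > 0"
    "\<And>a b l. a \<in> closure \<Omega> \<Longrightarrow> b \<in> closure \<Omega> \<Longrightarrow> a \<in> ball x \<rho> \<Longrightarrow> b \<in> ball x \<rho> \<Longrightarrow> 0 \<le> l \<Longrightarrow> l \<le> 1 \<Longrightarrow>
       a + l *\<^sub>R (b - a) - (l * (1 - l) * (\<omega> * norm (b - a))) *\<^sub>R normal \<in> closure \<Omega>"
proof -
  define \<theta> where "\<theta> = \<omega> * norm (g x) / (2 + \<omega>)"
  have \<theta>: "\<theta> > 0" "2 * \<theta> = \<omega> * (norm (g x) - \<theta>)"
    using assms gradient_nonzero[OF center_in_ball] by (simp_all add: \<theta>_def field_simps)
  obtain R where R: "R > 0" "R \<le> r" "\<And>y. y \<in> ball x R \<Longrightarrow> norm (g y - g x) \<le> \<theta>"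
    by (rule gradient_oscillation_le[OF \<theta>(1)]) (rule that)
  define \<rho> where "\<rho> = R / (1 + 2 * \<omega>)"
  have \<rho>: "\<rho> > 0" "\<rho> + \<omega> * (2 * \<rho>) = R"
  proof -
    show "\<rho> > 0" using R(1) assms by (simp add: \<rho>_def)
    have "\<rho> * (1 + 2 * \<omega>) = R" using assms by (simp add: \<rho>_def)
    then show "\<rho> + \<omega> * (2 * \<rho>) = R" by (simp add: algebra_simps)
  qed
  then have "\<rho> \<le> R" using assms by (smt (verit) mult_pos_pos)
  have "a + l *\<^sub>R (b - a) - (l * (1 - l) * (\<omega> * norm (b - a))) *\<^sub>R normal \<in> closure \<Omega>"
    if ab: "a \<in> closure \<Omega>" "b \<in> closure \<Omega>" "a \<in> ball x \<rho>" "b \<in> ball x \<rho>" and l: "0 \<le> l" "l \<le> 1" for a b l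
  proof -
    define y where "y = a + l *\<^sub>R (b - a)"
    define \<beta> where "\<beta> = l * (1 - l) * (\<omega> * norm (b - a))"
    have "(1 - l) *\<^sub>R a + l *\<^sub>R b \<in> ball x \<rho>" using ab l by (intro convexD) auto
    then have y: "y \<in> ball x \<rho>" by (simp add: y_def algebra_simps)
    have "0 \<le> \<beta>" using assms l by (simp add: \<beta>_def)
    have "norm (b - a) \<le> 2 * \<rho>"
      using dist_triangle3[of b a x] ab(3,4) by (simp add: dist_norm norm_minus_commute)
    then have "\<beta> \<le> 1 * (\<omega> * (2 * \<rho>))"
      unfolding \<beta>_def using assms l \<rho>(1) by (intro mult_mono mult_le_one) auto
    have "dist x (y - \<beta> *\<^sub>R normal) \<le> dist x y + \<beta>"
      using dist_triangle[of x "y - \<beta> *\<^sub>R normal" y] norm_normal \<open>0 \<le> \<beta>\<close> by (simp add: dist_norm)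
    then have y\<beta>: "y - \<beta> *\<^sub>R normal \<in> ball x R" using y \<open>\<beta> \<le> 1 * (\<omega> * (2 * \<rho>))\<close> \<rho>(2) by simp
    have sub: "ball x \<rho> \<subseteq> ball x R" using \<open>\<rho> \<le> R\<close> by (rule subset_ball)
    have "\<psi> (y - \<beta> *\<^sub>R normal) \<le> \<psi> y - \<beta> * (norm (g x) - \<theta>)"
      by (rule psi_inward_le[OF _ y\<beta> \<open>0 \<le> \<beta>\<close> R(2,3)]) (use y sub in auto)
    also have "\<dots> \<le> l * (1 - l) * (2 * \<theta> * norm (b - a)) - \<beta> * (norm (g x) - \<theta>)"
      unfolding y_def using psi_on_chord_le[OF ab(1,2) _ _ R(2,3) l] ab(3,4) sub by fastforce
    also have "\<dots> = 0" by (simp add: \<beta>_def \<theta>(2))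
    finally show ?thesis
      using y\<beta> R(2) unfolding y_def \<beta>_def by (intro in_closure_if_psi_nonpos) auto
  qed
  with \<rho>(1) show ?thesis by (rule that)
qed

end

section \<open>Optimal curves have no corner at the boundary\<close>

definition bumped_chord :: "real \<Rightarrow> real \<Rightarrow> 'b::real_vector \<Rightarrow> 'b \<Rightarrow> 'b \<Rightarrow> real \<Rightarrow> 'b" where
  "bumped_chord a b p q e s =
     p + ((s - a) / (b - a)) *\<^sub>R (q - p) - ((s - a) / (b - a) * (1 - (s - a) / (b - a))) *\<^sub>R e"

definition bumped_chord_velocity :: "real \<Rightarrow> real \<Rightarrow> 'b::real_vector \<Rightarrow> 'b \<Rightarrow> 'b \<Rightarrow> real \<Rightarrow> 'b" where
  "bumped_chord_velocity a b p q e s = (q - p) /\<^sub>R (b - a) - ((1 - 2 * ((s - a) / (b - a))) / (b - a)) *\<^sub>R e"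

lemma bumped_chord_endpoints:
  assumes "a < b"
  shows "bumped_chord a b p q e a = p" "bumped_chord a b p q e b = q"
  using assms by (simp_all add: bumped_chord_def)

lemma bumped_chord_has_vector_derivative:
  fixes p q e :: "'b::real_normed_vector"
  assumes "a < b"
  shows "(bumped_chord a b p q e has_vector_derivative bumped_chord_velocity a b p q e s) (at s within S)"
proof -
  define l where "l s = (s - a) / (b - a)" for s
  have l: "(l has_real_derivative 1 / (b - a)) (at s within S)"
    unfolding l_def using assms by (auto intro!: derivative_eq_intros)
  then have bump: "((\<lambda>s. l s * (1 - l s)) has_real_derivative (1 - 2 * l s) / (b - a)) (at s within S)"
    by (auto intro!: derivative_eq_intros simp: diff_divide_distrib algebra_simps)
  have "((\<lambda>s. p + l s *\<^sub>R (q - p) - (l s * (1 - l s)) *\<^sub>R e) has_vector_derivative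
      0 + (l s *\<^sub>R 0 + (1 / (b - a)) *\<^sub>R (q - p)) - ((l s * (1 - l s)) *\<^sub>R 0 + ((1 - 2 * l s) / (b - a)) *\<^sub>R e))
      (at s within S)"
    by (intro has_vector_derivative_diff has_vector_derivative_add has_vector_derivative_const
        has_vector_derivative_scaleR l bump)
  then show ?thesis
    by (simp add: bumped_chord_def[abs_def] bumped_chord_velocity_def l_def divide_inverse_commute)
qed

lemma continuous_on_bumped_chord_velocity:
  fixes p q e :: "'b::real_normed_vector"
  shows "continuous_on S (bumped_chord_velocity a b p q e)"
  unfolding bumped_chord_velocity_def[abs_def] divide_inverse by (intro continuous_intros)

lemma bumped_chord_velocity_deviation:
  fixes p q e :: "'b::real_normed_vector"
  assumes "a < b" "s \<in> {a..b}"
  shows "norm (bumped_chord_velocity a b p q e s - (q - p) /\<^sub>R (b - a)) \<le> norm e / (b - a)"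
proof -
  have "\<bar>1 - 2 * ((s - a) / (b - a))\<bar> \<le> 1" using assms by (auto simp: abs_le_iff field_simps)
  then have "\<bar>1 - 2 * ((s - a) / (b - a))\<bar> / (b - a) * norm e \<le> 1 / (b - a) * norm e"
    using assms(1) by (intro mult_right_mono divide_right_mono) auto
  then show ?thesis using assms(1) by (simp add: bumped_chord_velocity_def)
qed

lemma has_integral_bumped_chord_velocity:
  fixes p q e :: "'b::banach"
  assumes "a < b"
  shows "(bumped_chord_velocity a b p q e has_integral (q - p)) {a..b}"
  using fundamental_theorem_of_calculus[of a b, OF _ bumped_chord_has_vector_derivative[OF assms]] assms
  by (simp add: bumped_chord_endpoints)

lemma bumped_chord_velocity_power2_integrable:
  fixes p q e :: "'b::real_inner"
  shows "(\<lambda>s. (norm (bumped_chord_velocity a b p q e s))\<^sup>2) integrable_on {a..b}"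
  by (intro integrable_continuous_interval continuous_intros continuous_on_bumped_chord_velocity)

lemma bumped_chord_velocity_variance:
  fixes p q e :: "'b::euclidean_space"
  assumes "a < b"
  shows "integral {a..b} (\<lambda>s. (norm (bumped_chord_velocity a b p q e s - (q - p) /\<^sub>R (b - a)))\<^sup>2)
    \<le> (b - a) * (norm e / (b - a))\<^sup>2"
proof (rule has_integral_le[OF integrable_integral])
  show "((\<lambda>_. (norm e / (b - a))\<^sup>2) has_integral (b - a) * (norm e / (b - a))\<^sup>2) {a..b}"
    using has_integral_const_real[of "(norm e / (b - a))\<^sup>2" a b] assms by simp
  show "(norm (bumped_chord_velocity a b p q e s - (q - p) /\<^sub>R (b - a)))\<^sup>2 \<le> (norm e / (b - a))\<^sup>2"
    if "s \<in> {a..b}" for s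
    using bumped_chord_velocity_deviation[OF assms that] by (rule power_mono) simp
qed (use has_integral_norm_diff_power2[OF has_integral_bumped_chord_velocity[OF assms]
      bumped_chord_velocity_power2_integrable less_imp_le[OF assms]] in blast)

lemma bumped_chord_near:
  fixes p q e :: "'b::real_normed_vector"
  assumes "a < b" "s \<in> {a..b}" "norm (p - x) \<le> \<rho>" "norm (q - x) \<le> \<rho>" "norm e \<le> norm (q - p)"
  shows "norm (bumped_chord a b p q e s - x) \<le> 2 * \<rho>"
proof -
  define l where "l = (s - a) / (b - a)"
  have l: "0 \<le> l" "l \<le> 1" using assms(1,2) by (auto simp: l_def)
  have "l * (1 - l) \<le> 1 / 4"
    using zero_le_power2[of "l - 1 / 2"] by (simp add: power2_eq_square algebra_simps)
  moreover have "norm e \<le> 2 * \<rho>"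
    using assms(3-5) norm_triangle_ineq4[of "q - x" "p - x"] by simp
  ultimately have bump: "norm ((l * (1 - l)) *\<^sub>R e) \<le> 1 / 4 * (2 * \<rho>)"
    unfolding norm_scaleR using l by (intro mult_mono) auto
  have "(1 - l) *\<^sub>R p + l *\<^sub>R q \<in> cball x \<rho>"
    using assms(3,4) l by (intro convexD[OF convex_cball]) (auto simp: dist_norm norm_minus_commute)
  then have chord: "norm (p + l *\<^sub>R (q - p) - x) \<le> \<rho>"
    by (simp add: dist_norm norm_minus_commute algebra_simps)
  have displacement: "bumped_chord a b p q e s - x = (p + l *\<^sub>R (q - p) - x) - (l * (1 - l)) *\<^sub>R e"
    by (simp add: bumped_chord_def l_def)
  have "norm (bumped_chord a b p q e s - x) \<le> \<rho> + 1 / 4 * (2 * \<rho>)"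
    unfolding displacement by (rule order_trans[OF norm_triangle_ineq4 add_mono[OF chord bump]])
  moreover have "0 \<le> \<rho>" using norm_ge_zero assms(3) by (rule order_trans)
  ultimately show ?thesis by simp
qed

context mfg_data
begin

lemma integral_running_cost_bounds:
  assumes ab: "a \<le> b" and v: "(v has_integral I) {a..b}" "(\<lambda>s. (norm (v s))\<^sup>2) integrable_on {a..b}"
    and J: "(running_cost p v has_integral J) {a..b}"
    and x: "ball x R \<subseteq> U" "\<rho> < R" and \<kappa>: "\<kappa> = lipschitz_const * \<rho>"
    and near: "\<And>s. s \<in> {a..b} \<Longrightarrow> norm (p s - x) \<le> \<rho>"
    and F_near: "\<And>s. s \<in> {a..b} \<Longrightarrow> \<bar>F (p s) (m s) - f\<bar> \<le> \<delta>"
    and E: "E = integral {a..b} (\<lambda>s. (norm (v s - w))\<^sup>2)"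
  shows "(b - a) * (L x w + f - \<delta> - \<kappa> * (1 + 2 * (norm w)\<^sup>2)) + Lv x w \<bullet> (I - (b - a) *\<^sub>R w)
      + (1 / (2 * c_mu) - 2 * \<kappa>) * E \<le> J" (is ?lower)
    and "J \<le> (b - a) * (L x w + f + \<delta> + \<kappa> * (1 + 2 * (norm w)\<^sup>2)) + Lv x w \<bullet> (I - (b - a) *\<^sub>R w)
      + (c_mu / 2 + 2 * \<kappa>) * E" (is ?upper)
proof -
  have E: "((\<lambda>s. (norm (v s - w))\<^sup>2) has_integral E) {a..b}"
    unfolding E using has_integral_norm_diff_power2[OF v ab] by blast
  have expansion: "((\<lambda>s. C + Lv x w \<bullet> (v s - w) + k * (norm (v s - w))\<^sup>2) has_integral
      ((b - a) * C + Lv x w \<bullet> (I - (b - a) *\<^sub>R w) + k * E)) {a..b}" for C k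
  proof -
    have "((\<lambda>s. v s - w) has_integral (I - (b - a) *\<^sub>R w)) {a..b}"
      using has_integral_diff[OF v(1) has_integral_const_real[of w a b]] ab by simp
    from has_integral_linear[OF this bounded_linear_inner_right[of "Lv x w"]]
    show ?thesis
      using has_integral_const_real[of C a b] ab
      by (intro has_integral_add has_integral_mult_right[OF E]) (auto simp: o_def)
  qed
  have pointwise:
    "L x w + f - \<delta> - \<kappa> * (1 + 2 * (norm w)\<^sup>2) + Lv x w \<bullet> (v s - w) + (1 / (2 * c_mu) - 2 * \<kappa>) * (norm (v s - w))\<^sup>2
      \<le> running_cost p v s"
    "running_cost p v s \<le>
      L x w + f + \<delta> + \<kappa> * (1 + 2 * (norm w)\<^sup>2) + Lv x w \<bullet> (v s - w) + (c_mu / 2 + 2 * \<kappa>) * (norm (v s - w))\<^sup>2"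
    if s: "s \<in> {a..b}" for s
  proof -
    have "0 \<le> \<rho>" using norm_ge_zero near[OF s] by (rule order_trans)
    then have "p s \<in> ball x R" "x \<in> ball x R"
      using near[OF s] x(2) by (auto simp: dist_norm norm_minus_commute)
    note expansion = L_expansion_bounds[OF convex_ball x(1) this near[OF s] \<kappa>, where w = w and v = "v s"]
    have F_bounds: "f - \<delta> \<le> F (p s) (m s)" "F (p s) (m s) \<le> f + \<delta>" using F_near[OF s] by auto
    show "L x w + f - \<delta> - \<kappa> * (1 + 2 * (norm w)\<^sup>2) + Lv x w \<bullet> (v s - w) + (1 / (2 * c_mu) - 2 * \<kappa>) * (norm (v s - w))\<^sup>2
      \<le> running_cost p v s"
    "running_cost p v s \<le>
      L x w + f + \<delta> + \<kappa> * (1 + 2 * (norm w)\<^sup>2) + Lv x w \<bullet> (v s - w) + (c_mu / 2 + 2 * \<kappa>) * (norm (v s - w))\<^sup>2"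
      using add_mono[OF expansion(1) F_bounds(1)] add_mono[OF expansion(2) F_bounds(2)]
      by (simp_all add: running_cost_def ac_simps)
  qed
  show ?lower by (rule has_integral_le[OF expansion J pointwise(1)])
  show ?upper by (rule has_integral_le[OF J expansion pointwise(2)])
qed

lemma bumped_chord_competitor:
  assumes ab: "0 \<le> a" "a < b" "b \<le> T"
    and x: "ball x R \<subseteq> U" "2 * \<rho> < R" and \<kappa>: "\<kappa> = lipschitz_const * (2 * \<rho>)" "0 \<le> \<kappa>"
    and near: "norm (p - x) \<le> \<rho>" "norm (q - x) \<le> \<rho>"
    and F_near: "\<And>s y. s \<in> {a..b} \<Longrightarrow> y \<in> closure \<Omega> \<Longrightarrow> norm (y - x) \<le> 2 * \<rho> \<Longrightarrow> \<bar>F y (m s) - f\<bar> \<le> \<delta>"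
    and \<omega>: "\<omega> \<le> 1" and e: "norm e \<le> \<omega> * norm (q - p)"
    and inside: "\<And>s. s \<in> {a..b} \<Longrightarrow> bumped_chord a b p q e s \<in> closure \<Omega>"
    and w: "w = (q - p) /\<^sub>R (b - a)"
  obtains c where "c \<in> Gamma \<Omega> T" "apply_bcontfun c a = p" "apply_bcontfun c b = q"
    "curve_cost c absolutely_integrable_on {a..b}"
    "integral {a..b} (curve_cost c) \<le>
      (b - a) * (L x w + f + \<delta> + \<kappa> * (1 + 2 * (norm w)\<^sup>2) + (c_mu / 2 + 2 * \<kappa>) * (\<omega> * norm w)\<^sup>2)"
proof -
  let ?p = "bumped_chord a b p q e" and ?v = "bumped_chord_velocity a b p q e"
  let ?E = "integral {a..b} (\<lambda>s. (norm (?v s - w))\<^sup>2)" and ?k = "c_mu / 2 + 2 * \<kappa>"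
    and ?A = "L x w + f + \<delta> + \<kappa> * (1 + 2 * (norm w)\<^sup>2)"
  note ordered = less_imp_le[OF ab(2)]
  have chord: "q - p = (b - a) *\<^sub>R w" using ab(2) w by simp
  have "\<omega> * norm (q - p) \<le> 1 * norm (q - p)" using \<omega> by (rule mult_right_mono) simp
  then have p_near: "norm (?p s - x) \<le> 2 * \<rho>" if "s \<in> {a..b}" for s
    using bumped_chord_near[OF ab(2) that near] e by simp
  have deriv: "(?p has_vector_derivative ?v s) (at s within {a..b})" for s
    by (rule bumped_chord_has_vector_derivative[OF ab(2)])
  obtain c where c: "c \<in> Gamma \<Omega> T" "\<And>s. s \<in> {a..b} \<Longrightarrow> apply_bcontfun c s = ?p s"
    "curve_cost c absolutely_integrable_on {a..b}"
    "(running_cost ?p ?v has_integral integral {a..b} (curve_cost c)) {a..b}"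
    by (rule C1_competitor[OF ab(1) ordered ab(3) deriv continuous_on_bumped_chord_velocity inside])
      (assumption, rule that)
  have "norm e / (b - a) \<le> \<omega> * norm w"
    using e ab(2) by (simp add: chord pos_divide_le_eq mult.commute mult.left_commute)
  then have "(b - a) * (norm e / (b - a))\<^sup>2 \<le> (b - a) * (\<omega> * norm w)\<^sup>2"
    using ab(2) by (intro mult_left_mono power_mono) auto
  then have "?E \<le> (b - a) * (\<omega> * norm w)\<^sup>2"
    using bumped_chord_velocity_variance[OF ab(2), of p q e] by (simp add: w)
  then have deviation: "?k * ?E \<le> ?k * ((b - a) * (\<omega> * norm w)\<^sup>2)"
    using \<kappa>(2) L1_mu by (intro mult_left_mono) auto
  have "integral {a..b} (curve_cost c) \<le> (b - a) * ?A + Lv x w \<bullet> (q - p - (b - a) *\<^sub>R w) + ?k * ?E"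
    by (rule integral_running_cost_bounds(2)[OF ordered has_integral_bumped_chord_velocity[OF ab(2)]
          bumped_chord_velocity_power2_integrable c(4) x \<kappa>(1) p_near F_near[OF _ inside p_near] refl])
  also have "\<dots> = (b - a) * ?A + ?k * ?E" by (simp add: chord)
  also have "\<dots> \<le> (b - a) * ?A + ?k * ((b - a) * (\<omega> * norm w)\<^sup>2)" by (rule add_left_mono[OF deviation])
  also have "\<dots> = (b - a) * (?A + ?k * (\<omega> * norm w)\<^sup>2)" by (simp add: ring_distribs(1)[of "b - a" ?A] mult.left_commute)
  finally have "integral {a..b} (curve_cost c) \<le> (b - a) * (?A + ?k * (\<omega> * norm w)\<^sup>2)" .
  moreover have "apply_bcontfun c a = p" "apply_bcontfun c b = q"
    using c(2)[of a] c(2)[of b] ordered bumped_chord_endpoints[OF ab(2), of p q e] by simp_all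
  ultimately show ?thesis using that[OF c(1) _ _ c(3)] by blast
qed

lemma optimal_cost_expansion:
  assumes opt: "optimal \<gamma>" and ab: "0 \<le> a" "a < b" "b \<le> T"
    and x: "ball x R \<subseteq> U" "\<rho> < R" and \<kappa>: "\<kappa> = lipschitz_const * \<rho>"
    and near: "\<And>s. s \<in> {a..b} \<Longrightarrow> norm (\<gamma> s - x) \<le> \<rho>"
    and F_near: "\<And>s. s \<in> {a..b} \<Longrightarrow> \<bar>F (\<gamma> s) (m s) - f\<bar> \<le> \<delta>"
    and w: "w = (\<gamma> b - \<gamma> a) /\<^sub>R (b - a)"
  shows "(b - a) * (L x w + f - \<delta> - \<kappa> * (1 + 2 * (norm w)\<^sup>2))
      + (1 / (2 * c_mu) - 2 * \<kappa>) * integral {a..b} (\<lambda>s. (norm (velocity (apply_bcontfun \<gamma>) s - w))\<^sup>2)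
    \<le> integral {a..b} (curve_cost \<gamma>)"
proof -
  note ordered = less_imp_le[OF ab(2)]
  have "(curve_cost \<gamma> has_integral integral {a..b} (curve_cost \<gamma>)) {a..b}"
    using optimal_integrable[OF opt ab(1,3)] by (simp add: absolutely_integrable_on_def integrable_integral)
  from integral_running_cost_bounds(1)[OF ordered Gamma_velocity(2)[OF optimal_in_Gamma[OF opt] ab(1) ordered ab(3)]
      optimal_energy_integrable[OF opt ab(1,3)] this x \<kappa> near F_near refl, of w]
  show ?thesis using ab(2) by (simp add: w)
qed

text \<open>The optimal curve is compared with its chord, bumped by \<open>e\<close> so as to stay in the closure. Both costs
  are expanded at the chord velocity, where the linear terms cancel; strong convexity leaves the squared
  deviation of the velocity from its mean.\<close>
lemma optimal_velocity_deviation_le: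
  assumes opt: "optimal \<gamma>" and ab: "0 \<le> a" "a < b" "b \<le> T"
    and x: "ball x R \<subseteq> U" "2 * \<rho> < R" and \<kappa>: "\<kappa> = lipschitz_const * (2 * \<rho>)" "0 \<le> \<kappa>"
    and near: "\<And>s. s \<in> {a..b} \<Longrightarrow> norm (\<gamma> s - x) \<le> 2 * \<rho>"
    and ends: "norm (\<gamma> a - x) \<le> \<rho>" "norm (\<gamma> b - x) \<le> \<rho>"
    and F_near: "\<And>s y. s \<in> {a..b} \<Longrightarrow> y \<in> closure \<Omega> \<Longrightarrow> norm (y - x) \<le> 2 * \<rho> \<Longrightarrow> \<bar>F y (m s) - f\<bar> \<le> \<delta>"
    and \<omega>: "\<omega> \<le> 1" and e: "norm e \<le> \<omega> * norm (\<gamma> b - \<gamma> a)"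
    and inside: "\<And>s. s \<in> {a..b} \<Longrightarrow> bumped_chord a b (\<gamma> a) (\<gamma> b) e s \<in> closure \<Omega>"
    and w: "w = (\<gamma> b - \<gamma> a) /\<^sub>R (b - a)"
  shows "(1 / (2 * c_mu) - 2 * \<kappa>) * integral {a..b} (\<lambda>s. (norm (velocity (apply_bcontfun \<gamma>) s - w))\<^sup>2)
    \<le> (b - a) * (2 * \<delta> + 2 * \<kappa> * (1 + 2 * (norm w)\<^sup>2) + (c_mu / 2 + 2 * \<kappa>) * (\<omega> * norm w)\<^sup>2)"
proof -
  have in_closure: "\<gamma> s \<in> closure \<Omega>" if "s \<in> {a..b}" for s
    using Gamma_closure[OF optimal_in_Gamma[OF opt], of s] ab that by auto
  obtain c where c: "c \<in> Gamma \<Omega> T" "apply_bcontfun c a = \<gamma> a" "apply_bcontfun c b = \<gamma> b"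
    "curve_cost c absolutely_integrable_on {a..b}"
    "integral {a..b} (curve_cost c) \<le>
      (b - a) * (L x w + f + \<delta> + \<kappa> * (1 + 2 * (norm w)\<^sup>2) + (c_mu / 2 + 2 * \<kappa>) * (\<omega> * norm w)\<^sup>2)"
    by (rule bumped_chord_competitor[OF ab x \<kappa> ends F_near \<omega> e inside w])
  have "(b - a) * (L x w + f - \<delta> - \<kappa> * (1 + 2 * (norm w)\<^sup>2))
      + (1 / (2 * c_mu) - 2 * \<kappa>) * integral {a..b} (\<lambda>s. (norm (velocity (apply_bcontfun \<gamma>) s - w))\<^sup>2)
    \<le> integral {a..b} (curve_cost \<gamma>)"
    by (rule optimal_cost_expansion[OF opt ab x \<kappa>(1) near F_near[OF _ in_closure near] w])
  also have "\<dots> \<le> integral {a..b} (curve_cost c)"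
    by (rule optimal_on_interval[OF opt ab(1) less_imp_le[OF ab(2)] ab(3) c(1-4)])
  also note c(5)
  finally show ?thesis by (simp add: algebra_simps)
qed

end

locale mfg_contact = mfg_solution U M c_mu L Lx Lv Lvx Lvv \<Omega> T kappa F G m u + boundary_chart \<Omega> x r \<psi> g
  for U :: "'a::euclidean_space set"
    and M c_mu :: real
    and L :: "'a \<Rightarrow> 'a \<Rightarrow> real"
    and Lx Lv :: "'a \<Rightarrow> 'a \<Rightarrow> 'a"
    and Lvx Lvv :: "'a \<Rightarrow> 'a \<Rightarrow> 'a \<Rightarrow> 'a"
    and \<Omega> :: "'a set"
    and T kappa :: real
    and F G :: "'a \<Rightarrow> 'a measure \<Rightarrow> real"
    and m :: "real \<Rightarrow> 'a measure"
    and u :: "real \<Rightarrow> 'a \<Rightarrow> real"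
    and x :: 'a and r :: real and \<psi> :: "'a \<Rightarrow> real" and g :: "'a \<Rightarrow> 'a" +
  fixes \<gamma> :: "real \<Rightarrow>\<^sub>C 'a" and t :: real
  assumes opt: "optimal \<gamma>" and t: "0 < t" "t < T" and contact: "apply_bcontfun \<gamma> t = x"
begin

lemma contact_in_closure: "x \<in> closure \<Omega>"
  using Gamma_closure[OF optimal_in_Gamma[OF opt], of t] t contact by simp

lemma contact_in_U: "x \<in> U"
  using contact_in_closure closure_subset_U by blast

lemma optimal_in_closure: "0 \<le> s \<Longrightarrow> s \<le> T \<Longrightarrow> \<gamma> s \<in> closure \<Omega>"
  using Gamma_closure[OF optimal_in_Gamma[OF opt]] by simp

lemma eventually_window: "\<forall>\<^sub>F h in at_right 0. 0 < h \<and> h < t \<and> t + h < T"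
  using t unfolding eventually_at_right_field by (intro exI[of _ "min t (T - t)"]) auto

lemma eventually_near_contact:
  assumes "\<delta> > 0"
  shows "\<forall>\<^sub>F h in at_right 0. \<forall>s\<in>{t - h..t + h}. norm (\<gamma> s - x) \<le> \<delta>"
proof -
  have "isCont (apply_bcontfun \<gamma>) t"
    using continuous_on_eq_continuous_at[OF open_UNIV] continuous_on_apply_bcontfun by blast
  then obtain d where "d > 0" "\<And>s. dist s t < d \<Longrightarrow> dist (\<gamma> s) x < \<delta>"
    using assms contact unfolding continuous_at_eps_delta by metis
  then show ?thesis
    unfolding eventually_at_right_field
    by (intro exI[of _ d]) (force simp: dist_norm dist_real_def intro: less_imp_le)
qed

lemma F_near_contact:
  assumes "\<delta> > 0"
  obtains d where "d > 0" "\<And>s y. s \<in> {0..T} \<Longrightarrow> y \<in> closure \<Omega> \<Longrightarrow> \<bar>s - t\<bar> \<le> d \<Longrightarrow> norm (y - x) \<le> d \<Longrightarrow>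
    \<bar>F y (m s) - F x (m t)\<bar> \<le> \<delta>"
proof -
  have "(t, x) \<in> {0..T} \<times> U" using t contact_in_U by simp
  then obtain d where d: "d > 0" "\<And>s y. s \<in> {0..T} \<Longrightarrow> y \<in> U \<Longrightarrow> dist (s, y) (t, x) < d \<Longrightarrow>
      dist (F y (m s)) (F x (m t)) < \<delta>"
    using continuous_on_F assms unfolding continuous_on_iff by fastforce
  have "\<bar>F y (m s) - F x (m t)\<bar> \<le> \<delta>"
    if sy: "s \<in> {0..T}" "y \<in> closure \<Omega>" "\<bar>s - t\<bar> \<le> d / 3" "norm (y - x) \<le> d / 3" for s y
  proof -
    have "dist (s, y) (t, x) \<le> dist s t + dist y x"
      unfolding dist_Pair_Pair by (rule sqrt_sum_squares_le_sum) auto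
    also have "\<dots> < d" using sy(3,4) d(1) by (simp add: dist_norm)
    finally show ?thesis
      using d(2)[of s y] sy(1,2) closure_subset_U by (auto simp: dist_real_def)
  qed
  then show ?thesis using d(1) by (intro that[of "d / 3"]) auto
qed

definition past_velocity :: "real \<Rightarrow> 'a" where
  "past_velocity h = (x - \<gamma> (t - h)) /\<^sub>R h"

definition chord_velocity :: "real \<Rightarrow> 'a" where
  "chord_velocity h = (\<gamma> (t + h) - \<gamma> (t - h)) /\<^sub>R (2 * h)"

definition velocity_deviation :: "real \<Rightarrow> real" where
  "velocity_deviation h = integral {t - h..t + h} (\<lambda>s. (norm (velocity (apply_bcontfun \<gamma>) s - chord_velocity h))\<^sup>2)"

lemma bump_scale:
  assumes "\<delta> > 0"
  obtains R \<rho> where "ball x R \<subseteq> U" "0 < \<rho>" "2 * \<rho> < R" "lipschitz_const * (2 * \<rho>) \<le> \<delta>"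
    "\<And>s y. s \<in> {0..T} \<Longrightarrow> y \<in> closure \<Omega> \<Longrightarrow> \<bar>s - t\<bar> \<le> \<rho> \<Longrightarrow> norm (y - x) \<le> 2 * \<rho> \<Longrightarrow> \<bar>F y (m s) - F x (m t)\<bar> \<le> \<delta>"
    "\<And>a b s p q. a < b \<Longrightarrow> s \<in> {a..b} \<Longrightarrow> p \<in> closure \<Omega> \<Longrightarrow> q \<in> closure \<Omega> \<Longrightarrow>
       norm (p - x) \<le> \<rho> \<Longrightarrow> norm (q - x) \<le> \<rho> \<Longrightarrow> bumped_chord a b p q ((\<delta> * norm (q - p)) *\<^sub>R normal) s \<in> closure \<Omega>"
proof -
  obtain R where R: "R > 0" "ball x R \<subseteq> U" using open_U contact_in_U openE by blast
  obtain \<rho>\<^sub>1 where \<rho>\<^sub>1: "\<rho>\<^sub>1 > 0"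
    "\<And>p q l. p \<in> closure \<Omega> \<Longrightarrow> q \<in> closure \<Omega> \<Longrightarrow> p \<in> ball x \<rho>\<^sub>1 \<Longrightarrow> q \<in> ball x \<rho>\<^sub>1 \<Longrightarrow> 0 \<le> l \<Longrightarrow> l \<le> 1 \<Longrightarrow>
       p + l *\<^sub>R (q - p) - (l * (1 - l) * (\<delta> * norm (q - p))) *\<^sub>R normal \<in> closure \<Omega>"
    by (rule bumped_chord_in_closure[OF assms]) (rule that)
  obtain d where d: "d > 0" "\<And>s y. s \<in> {0..T} \<Longrightarrow> y \<in> closure \<Omega> \<Longrightarrow> \<bar>s - t\<bar> \<le> d \<Longrightarrow> norm (y - x) \<le> d \<Longrightarrow>
      \<bar>F y (m s) - F x (m t)\<bar> \<le> \<delta>"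
    by (rule F_near_contact[OF assms]) (rule that)
  have K: "lipschitz_const > 0" by (rule lipschitz_const_pos[OF contact_in_U])
  define \<rho> where "\<rho> = Min {R / 3, \<rho>\<^sub>1 / 2, d / 2, \<delta> / (2 * lipschitz_const)}"
  have "\<rho> > 0" unfolding \<rho>_def using R(1) \<rho>\<^sub>1(1) d(1) assms K by simp
  have "\<rho> \<le> R / 3" "\<rho> \<le> \<rho>\<^sub>1 / 2" "\<rho> \<le> d / 2" "\<rho> \<le> \<delta> / (2 * lipschitz_const)"
    unfolding \<rho>_def by (rule Min_le; simp)+
  then have \<rho>: "2 * \<rho> < R" "\<rho> < \<rho>\<^sub>1" "2 * \<rho> \<le> d" "lipschitz_const * (2 * \<rho>) \<le> \<delta>"
    using R(1) \<rho>\<^sub>1(1) K by (simp_all add: field_simps)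
  show ?thesis
  proof (rule that[OF R(2) \<open>\<rho> > 0\<close> \<rho>(1,4)])
    show "\<bar>F y (m s) - F x (m t)\<bar> \<le> \<delta>"
      if "s \<in> {0..T}" "y \<in> closure \<Omega>" "\<bar>s - t\<bar> \<le> \<rho>" "norm (y - x) \<le> 2 * \<rho>" for s y
      using that \<rho>(3) \<open>\<rho> > 0\<close> by (intro d(2)) auto
    show "bumped_chord a b p q ((\<delta> * norm (q - p)) *\<^sub>R normal) s \<in> closure \<Omega>"
      if "a < b" "s \<in> {a..b}" and pq: "p \<in> closure \<Omega>" "q \<in> closure \<Omega>" "norm (p - x) \<le> \<rho>" "norm (q - x) \<le> \<rho>" for a b s p q
      using \<rho>\<^sub>1(2)[OF pq(1,2), of "(s - a) / (b - a)"] that \<rho>(2)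
      by (simp add: bumped_chord_def dist_norm norm_minus_commute)
  qed
qed

lemma velocity_deviation_integrable:
  assumes "0 \<le> a" "a \<le> b" "b \<le> T"
  shows "(\<lambda>s. (norm (velocity (apply_bcontfun \<gamma>) s - w))\<^sup>2) integrable_on {a..b}"
  using has_integral_norm_diff_power2[OF Gamma_velocity(2)[OF optimal_in_Gamma[OF opt] assms]
      optimal_energy_integrable[OF opt assms(1,3)] assms(2)] by blast

lemma velocity_deviation_nonneg:
  "0 < h \<Longrightarrow> h < t \<Longrightarrow> t + h < T \<Longrightarrow> 0 \<le> velocity_deviation h"
  unfolding velocity_deviation_def by (intro integral_nonneg velocity_deviation_integrable) auto

lemma chord_deviation_error_le:
  assumes \<delta>: "0 < \<delta>" "\<delta> \<le> 1" and \<kappa>: "0 \<le> \<kappa>" "\<kappa> \<le> \<delta>" and "0 \<le> h" "0 \<le> n"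
  shows "2 * h * (2 * \<delta> + 2 * \<kappa> * (1 + 2 * n\<^sup>2) + (c_mu / 2 + 2 * \<kappa>) * (\<delta> * n)\<^sup>2)
    \<le> \<delta> * (12 + c_mu) * (h * (1 + n\<^sup>2))"
proof -
  have "\<delta>\<^sup>2 \<le> \<delta>" using \<delta> by (simp add: power2_eq_square mult_left_le)
  then have "(\<delta> * n)\<^sup>2 \<le> \<delta> * n\<^sup>2" by (simp add: power_mult_distrib mult_right_mono)
  then have "2 * h * (2 * \<delta> + 2 * \<kappa> * (1 + 2 * n\<^sup>2) + (c_mu / 2 + 2 * \<kappa>) * (\<delta> * n)\<^sup>2)
      \<le> 2 * h * (2 * \<delta> + 2 * \<delta> * (1 + 2 * n\<^sup>2) + (c_mu / 2 + 2 * 1) * (\<delta> * n\<^sup>2))"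
    using assms L1_mu by (intro mult_left_mono add_mono mult_mono) auto
  also have "\<dots> = \<delta> * (12 + c_mu) * (h * (1 + n\<^sup>2)) - h * \<delta> * (4 + c_mu)" by (simp add: algebra_simps)
  also have "\<dots> \<le> \<delta> * (12 + c_mu) * (h * (1 + n\<^sup>2))" using \<delta> \<open>0 \<le> h\<close> L1_mu by simp
  finally show ?thesis .
qed

lemma eventually_velocity_deviation_bound:
  assumes \<delta>: "0 < \<delta>" "\<delta> \<le> 1"
  shows "\<forall>\<^sub>F h in at_right 0. (1 / (2 * c_mu) - 2 * \<delta>) * velocity_deviation h
    \<le> \<delta> * (12 + c_mu) * (h * (1 + (norm (chord_velocity h))\<^sup>2))"
proof -
  obtain R \<rho> where R: "ball x R \<subseteq> U" and \<rho>: "0 < \<rho>" "2 * \<rho> < R" "lipschitz_const * (2 * \<rho>) \<le> \<delta>"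
    and F_near: "\<And>s y. s \<in> {0..T} \<Longrightarrow> y \<in> closure \<Omega> \<Longrightarrow> \<bar>s - t\<bar> \<le> \<rho> \<Longrightarrow> norm (y - x) \<le> 2 * \<rho> \<Longrightarrow>
      \<bar>F y (m s) - F x (m t)\<bar> \<le> \<delta>"
    and inside: "\<And>a b s p q. a < b \<Longrightarrow> s \<in> {a..b} \<Longrightarrow> p \<in> closure \<Omega> \<Longrightarrow> q \<in> closure \<Omega> \<Longrightarrow>
       norm (p - x) \<le> \<rho> \<Longrightarrow> norm (q - x) \<le> \<rho> \<Longrightarrow> bumped_chord a b p q ((\<delta> * norm (q - p)) *\<^sub>R normal) s \<in> closure \<Omega>"
    by (rule bump_scale[OF \<delta>(1)]) (rule that)
  define \<kappa> where "\<kappa> = lipschitz_const * (2 * \<rho>)"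
  have \<kappa>: "0 \<le> \<kappa>" "\<kappa> \<le> \<delta>" using lipschitz_const_pos[OF contact_in_U] \<rho> by (auto simp: \<kappa>_def)
  have "\<forall>\<^sub>F h in at_right 0. h < \<rho>" using \<rho>(1) by (rule eventually_at_rightI[rotated]) auto
  with eventually_window eventually_near_contact[OF \<rho>(1)]
  show ?thesis
  proof eventually_elim
    case (elim h)
    let ?a = "t - h" and ?b = "t + h" and ?w = "chord_velocity h" and ?D = "velocity_deviation h"
    have ab: "0 \<le> ?a" "?a < ?b" "?b \<le> T" using elim by auto
    have near: "norm (\<gamma> s - x) \<le> \<rho>" if "s \<in> {?a..?b}" for s using elim(2) that by blast
    have "(1 / (2 * c_mu) - 2 * \<kappa>) * ?D
        \<le> (?b - ?a) * (2 * \<delta> + 2 * \<kappa> * (1 + 2 * (norm ?w)\<^sup>2) + (c_mu / 2 + 2 * \<kappa>) * (\<delta> * norm ?w)\<^sup>2)"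
      unfolding velocity_deviation_def
    proof (rule optimal_velocity_deviation_le[OF opt ab R \<rho>(2) \<kappa>_def \<kappa>(1) _ _ _ _ \<delta>(2)])
      show "norm ((\<delta> * norm (\<gamma> ?b - \<gamma> ?a)) *\<^sub>R normal) \<le> \<delta> * norm (\<gamma> ?b - \<gamma> ?a)"
        using \<delta>(1) norm_normal by simp
      show "norm (\<gamma> s - x) \<le> 2 * \<rho>" if "s \<in> {?a..?b}" for s using near[OF that] \<rho>(1) by simp
      show "\<bar>F y (m s) - F x (m t)\<bar> \<le> \<delta>"
        if "s \<in> {?a..?b}" "y \<in> closure \<Omega>" "norm (y - x) \<le> 2 * \<rho>" for s y
        using that elim by (intro F_near) auto
      show "bumped_chord ?a ?b (\<gamma> ?a) (\<gamma> ?b) ((\<delta> * norm (\<gamma> ?b - \<gamma> ?a)) *\<^sub>R normal) s \<in> closure \<Omega>"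
        if "s \<in> {?a..?b}" for s
        using that ab near by (intro inside optimal_in_closure) auto
    qed (use near ab in \<open>auto simp: chord_velocity_def\<close>)
    also have "\<dots> \<le> \<delta> * (12 + c_mu) * (h * (1 + (norm ?w)\<^sup>2))"
      using chord_deviation_error_le[OF \<delta> \<kappa>, of h "norm ?w"] elim(1) by simp
    finally have "(1 / (2 * c_mu) - 2 * \<kappa>) * ?D \<le> \<delta> * (12 + c_mu) * (h * (1 + (norm ?w)\<^sup>2))" .
    moreover have "(1 / (2 * c_mu) - 2 * \<delta>) * ?D \<le> (1 / (2 * c_mu) - 2 * \<kappa>) * ?D"
      using \<kappa>(2) velocity_deviation_nonneg elim(1) by (intro mult_right_mono) auto
    ultimately show ?case by linarith
  qed
qed

lemma eventually_velocity_deviation_small: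
  assumes "\<epsilon> > 0"
  shows "\<forall>\<^sub>F h in at_right 0. velocity_deviation h \<le> \<epsilon> * (h * (1 + (norm (chord_velocity h))\<^sup>2))"
proof -
  define \<delta> where "\<delta> = Min {1, 1 / (8 * c_mu), \<epsilon> / (4 * c_mu * (12 + c_mu))}"
  have \<delta>_pos: "\<delta> > 0" unfolding \<delta>_def using assms L1_mu by simp
  have \<delta>_le: "\<delta> \<le> 1" "\<delta> \<le> 1 / (8 * c_mu)" "\<delta> \<le> \<epsilon> / (4 * c_mu * (12 + c_mu))"
    unfolding \<delta>_def by (rule Min_le; simp)+
  have \<epsilon>: "4 * c_mu * (\<delta> * (12 + c_mu)) \<le> \<epsilon>"
    using \<delta>_le(3) L1_mu by (simp add: pos_le_divide_eq mult.commute mult.left_commute)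
  have coefficient: "1 / (4 * c_mu) \<le> 1 / (2 * c_mu) - 2 * \<delta>"
    using \<delta>_le(2) L1_mu by (simp add: field_simps)
  from eventually_velocity_deviation_bound[OF \<delta>_pos \<delta>_le(1)] eventually_window show ?thesis
  proof eventually_elim
    case (elim h)
    let ?Q = "h * (1 + (norm (chord_velocity h))\<^sup>2)"
    have "1 / (4 * c_mu) * velocity_deviation h \<le> (1 / (2 * c_mu) - 2 * \<delta>) * velocity_deviation h"
      using coefficient velocity_deviation_nonneg elim(2) by (intro mult_right_mono) auto
    also note elim(1)
    finally have "velocity_deviation h \<le> 4 * c_mu * (\<delta> * (12 + c_mu)) * ?Q"
      using L1_mu by (simp add: field_simps)
    also have "\<dots> \<le> \<epsilon> * ?Q" using \<epsilon> elim(2) by (intro mult_right_mono) auto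
    finally show ?case .
  qed
qed

lemma past_chord_velocity_deviation:
  assumes h: "0 < h" "h < t" "t + h < T"
  shows "h * (norm (past_velocity h - chord_velocity h))\<^sup>2 \<le> velocity_deviation h"
proof -
  let ?w = "chord_velocity h" and ?v = "velocity (apply_bcontfun \<gamma>)"
  let ?D = "integral {t - h..t} (\<lambda>s. (norm (?v s - ?w))\<^sup>2)"
  have v: "(?v has_integral (\<gamma> t - \<gamma> (t - h))) {t - h..t}"
    using h t by (intro Gamma_velocity(2)[OF optimal_in_Gamma[OF opt]]) auto
  have "((\<lambda>s. ?v s - ?w) has_integral (\<gamma> t - \<gamma> (t - h) - h *\<^sub>R ?w)) {t - h..t}"
    using has_integral_diff[OF v has_integral_const_real[of ?w "t - h" t]] h by simp
  moreover have "\<gamma> t - \<gamma> (t - h) - h *\<^sub>R ?w = h *\<^sub>R (past_velocity h - ?w)"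
    using h(1) contact by (simp add: past_velocity_def scaleR_diff_right)
  ultimately have "(norm (h *\<^sub>R (past_velocity h - ?w)))\<^sup>2 \<le> (t - (t - h)) * ?D"
    using h t by (intro power2_norm_integral_le velocity_deviation_integrable) auto
  then have "h * (h * (norm (past_velocity h - ?w))\<^sup>2) \<le> h * ?D"
    using h(1) by (simp add: power_mult_distrib power2_eq_square ac_simps)
  then have "h * (norm (past_velocity h - ?w))\<^sup>2 \<le> ?D" using h(1) by simp
  also have "\<dots> \<le> velocity_deviation h"
    unfolding velocity_deviation_def using h t
    by (intro integral_subset_le velocity_deviation_integrable) auto
  finally show ?thesis .
qed

lemma past_minus_chord_velocity_tendsto_0:
  assumes bounded: "\<forall>\<^sub>F h in at_right 0. norm (past_velocity h) \<le> B"
  shows "((\<lambda>h. past_velocity h - chord_velocity h) \<longlongrightarrow> 0) (at_right 0)"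
proof (rule tendstoI)
  fix e :: real assume "e > 0"
  define C where "C = 1 + 2 * B\<^sup>2"
  have "C > 0" unfolding C_def by (simp add: add_pos_nonneg)
  define \<epsilon> where "\<epsilon> = min (1 / 4) (e\<^sup>2 / (4 * C))"
  have \<epsilon>: "\<epsilon> > 0" "2 * \<epsilon> \<le> 1 / 2" "2 * (\<epsilon> * C) < e\<^sup>2"
  proof -
    have "\<epsilon> \<le> e\<^sup>2 / (4 * C)" by (simp add: \<epsilon>_def)
    then have "4 * (\<epsilon> * C) \<le> e\<^sup>2" using \<open>C > 0\<close> by (simp add: pos_le_divide_eq ac_simps)
    moreover have "0 < e\<^sup>2" using \<open>e > 0\<close> by simp
    ultimately show "2 * (\<epsilon> * C) < e\<^sup>2" by linarith
  qed (use \<open>e > 0\<close> \<open>C > 0\<close> in \<open>auto simp: \<epsilon>_def\<close>)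
  from bounded eventually_window eventually_velocity_deviation_small[OF \<epsilon>(1)]
  show "\<forall>\<^sub>F h in at_right 0. dist (past_velocity h - chord_velocity h) 0 < e"
  proof eventually_elim
    case (elim h)
    let ?d = "past_velocity h - chord_velocity h"
    have "(norm (chord_velocity h))\<^sup>2 \<le> 2 * (norm (past_velocity h))\<^sup>2 + 2 * (norm (- ?d))\<^sup>2"
      using power2_norm_add_le[of "past_velocity h" "- ?d"] by simp
    also have "\<dots> \<le> 2 * B\<^sup>2 + 2 * (norm ?d)\<^sup>2" using elim(1) by (simp add: power_mono norm_minus_commute)
    finally have chord: "1 + (norm (chord_velocity h))\<^sup>2 \<le> C + 2 * (norm ?d)\<^sup>2" by (simp add: C_def)
    have "h * (norm ?d)\<^sup>2 \<le> velocity_deviation h"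
      using past_chord_velocity_deviation elim(2) by blast
    also have "\<dots> \<le> h * (\<epsilon> * (1 + (norm (chord_velocity h))\<^sup>2))"
      using elim(3) by (simp only: mult.left_commute)
    finally have "(norm ?d)\<^sup>2 \<le> \<epsilon> * (1 + (norm (chord_velocity h))\<^sup>2)" using elim(2) by simp
    also have "\<dots> \<le> \<epsilon> * (C + 2 * (norm ?d)\<^sup>2)" using chord \<epsilon>(1) by (intro mult_left_mono) auto
    also have "\<dots> \<le> \<epsilon> * C + 1 / 2 * (norm ?d)\<^sup>2"
      using mult_right_mono[OF \<epsilon>(2), of "(norm ?d)\<^sup>2"] by (simp add: algebra_simps)
    finally have "(norm ?d)\<^sup>2 < e\<^sup>2" using \<epsilon>(3) by simp
    then show ?case using \<open>e > 0\<close> by (simp add: power2_less_imp_less)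
  qed
qed

end

section \<open>The equation on the tangent hyperplane\<close>

lemma superdiff_eventually:
  assumes p: "(p\<^sub>1, p\<^sub>2) \<in> superdiff \<Omega> T u t x" and "\<epsilon> > 0"
    and lim: "(s \<longlongrightarrow> t) A" "(y \<longlongrightarrow> x) A"
    and dom: "\<forall>\<^sub>F k in A. s k \<in> {0<..<T} \<and> y k \<in> closure \<Omega>"
  shows "\<forall>\<^sub>F k in A. u (s k) (y k) - u t x \<le> p\<^sub>1 * (s k - t) + p\<^sub>2 \<bullet> (y k - x) + \<epsilon> * (\<bar>s k - t\<bar> + norm (y k - x))"
proof -
  obtain \<delta> where \<delta>: "\<delta> > 0" "\<And>s y. s \<in> {0<..<T} \<Longrightarrow> y \<in> closure \<Omega> \<Longrightarrow> \<bar>s - t\<bar> + norm (y - x) < \<delta> \<Longrightarrow>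
      u s y - u t x - p\<^sub>1 * (s - t) - p\<^sub>2 \<bullet> (y - x) \<le> \<epsilon> * (\<bar>s - t\<bar> + norm (y - x))"
    using p \<open>\<epsilon> > 0\<close> unfolding superdiff_def by auto
  from tendstoD[OF lim(1) half_gt_zero[OF \<delta>(1)]] tendstoD[OF lim(2) half_gt_zero[OF \<delta>(1)]] dom
  show ?thesis
  proof eventually_elim
    case (elim k)
    then show ?case using \<delta>(2)[of "s k" "y k"] by (simp add: dist_norm)
  qed
qed

lemma average_tendsto_at_right:
  fixes f :: "real \<Rightarrow> real"
  assumes "continuous_on {t..b} f" "t < b"
  shows "((\<lambda>h. integral {t..t + h} f / h) \<longlongrightarrow> f t) (at_right 0)"
proof -
  have "((\<lambda>s. integral {t..s} f) has_real_derivative f t) (at t within {t..b})"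
    by (rule integral_has_real_derivative) (use assms in auto)
  then have "((\<lambda>s. integral {t..s} f / (s - t)) \<longlongrightarrow> f t) (at_right t)"
    using assms(2) by (simp add: has_field_derivative_iff at_within_Icc_at_right)
  then show ?thesis by (simp add: filterlim_at_right_to_0[of _ _ t] add.commute)
qed

lemma bounded_at_right_cluster_point:
  fixes f :: "real \<Rightarrow> 'b::euclidean_space"
  assumes "\<forall>\<^sub>F h in at_right 0. norm (f h) \<le> B"
  obtains h w where "filterlim h (at_right 0) sequentially" "(\<lambda>n. f (h n)) \<longlonglongrightarrow> w"
proof -
  obtain d where d: "d > 0" "\<And>h. 0 < h \<Longrightarrow> h < d \<Longrightarrow> norm (f h) \<le> B"
    using assms unfolding eventually_at_right_field by auto
  define H where "H n = d / real (n + 2)" for n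
  have H: "0 < H n" "H n < d" for n using d(1) by (auto simp: H_def divide_less_eq)
  have "bounded (range (\<lambda>n. f (H n)))" using d(2) H unfolding bounded_iff by blast
  then obtain w k where k: "strict_mono (k :: nat \<Rightarrow> nat)" "((\<lambda>n. f (H n)) \<circ> k) \<longlonglongrightarrow> w"
    using bounded_imp_convergent_subsequence by blast
  have "H \<longlonglongrightarrow> 0"
    unfolding H_def using LIMSEQ_ignore_initial_segment[OF lim_const_over_n[of d], of 2] by simp
  then have "(H \<circ> k) \<longlonglongrightarrow> 0" by (rule LIMSEQ_subseq_LIMSEQ[OF _ k(1)])
  then have "filterlim (H \<circ> k) (at_right 0) sequentially"
    using H(1) by (auto simp: filterlim_at less_imp_neq[symmetric])
  with k(2) show ?thesis by (intro that) (auto simp: o_def)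
qed

context mfg_contact
begin

definition equation_defect :: "real \<Rightarrow> 'a \<Rightarrow> 'a \<Rightarrow> real" where
  "equation_defect p\<^sub>1 p\<^sub>2 v = L x v + F x (m t) + p\<^sub>1 + p\<^sub>2 \<bullet> v"

lemma equation_defect_tendsto:
  assumes "(v \<longlongrightarrow> w) A"
  shows "((\<lambda>k. equation_defect p\<^sub>1 p\<^sub>2 (v k)) \<longlongrightarrow> equation_defect p\<^sub>1 p\<^sub>2 w) A"
  unfolding equation_defect_def
  by (intro tendsto_intros assms
      isCont_tendsto_compose[OF has_derivative_continuous[OF has_derivative_L(2)[OF contact_in_U]] assms])

lemma past_cost_superdiff:
  assumes p: "(p\<^sub>1, p\<^sub>2) \<in> superdiff \<Omega> T u t x" and "\<epsilon> > 0"
  shows "\<forall>\<^sub>F h in at_right 0. integral {t - h..t} (curve_cost \<gamma>) \<le>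
    h * (- p\<^sub>1 - p\<^sub>2 \<bullet> past_velocity h + \<epsilon> * (1 + norm (past_velocity h)))"
proof -
  have "((\<lambda>h. t - h) \<longlongrightarrow> t - 0) (at_right 0)" by (intro tendsto_intros)
  then have s_lim: "((\<lambda>h. t - h) \<longlongrightarrow> t) (at_right 0)" by simp
  have "isCont (apply_bcontfun \<gamma>) t"
    using continuous_on_eq_continuous_at[OF open_UNIV] continuous_on_apply_bcontfun by blast
  from isCont_tendsto_compose[OF this s_lim]
  have y_lim: "((\<lambda>h. \<gamma> (t - h)) \<longlongrightarrow> x) (at_right 0)" by (simp add: contact)
  have "\<forall>\<^sub>F h in at_right 0. t - h \<in> {0<..<T} \<and> \<gamma> (t - h) \<in> closure \<Omega>"
    using eventually_window by eventually_elim (use t in \<open>auto intro: optimal_in_closure\<close>)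
  from superdiff_eventually[OF p \<open>\<epsilon> > 0\<close> s_lim y_lim this] eventually_window
  show ?thesis
  proof eventually_elim
    case (elim h)
    have step: "\<gamma> (t - h) - x = - (h *\<^sub>R past_velocity h)" using elim by (simp add: past_velocity_def)
    have "integral {t - h..t} (curve_cost \<gamma>) + u t x \<le> u (t - h) (\<gamma> (t - h))"
      using value_along_optimal[OF opt, of "t - h" t] elim(2) t by (simp add: contact)
    then show ?case using elim(1,2) unfolding step by (simp add: algebra_simps)
  qed
qed

lemma past_cost_coercive:
  assumes h: "0 < h" "h < t"
  shows "h * ((norm (past_velocity h))\<^sup>2 / (4 * c_mu) - (coercivity_const + F_bound)) \<le> integral {t - h..t} (curve_cost \<gamma>)"
proof -
  let ?E = "integral {t - h..t} (\<lambda>s. (norm (velocity (apply_bcontfun \<gamma>) s))\<^sup>2)"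
  have "(norm (\<gamma> t - \<gamma> (t - h)))\<^sup>2 \<le> (t - (t - h)) * ?E"
    using h t by (intro power2_norm_integral_le Gamma_velocity(2)[OF optimal_in_Gamma[OF opt]]
        optimal_energy_integrable[OF opt]) auto
  moreover have "\<gamma> t - \<gamma> (t - h) = h *\<^sub>R past_velocity h" using h(1) contact by (simp add: past_velocity_def)
  ultimately have "h * (h * (norm (past_velocity h))\<^sup>2) \<le> h * ?E"
    using h(1) by (simp add: power_mult_distrib power2_eq_square ac_simps)
  then have "h * (norm (past_velocity h))\<^sup>2 / (4 * c_mu) \<le> ?E / (4 * c_mu)"
    using h(1) L1_mu by (simp add: divide_right_mono)
  moreover have "?E / (4 * c_mu) - h * (coercivity_const + F_bound) \<le> integral {t - h..t} (curve_cost \<gamma>)"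
    using optimal_energy_le_cost[OF opt, of "t - h" t] h t by simp
  ultimately show ?thesis by (simp add: right_diff_distrib)
qed

lemma past_velocity_bounded:
  assumes p: "(p\<^sub>1, p\<^sub>2) \<in> superdiff \<Omega> T u t x"
  obtains B where "\<forall>\<^sub>F h in at_right 0. norm (past_velocity h) \<le> B"
proof -
  define k\<^sub>0 where "k\<^sub>0 = \<bar>coercivity_const + F_bound\<bar> + \<bar>p\<^sub>1\<bar> + 1"
  define k\<^sub>1 where "k\<^sub>1 = norm p\<^sub>2 + 1"
  have k: "0 \<le> k\<^sub>0" "0 \<le> k\<^sub>1" by (auto simp: k\<^sub>0_def k\<^sub>1_def)
  from past_cost_superdiff[OF p zero_less_one] eventually_window
  have "\<forall>\<^sub>F h in at_right 0. norm (past_velocity h) \<le> max 1 (4 * c_mu * (k\<^sub>0 + k\<^sub>1))"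
  proof eventually_elim
    case (elim h)
    let ?n = "norm (past_velocity h)"
    show ?case
    proof (cases "?n \<le> 1")
      case False
      have "h * (?n\<^sup>2 / (4 * c_mu) - (coercivity_const + F_bound)) \<le>
          h * (- p\<^sub>1 - p\<^sub>2 \<bullet> past_velocity h + 1 * (1 + ?n))"
        by (rule order_trans[OF past_cost_coercive elim(1)]) (use elim(2) in auto)
      then have "?n\<^sup>2 / (4 * c_mu) - (coercivity_const + F_bound) \<le> - p\<^sub>1 - p\<^sub>2 \<bullet> past_velocity h + (1 + ?n)"
        using elim(2) by simp
      moreover have "- (p\<^sub>2 \<bullet> past_velocity h) \<le> norm p\<^sub>2 * ?n"
        using Cauchy_Schwarz_ineq2[of p\<^sub>2 "past_velocity h"] by linarith
      ultimately have "?n\<^sup>2 / (4 * c_mu) \<le> k\<^sub>0 * 1 + k\<^sub>1 * ?n"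
        by (simp add: k\<^sub>0_def k\<^sub>1_def algebra_simps)
      also have "\<dots> \<le> k\<^sub>0 * ?n + k\<^sub>1 * ?n"
        using False k by (intro add_right_mono mult_left_mono) auto
      finally have "?n * ?n \<le> (4 * c_mu * (k\<^sub>0 + k\<^sub>1)) * ?n"
        using L1_mu by (simp add: power2_eq_square field_simps)
      then have "?n \<le> 4 * c_mu * (k\<^sub>0 + k\<^sub>1)"
        using False by (simp only: mult_le_cancel_right_pos)
      then show ?thesis by simp
    qed simp
  qed
  then show ?thesis by (rule that)
qed

lemma past_cost_expansion:
  assumes "\<epsilon> > 0"
  shows "\<forall>\<^sub>F h in at_right 0.
    h * (L x (past_velocity h) + F x (m t) - \<epsilon> * (2 + 2 * (norm (past_velocity h))\<^sup>2))
      \<le> integral {t - h..t} (curve_cost \<gamma>)"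
proof -
  define \<delta> where "\<delta> = min \<epsilon> (1 / (4 * c_mu))"
  have \<delta>: "\<delta> > 0" "\<delta> \<le> \<epsilon>" "0 \<le> 1 / (2 * c_mu) - 2 * \<delta>"
    using assms L1_mu by (auto simp: \<delta>_def min_le_iff_disj)
  obtain R \<rho> where R: "ball x R \<subseteq> U" and \<rho>: "0 < \<rho>" "2 * \<rho> < R" "lipschitz_const * (2 * \<rho>) \<le> \<delta>"
    and F_near: "\<And>s y. s \<in> {0..T} \<Longrightarrow> y \<in> closure \<Omega> \<Longrightarrow> \<bar>s - t\<bar> \<le> \<rho> \<Longrightarrow> norm (y - x) \<le> 2 * \<rho> \<Longrightarrow>
      \<bar>F y (m s) - F x (m t)\<bar> \<le> \<delta>"
    by (rule bump_scale[OF \<delta>(1)]) (rule that)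
  define \<kappa> where "\<kappa> = lipschitz_const * (2 * \<rho>)"
  have "\<forall>\<^sub>F h in at_right 0. h < \<rho>" using \<rho>(1) by (rule eventually_at_rightI[rotated]) auto
  with eventually_window eventually_near_contact[OF \<rho>(1)]
  show ?thesis
  proof eventually_elim
    case (elim h)
    let ?a = "t - h" and ?w = "past_velocity h" and ?v = "velocity (apply_bcontfun \<gamma>)"
    let ?E = "integral {?a..t} (\<lambda>s. (norm (?v s - ?w))\<^sup>2)"
    have a: "0 \<le> ?a" "?a < t" "t \<le> T" using elim t by auto
    have near: "norm (\<gamma> s - x) \<le> 2 * \<rho>" if "s \<in> {?a..t}" for s
      using elim(2)[rule_format, of s] that \<rho>(1) by auto
    have F_\<gamma>: "\<bar>F (\<gamma> s) (m s) - F x (m t)\<bar> \<le> \<delta>" if "s \<in> {?a..t}" for s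
      using that a elim near by (intro F_near optimal_in_closure) auto
    have "?w = (\<gamma> t - \<gamma> ?a) /\<^sub>R (t - ?a)" by (simp add: past_velocity_def contact)
    from optimal_cost_expansion[OF opt a R \<rho>(2) \<kappa>_def near F_\<gamma> this]
    have "h * (L x ?w + F x (m t) - \<delta> - \<kappa> * (1 + 2 * (norm ?w)\<^sup>2)) + (1 / (2 * c_mu) - 2 * \<kappa>) * ?E
        \<le> integral {?a..t} (curve_cost \<gamma>)" by simp
    moreover have "0 \<le> (1 / (2 * c_mu) - 2 * \<kappa>) * ?E"
      using \<delta>(3) \<rho>(3) velocity_deviation_integrable[OF a(1) less_imp_le[OF a(2)] a(3)]
      by (intro mult_nonneg_nonneg integral_nonneg) (auto simp: \<kappa>_def)
    moreover have "h * (L x ?w + F x (m t) - \<epsilon> * (2 + 2 * (norm ?w)\<^sup>2)) \<le>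
        h * (L x ?w + F x (m t) - \<delta> - \<kappa> * (1 + 2 * (norm ?w)\<^sup>2))"
    proof (rule mult_left_mono)
      have "\<kappa> * (1 + 2 * (norm ?w)\<^sup>2) \<le> \<epsilon> * (1 + 2 * (norm ?w)\<^sup>2)"
        using \<delta>(2) \<rho>(3) by (intro mult_right_mono) (auto simp: \<kappa>_def)
      then show "L x ?w + F x (m t) - \<epsilon> * (2 + 2 * (norm ?w)\<^sup>2) \<le> L x ?w + F x (m t) - \<delta> - \<kappa> * (1 + 2 * (norm ?w)\<^sup>2)"
        using \<delta>(2) by (simp add: algebra_simps)
    qed (use elim in simp)
    ultimately show ?case by linarith
  qed
qed

lemma past_velocity_subsolution:
  assumes p: "(p\<^sub>1, p\<^sub>2) \<in> superdiff \<Omega> T u t x" and B: "\<forall>\<^sub>F h in at_right 0. norm (past_velocity h) \<le> B" and "\<epsilon> > 0"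
  shows "\<forall>\<^sub>F h in at_right 0. equation_defect p\<^sub>1 p\<^sub>2 (past_velocity h) \<le> \<epsilon> * (3 + B + 2 * B\<^sup>2)"
  using past_cost_superdiff[OF p \<open>\<epsilon> > 0\<close>] past_cost_expansion[OF \<open>\<epsilon> > 0\<close>] B eventually_window
proof eventually_elim
  case (elim h)
  let ?w = "past_velocity h"
  have "h * (L x ?w + F x (m t) - \<epsilon> * (2 + 2 * (norm ?w)\<^sup>2)) \<le> h * (- p\<^sub>1 - p\<^sub>2 \<bullet> ?w + \<epsilon> * (1 + norm ?w))"
    using elim(1,2) by linarith
  then have "L x ?w + F x (m t) - \<epsilon> * (2 + 2 * (norm ?w)\<^sup>2) \<le> - p\<^sub>1 - p\<^sub>2 \<bullet> ?w + \<epsilon> * (1 + norm ?w)"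
    using elim(4) by simp
  then have "equation_defect p\<^sub>1 p\<^sub>2 ?w \<le> \<epsilon> * (3 + norm ?w + 2 * (norm ?w)\<^sup>2)"
    by (simp add: equation_defect_def algebra_simps)
  also have "\<dots> \<le> \<epsilon> * (3 + B + 2 * B\<^sup>2)"
    using elim(3) \<open>\<epsilon> > 0\<close> by (intro mult_left_mono add_mono power_mono) auto
  finally show ?case .
qed

text \<open>The forward mean velocity over \<open>[t, t + h]\<close> is twice the chord velocity minus the past one, so both
  have the same limit \<open>w\<close>; the secants at \<open>x\<close> then show \<open>-w\<close> and \<open>w\<close> to be non-outward.\<close>
lemma past_velocity_limit_tangential:
  assumes h: "filterlim h (at_right 0) sequentially" and w: "(\<lambda>n. past_velocity (h n)) \<longlonglongrightarrow> w"
    and B: "\<forall>\<^sub>F h in at_right 0. norm (past_velocity h) \<le> B"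
  shows "g x \<bullet> w = 0"
proof (rule antisym)
  have h0: "h \<longlonglongrightarrow> 0" using h by (simp add: filterlim_at)
  have window: "\<forall>\<^sub>F n in sequentially. 0 < h n \<and> h n < t \<and> t + h n < T"
    using eventually_window h by (rule eventually_compose_filterlim)
  then have h_pos: "\<forall>\<^sub>F n in sequentially. 0 < h n" by eventually_elim simp
  have "g x \<bullet> (- w) \<le> 0"
  proof (rule inner_gradient_limit_secant_nonpos[OF h0 h_pos tendsto_minus[OF w]])
    show "\<forall>\<^sub>F n in sequentially. x + h n *\<^sub>R (- past_velocity (h n)) \<in> closure \<Omega>"
      using window by eventually_elim (use t optimal_in_closure in \<open>auto simp: past_velocity_def\<close>)
  qed simp
  then show "0 \<le> g x \<bullet> w" by simp
  have "(\<lambda>n. past_velocity (h n) - 2 *\<^sub>R (past_velocity (h n) - chord_velocity (h n))) \<longlonglongrightarrow> w - 2 *\<^sub>R 0"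
    by (intro tendsto_intros w filterlim_compose[OF past_minus_chord_velocity_tendsto_0[OF B] h])
  moreover have "p - 2 *\<^sub>R (p - c) = 2 *\<^sub>R c - p" for p c :: 'a by (simp add: scaleR_2)
  ultimately have forward: "(\<lambda>n. 2 *\<^sub>R chord_velocity (h n) - past_velocity (h n)) \<longlonglongrightarrow> w" by simp
  show "g x \<bullet> w \<le> 0"
  proof (rule inner_gradient_limit_secant_nonpos[OF h0 h_pos forward])
    show "\<forall>\<^sub>F n in sequentially. x + h n *\<^sub>R (2 *\<^sub>R chord_velocity (h n) - past_velocity (h n)) \<in> closure \<Omega>"
      using window
    proof eventually_elim
      case (elim n)
      have "h n *\<^sub>R past_velocity (h n) = x - \<gamma> (t - h n)" "(h n * 2) *\<^sub>R chord_velocity (h n) = \<gamma> (t + h n) - \<gamma> (t - h n)"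
        using elim by (auto simp: past_velocity_def chord_velocity_def)
      then have "x + h n *\<^sub>R (2 *\<^sub>R chord_velocity (h n) - past_velocity (h n)) = \<gamma> (t + h n)"
        by (simp add: scaleR_diff_right)
      then show ?case using elim t by (auto intro: optimal_in_closure)
    qed
  qed simp
qed

lemma tangential_subsolution_exists:
  assumes p: "(p\<^sub>1, p\<^sub>2) \<in> superdiff \<Omega> T u t x"
  obtains w where "g x \<bullet> w = 0" "equation_defect p\<^sub>1 p\<^sub>2 w \<le> 0"
proof -
  obtain B where B: "\<forall>\<^sub>F h in at_right 0. norm (past_velocity h) \<le> B"
    by (rule past_velocity_bounded[OF p])
  obtain h w where h: "filterlim h (at_right 0) sequentially" and w: "(\<lambda>n. past_velocity (h n)) \<longlonglongrightarrow> w"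
    by (rule bounded_at_right_cluster_point[OF B])
  have "equation_defect p\<^sub>1 p\<^sub>2 w \<le> \<epsilon> * (3 + B + 2 * B\<^sup>2)" if "\<epsilon> > 0" for \<epsilon>
    using eventually_compose_filterlim[OF past_velocity_subsolution[OF p B that] h]
    by (intro tendsto_upperbound[OF equation_defect_tendsto[OF w]]) auto
  then have "equation_defect p\<^sub>1 p\<^sub>2 w \<le> 0" by (rule nonpos_if_le_small_multiples)
  with past_velocity_limit_tangential[OF h w B] show ?thesis by (rule that)
qed

lemma inward_ray:
  assumes w: "g x \<bullet> w < 0"
  obtains b where "t < b" "b < T" "\<And>s. s \<in> {t..b} \<Longrightarrow> x + (s - t) *\<^sub>R w \<in> closure \<Omega>"
proof -
  obtain d where d: "d > 0" "\<And>h. 0 < h \<Longrightarrow> h < d \<Longrightarrow> x + h *\<^sub>R w \<in> closure \<Omega>"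
    using inward_segment_in_closure[OF w] unfolding eventually_at_right_field by auto
  define b where "b = t + min d (T - t) / 2"
  have b: "t < b" "b < T" "b < t + d" unfolding b_def using d(1) t by (auto simp: min_def field_simps)
  show ?thesis
  proof (rule that[OF b(1,2)])
    show "x + (s - t) *\<^sub>R w \<in> closure \<Omega>" if "s \<in> {t..b}" for s
      using d(2)[of "s - t"] b(3) that contact_in_closure by (cases "s = t") auto
  qed
qed

lemma value_along_ray:
  assumes "s \<in> {t..T}" and inside: "\<And>r. r \<in> {t..s} \<Longrightarrow> x + (r - t) *\<^sub>R w \<in> closure \<Omega>"
  shows "u t x \<le> integral {t..s} (running_cost (\<lambda>r. x + (r - t) *\<^sub>R w) (\<lambda>_. w)) + u s (x + (s - t) *\<^sub>R w)"
proof -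
  let ?q = "\<lambda>r. x + (r - t) *\<^sub>R w"
  have ab: "0 \<le> t" "t \<le> s" "s \<le> T" using assms(1) t by auto
  have deriv: "(?q has_vector_derivative w) (at r within {t..s})" for r
    by (auto intro!: derivative_eq_intros)
  obtain c where c: "c \<in> Gamma \<Omega> T" "\<And>r. r \<in> {t..s} \<Longrightarrow> apply_bcontfun c r = ?q r"
    "curve_cost c absolutely_integrable_on {t..s}"
    "(running_cost ?q (\<lambda>_. w) has_integral integral {t..s} (curve_cost c)) {t..s}"
    by (rule C1_competitor[OF ab deriv _ inside]) (auto intro: that)
  then show ?thesis
    using value_dynamic_programming[OF ab c(1,3)] integral_unique[OF c(4)] c(2)[of t] c(2)[of s] ab by simp
qed

lemma inward_supersolution:
  assumes p: "(p\<^sub>1, p\<^sub>2) \<in> superdiff \<Omega> T u t x" and w: "g x \<bullet> w < 0"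
  shows "0 \<le> equation_defect p\<^sub>1 p\<^sub>2 w"
proof -
  let ?q = "\<lambda>s. x + (s - t) *\<^sub>R w"
  let ?c = "running_cost ?q (\<lambda>_. w)"
  obtain b where b: "t < b" "b < T" and inside: "\<And>s. s \<in> {t..b} \<Longrightarrow> ?q s \<in> closure \<Omega>"
    by (rule inward_ray[OF w]) (rule that)
  have "continuous_on {t..b} ?c"
    using b t inside closure_subset_U by (intro continuous_on_running_cost continuous_intros) auto
  from average_tendsto_at_right[OF this b(1)]
  have average: "((\<lambda>h. integral {t..t + h} ?c / h) \<longlongrightarrow> L x w + F x (m t)) (at_right 0)"
    by (simp add: running_cost_def)
  have "((\<lambda>h. t + h) \<longlongrightarrow> t + 0) (at_right 0)" "((\<lambda>h. x + h *\<^sub>R w) \<longlongrightarrow> x + 0 *\<^sub>R w) (at_right 0)"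
    by (intro tendsto_intros)+
  then have lim: "((\<lambda>h. t + h) \<longlongrightarrow> t) (at_right 0)" "((\<lambda>h. x + h *\<^sub>R w) \<longlongrightarrow> x) (at_right 0)" by simp_all
  have short: "\<forall>\<^sub>F h in at_right 0. 0 < h \<and> h < b - t"
    using b(1) unfolding eventually_at_right_field by (intro exI[of _ "b - t"]) auto
  then have dom: "\<forall>\<^sub>F h in at_right 0. t + h \<in> {0<..<T} \<and> x + h *\<^sub>R w \<in> closure \<Omega>"
  proof eventually_elim
    case (elim h)
    then show ?case using inside[of "t + h"] b t by simp
  qed
  have "- equation_defect p\<^sub>1 p\<^sub>2 w \<le> \<epsilon> * (1 + norm w)" if "\<epsilon> > 0" for \<epsilon>
  proof -
    from superdiff_eventually[OF p that lim dom] short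
    have "\<forall>\<^sub>F h in at_right 0. - (p\<^sub>1 + p\<^sub>2 \<bullet> w + \<epsilon> * (1 + norm w)) \<le> integral {t..t + h} ?c / h"
    proof eventually_elim
      case (elim h)
      have "u t x \<le> integral {t..t + h} ?c + u (t + h) (x + h *\<^sub>R w)"
        using value_along_ray[of "t + h" w] elim(2) b(2) inside by simp
      with elim have "- (p\<^sub>1 + p\<^sub>2 \<bullet> w + \<epsilon> * (1 + norm w)) * h \<le> integral {t..t + h} ?c"
        by (simp add: algebra_simps)
      then show ?case using elim(2) by (simp add: pos_le_divide_eq)
    qed
    then have "- (p\<^sub>1 + p\<^sub>2 \<bullet> w + \<epsilon> * (1 + norm w)) \<le> L x w + F x (m t)"
      by (intro tendsto_lowerbound[OF average]) auto
    then show ?thesis by (simp add: equation_defect_def)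
  qed
  then have "- equation_defect p\<^sub>1 p\<^sub>2 w \<le> 0" by (rule nonpos_if_le_small_multiples)
  then show ?thesis by simp
qed

lemma tangential_supersolution:
  assumes p: "(p\<^sub>1, p\<^sub>2) \<in> superdiff \<Omega> T u t x" and w: "g x \<bullet> w = 0"
  shows "0 \<le> equation_defect p\<^sub>1 p\<^sub>2 w"
proof (rule tendsto_lowerbound[OF equation_defect_tendsto])
  have "((\<lambda>\<epsilon>. w - \<epsilon> *\<^sub>R g x) \<longlongrightarrow> w - 0 *\<^sub>R g x) (at_right 0)" by (intro tendsto_intros)
  then show "((\<lambda>\<epsilon>. w - \<epsilon> *\<^sub>R g x) \<longlongrightarrow> w) (at_right 0)" by simp
  show "\<forall>\<^sub>F \<epsilon> in at_right 0. 0 \<le> equation_defect p\<^sub>1 p\<^sub>2 (w - \<epsilon> *\<^sub>R g x)"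
    using eventually_at_right_less[of 0]
    by eventually_elim
      (use w gradient_nonzero[OF center_in_ball] in \<open>intro inward_supersolution[OF p], simp add: inner_diff_right\<close>)
qed simp

lemma tangential_equation:
  assumes p: "(p\<^sub>1, p\<^sub>2) \<in> superdiff \<Omega> T u t x" and \<nu>: "outward_normal \<Omega> x = normal"
  shows "- p\<^sub>1 + tangential_Hamiltonian \<Omega> L x p\<^sub>2 = F x (m t)"
proof -
  have tangent: "v \<bullet> outward_normal \<Omega> x = 0 \<longleftrightarrow> g x \<bullet> v = 0" for v
    using gradient_nonzero[OF center_in_ball] by (simp add: \<nu> normal_def inner_commute)
  obtain w where w: "g x \<bullet> w = 0" "equation_defect p\<^sub>1 p\<^sub>2 w \<le> 0"
    by (rule tangential_subsolution_exists[OF p])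
  have upper: "- (p\<^sub>2 \<bullet> v) - L x v \<le> p\<^sub>1 + F x (m t)" if "v \<in> {v. v \<bullet> outward_normal \<Omega> x = 0}" for v
    using tangential_supersolution[OF p, of v] that tangent by (simp add: equation_defect_def)
  have "tangential_Hamiltonian \<Omega> L x p\<^sub>2 \<le> p\<^sub>1 + F x (m t)"
    unfolding tangential_Hamiltonian_def by (rule cSUP_least) (use w tangent upper in auto)
  moreover have "- (p\<^sub>2 \<bullet> w) - L x w \<le> tangential_Hamiltonian \<Omega> L x p\<^sub>2"
    unfolding tangential_Hamiltonian_def
    by (rule cSUP_upper) (use w tangent upper in \<open>auto intro!: bdd_aboveI2\<close>)
  ultimately show ?thesis using w(2) by (simp add: equation_defect_def)
qed

end

lemma outward_normal_chart:
  assumes "C2_boundary \<Omega>" "x \<in> frontier \<Omega>"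
  obtains r \<psi> g where "local_defining_fn \<Omega> x r \<psi> g" "outward_normal \<Omega> x = g x /\<^sub>R norm (g x)"
proof -
  have "\<exists>\<nu> r \<psi> g. local_defining_fn \<Omega> x r \<psi> g \<and> \<nu> = g x /\<^sub>R norm (g x)"
    using assms unfolding C2_boundary_def by blast
  then have "\<exists>r \<psi> g. local_defining_fn \<Omega> x r \<psi> g \<and> outward_normal \<Omega> x = g x /\<^sub>R norm (g x)"
    unfolding outward_normal_def by (rule someI_ex)
  then show ?thesis using that by blast
qed

theorem theorem4p12:
  fixes \<Omega> U :: "'a::euclidean_space set"
    and T kappa M c_mu :: real
    and L :: "'a \<Rightarrow> 'a \<Rightarrow> real"
    and Lx Lv :: "'a \<Rightarrow> 'a \<Rightarrow> 'a"
    and Lvx Lvv :: "'a \<Rightarrow> 'a \<Rightarrow> 'a \<Rightarrow> 'a"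
    and F G :: "'a \<Rightarrow> 'a measure \<Rightarrow> real"
    and u :: "real \<Rightarrow> 'a \<Rightarrow> real"
    and m :: "real \<Rightarrow> 'a measure"
    and t :: real and x :: 'a
  assumes T_pos: "T > 0"
    and Omega: "bounded \<Omega>" "open \<Omega>" "C2_boundary \<Omega>"
    and U: "open U" "closure \<Omega> \<subseteq> U"
    \<comment> \<open>(D1)\<close>
    and D1: "\<forall>y\<in>U. \<forall>m1\<in>Prob_on (closure \<Omega>). \<forall>m2\<in>Prob_on (closure \<Omega>).
               \<bar>F y m1 - F y m2\<bar> + \<bar>G y m1 - G y m2\<bar> \<le> kappa * KR_dist m1 m2"
    \<comment> \<open>(D2)\<close>
    and D2: "\<forall>\<mu>\<in>Prob_on (closure \<Omega>). \<exists>DF DG.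
               (\<forall>y\<in>U. ((\<lambda>z. F z \<mu>) has_derivative (\<lambda>h. DF y \<bullet> h)) (at y)) \<and>
               (\<forall>y\<in>U. ((\<lambda>z. G z \<mu>) has_derivative (\<lambda>h. DG y \<bullet> h)) (at y)) \<and>
               continuous_on U DF \<and> continuous_on U DG \<and>
               bounded ((\<lambda>z. F z \<mu>) ` U) \<and> bounded ((\<lambda>z. G z \<mu>) ` U) \<and>
               (\<forall>y\<in>U. norm (DF y) + norm (DG y) \<le> kappa)"
    \<comment> \<open>(D3)\<close>
    and D3: "\<exists>C. \<forall>\<mu>\<in>Prob_on (closure \<Omega>). semiconcave_lin U C (\<lambda>z. F z \<mu>)"
    \<comment> \<open>(L0)\<close>
    and L0_C1: "\<forall>y\<in>U. \<forall>v. ((\<lambda>(z, w). L z w) has_derivative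
                   (\<lambda>(h, k). Lx y v \<bullet> h + Lv y v \<bullet> k)) (at (y, v))"
    and L0_cont: "continuous_on (U \<times> UNIV) (\<lambda>(z, w). Lx z w)"
                 "continuous_on (U \<times> UNIV) (\<lambda>(z, w). Lv z w)"
    and L0_bound: "\<forall>y\<in>U. \<bar>L y 0\<bar> + norm (Lx y 0) + norm (Lv y 0) \<le> M"
    \<comment> \<open>(L1)\<close>
    and L1_diff: "\<forall>y\<in>U. \<forall>v. ((\<lambda>(z, w). Lv z w) has_derivative
                   (\<lambda>(h, k). Lvx y v h + Lvv y v k)) (at (y, v))"
    and L1_mu: "c_mu > 0"
    and L1_vv: "\<forall>y\<in>U. \<forall>v k. (norm k)\<^sup>2 / c_mu \<le> Lvv y v k \<bullet> k \<and> Lvv y v k \<bullet> k \<le> c_mu * (norm k)\<^sup>2"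
    and L1_vx: "\<forall>y\<in>U. \<forall>v h. norm (Lvx y v h) \<le> c_mu * (1 + norm v) * norm h"
    \<comment> \<open>(L2)\<close>
    and L2: "\<forall>R. \<exists>C. \<forall>y\<in>U. \<forall>v\<in>cball 0 R. \<forall>w\<in>cball 0 R. norm (Lx y v - Lx y w) \<le> C * norm (v - w)"
    \<comment> \<open>(L3)\<close>
    and L3: "\<forall>R. \<exists>C. \<forall>v\<in>cball 0 R. semiconcave_lin U C (\<lambda>z. L z v)"
    \<comment> \<open>mild solution and boundary point\<close>
    and mild: "mild_solution \<Omega> T L F G u m"
    and tx: "(t, x) \<in> boundary_Q \<Omega> T m"
  shows "\<forall>(p1, p2)\<in>superdiff \<Omega> T u t x.
           - p1 + tangential_Hamiltonian \<Omega> L x p2 = F x (m t)"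
proof -
  have t: "0 < t" "t < T" and x: "x \<in> frontier \<Omega>" "x \<in> msupport (m t)"
    using tx by (auto simp: boundary_Q_def)
  have m: "\<forall>t\<in>{0..T}. m t \<in> Prob_on (closure \<Omega>)"
    "\<forall>t\<in>{0..T}. \<forall>\<epsilon>>0. \<exists>\<delta>>0. \<forall>s\<in>{0..T}. \<bar>s - t\<bar> < \<delta> \<longrightarrow> KR_dist (m s) (m t) < \<epsilon>"
    using mild unfolding mild_solution_def by blast+
  interpret mfg_solution U M c_mu L Lx Lv Lvx Lvv \<Omega> T kappa F G m u
    by unfold_locales (fact assms m)+
  obtain \<gamma> where \<gamma>: "optimal \<gamma>" "apply_bcontfun \<gamma> t = x"
    by (rule optimal_curve_through[of t x]) (use t x(2) in auto)
  obtain r \<psi> g where \<psi>: "local_defining_fn \<Omega> x r \<psi> g" and \<nu>: "outward_normal \<Omega> x = g x /\<^sub>R norm (g x)"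
    by (rule outward_normal_chart[OF Omega(3) x(1)])
  interpret mfg_contact U M c_mu L Lx Lv Lvx Lvv \<Omega> T kappa F G m u x r \<psi> g \<gamma> t
    by unfold_locales (fact \<psi> Omega(2) x(1) \<gamma> t)+
  have "outward_normal \<Omega> x = normal" using \<nu> by (simp only: normal_def)
  then show ?thesis using tangential_equation by blast
qed

end
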